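(* Let $(\mathfrak g,J)$ be a real Lie algebra of real dimension $2n$ with integrable complex structure such that $H^{2n}(\mathfrak g_{\mathbb C},\mathbb C)\cong\mathbb C$, and let $(E,I)$ be a finite-dimensional integrable or anti-integrable $(\mathfrak g,J)$-module. Then the pairing \[H^{p,q}(\mathfrak g,E)\times H^{n-p,n-q}(\mathfrak g,E^* )\to\Lambda^{n,n}\mathfrak g^*=\mathbb C\cdot vol\cong\mathbb C,\qquad(\alpha,\beta)\mapsto\alpha\wedge\beta,\] is well defined and non-degenerate.
   Context: Complex structure on $\mathfrak g$: $J^2=-\mathrm{id}$ and $[x,y]-[Jx,Jy]+J[Jx,y]+J[x,Jy]=0$. $\mathfrak g_{\mathbb C}=\mathfrak g^{1,0}\oplus\mathfrak g^{0,1}$, $E_{\mathbb C}=E^{1,0}\oplus E^{0,1}$ are the $\pm i$-eigenspace decompositions; $\Lambda^{p,q}\mathfrak g^*=\Lambda^p(\mathfrak g^{1,0})^*\otimes\Lambda^q(\mathfrak g^{0,1})^*$. $(E,I)$ with representation $\rho$ is integrable if $[I,\rho(Jx)]+I[\rho(x),I]=0$ for all $x$, anti-integrable if $(E,-I)$ is integrable. $\mathfrak g^{0,1}$ acts on $E^{1,0}$ by $\bar X\cdot V=(\rho(\bar X)V)^{1,0}$ (integrable case) resp. $\rho(\bar X)V$ (anti-integrable case), and on $\Lambda^p(\mathfrak g^{1,0})^*$ via the coadjoint action; $H^{p,q}(\mathfrak g,E):=H^q(\mathfrak g^{0,1},\Lambda^p(\mathfrak g^{1,0})^*\otimes E^{1,0})$,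 computed by the Chevalley–Eilenberg complex on $\Lambda^{p,\bullet}\mathfrak g^*\otimes E^{1,0}$. The dual $E^*$ carries the module structure $(x\cdot\phi)(v)=-\phi(x\cdot v)$ and complex structure $\phi\mapsto\phi\circ I$, so $(E^* )^{1,0}\cong(E^{1,0})^*$. The wedge $\alpha\wedge\beta$ uses the exterior product on $\Lambda^{\bullet,\bullet}\mathfrak g^*$ and the evaluation $E^{1,0}\otimes(E^* )^{1,0}\to\mathbb C$; $vol$ is a generator of $\Lambda^{2n}\mathfrak g_{\mathbb C}^*$. *)

theory Defs
  imports "HOL-Analysis.Analysis" "HOL-Combinatorics.Permutations"
begin

definition fin_dim :: "'a::real_vector set \<Rightarrow> bool" where
  "fin_dim V \<longleftrightarrow> (\<exists>B. finite B \<and> B \<subseteq> V \<and> span B = V)"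

definition lie_algebra :: "('g::real_vector \<Rightarrow> 'g \<Rightarrow> 'g) \<Rightarrow> bool" where
  "lie_algebra br \<longleftrightarrow>
     (\<forall>x. linear (br x)) \<and> (\<forall>y. linear (\<lambda>x. br x y)) \<and> (\<forall>x. br x x = 0) \<and>
     (\<forall>x y z. br x (br y z) + br y (br z x) + br z (br x y) = 0)"

definition complex_structure :: "('a::real_vector \<Rightarrow> 'a) \<Rightarrow> bool" where
  "complex_structure J \<longleftrightarrow> linear J \<and> (\<forall>x. J (J x) = - x)"

definition integrable_cs :: "('g::real_vector \<Rightarrow> 'g \<Rightarrow> 'g) \<Rightarrow> ('g \<Rightarrow> 'g) \<Rightarrow> bool" where
  "integrable_cs br J \<longleftrightarrow> complex_structure J \<and>
     (\<forall>x y. br x y - br (J x) (J y) + J (br (J x) y) + J (br x (J y)) = 0)"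

definition lie_module :: "('g::real_vector \<Rightarrow> 'g \<Rightarrow> 'g) \<Rightarrow> ('g \<Rightarrow> 'e::real_vector \<Rightarrow> 'e) \<Rightarrow> bool" where
  "lie_module br rho \<longleftrightarrow>
     (\<forall>x. linear (rho x)) \<and> (\<forall>v. linear (\<lambda>x. rho x v)) \<and>
     (\<forall>x y v. rho (br x y) v = rho x (rho y v) - rho y (rho x v))"

definition integrable_module :: "('g \<Rightarrow> 'g) \<Rightarrow> ('g \<Rightarrow> 'e::real_vector \<Rightarrow> 'e) \<Rightarrow> ('e \<Rightarrow> 'e) \<Rightarrow> bool" where
  "integrable_module J rho I \<longleftrightarrow>
     (\<forall>x v. (I (rho (J x) v) - rho (J x) (I v)) + I (rho x (I v) - I (rho x v)) = 0)"

definition anti_integrable_module :: "('g \<Rightarrow> 'g) \<Rightarrow> ('g \<Rightarrow> 'e::real_vector \<Rightarrow> 'e) \<Rightarrow> ('e \<Rightarrow> 'e) \<Rightarrow> bool" where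
  "anti_integrable_module J rho I \<longleftrightarrow> integrable_module J rho (\<lambda>v. - I v)"

section \<open>Dual module E* (as bounded = linear functionals, E finite-dimensional)\<close>

definition dual_rho :: "('g \<Rightarrow> 'e::real_normed_vector \<Rightarrow> 'e) \<Rightarrow> 'g \<Rightarrow> ('e \<Rightarrow>\<^sub>L real) \<Rightarrow> ('e \<Rightarrow>\<^sub>L real)" where
  "dual_rho rho x \<phi> = - (\<phi> o\<^sub>L Blinfun (rho x))"

definition dual_cs :: "('e::real_normed_vector \<Rightarrow> 'e) \<Rightarrow> ('e \<Rightarrow>\<^sub>L real) \<Rightarrow> ('e \<Rightarrow>\<^sub>L real)" where
  "dual_cs I \<phi> = \<phi> o\<^sub>L Blinfun I"

definition del_arg :: "nat \<Rightarrow> (nat \<Rightarrow> 'a) \<Rightarrow> (nat \<Rightarrow> 'a)" where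
  "del_arg i ys = (\<lambda>k. if k < i then ys k else ys (Suc k))"

definition cons_arg :: "'a \<Rightarrow> (nat \<Rightarrow> 'a) \<Rightarrow> (nat \<Rightarrow> 'a)" where
  "cons_arg a ys = (\<lambda>k. if k = 0 then a else ys (k - 1))"

text \<open>Model (canonical C-linear identifications):
  g^{1,0} = (g,J) via x |-> (x - iJx)/2,  g^{0,1} = (g,-J) via y |-> (y + iJy)/2,
  V^{1,0} = (V,I_V) via v |-> (v - i I_V v)/2.
  An element of Hom(Lambda^q g^{0,1}, Lambda^p (g^{1,0})^* (x) V^{1,0}) is thus a map
  phi ys xs (ys: the q arguments from g^{0,1}, xs: the p arguments from g^{1,0}),
  real multilinear, alternating in each group, and complex linear in the above sense.\<close>

definition dcochain :: "('g::real_vector \<Rightarrow> 'g) \<Rightarrow> ('v::real_vector \<Rightarrow> 'v) \<Rightarrow> nat \<Rightarrow> nat \<Rightarrow>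
    ((nat \<Rightarrow> 'g) \<Rightarrow> (nat \<Rightarrow> 'g) \<Rightarrow> 'v) \<Rightarrow> bool" where
  "dcochain J Iv p q \<phi> \<longleftrightarrow>
     (\<forall>ys ys' xs xs'. (\<forall>i<q. ys i = ys' i) \<longrightarrow> (\<forall>j<p. xs j = xs' j) \<longrightarrow> \<phi> ys xs = \<phi> ys' xs') \<and>
     (\<forall>ys xs i. i < q \<longrightarrow> linear (\<lambda>y. \<phi> (ys(i := y)) xs)) \<and>
     (\<forall>ys xs j. j < p \<longrightarrow> linear (\<lambda>x. \<phi> ys (xs(j := x)))) \<and>
     (\<forall>ys xs i i'. i < q \<longrightarrow> i' < q \<longrightarrow> i \<noteq> i' \<longrightarrow> ys i = ys i' \<longrightarrow> \<phi> ys xs = 0) \<and>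
     (\<forall>ys xs j j'. j < p \<longrightarrow> j' < p \<longrightarrow> j \<noteq> j' \<longrightarrow> xs j = xs j' \<longrightarrow> \<phi> ys xs = 0) \<and>
     (\<forall>ys xs i. i < q \<longrightarrow> \<phi> (ys(i := J (ys i))) xs = - Iv (\<phi> ys xs)) \<and>
     (\<forall>ys xs j. j < p \<longrightarrow> \<phi> ys (xs(j := J (xs j))) = Iv (\<phi> ys xs))"

text \<open>Bracket of g^{0,1} transported to g: [a(y),a(y')] = a(([y,y'] - [Jy,Jy'])/2).\<close>
definition br01 :: "('g::real_vector \<Rightarrow> 'g \<Rightarrow> 'g) \<Rightarrow> ('g \<Rightarrow> 'g) \<Rightarrow> 'g \<Rightarrow> 'g \<Rightarrow> 'g" where
  "br01 br J y y' = (1/2) *\<^sub>R (br y y' - br (J y) (J y'))"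

text \<open>Action of g^{0,1} on g^{1,0}: Ybar . X = [Ybar, X]^{1,0} (coadjoint action is its negative transpose).\<close>
definition act10 :: "('g::real_vector \<Rightarrow> 'g \<Rightarrow> 'g) \<Rightarrow> ('g \<Rightarrow> 'g) \<Rightarrow> 'g \<Rightarrow> 'g \<Rightarrow> 'g" where
  "act10 br J y x = (1/4) *\<^sub>R (br y x + br (J y) (J x) + J (br (J y) x) - J (br y (J x)))"

text \<open>Action of g^{0,1} on V^{1,0}: Ybar . V = (rho(Ybar) V)^{1,0}.  In the anti-integrable
  case rho(Ybar)V already lies in V^{1,0}, so this formula covers both cases.\<close>
definition actV :: "('g \<Rightarrow> 'v::real_vector \<Rightarrow> 'v) \<Rightarrow> ('g \<Rightarrow> 'g) \<Rightarrow> ('v \<Rightarrow> 'v) \<Rightarrow> 'g \<Rightarrow> 'v \<Rightarrow> 'v" where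
  "actV rho J Iv y v = (1/4) *\<^sub>R (rho y v + rho (J y) (Iv v) + Iv (rho (J y) v) - Iv (rho y (Iv v)))"

definition actM :: "('g::real_vector \<Rightarrow> 'g \<Rightarrow> 'g) \<Rightarrow> ('g \<Rightarrow> 'v::real_vector \<Rightarrow> 'v) \<Rightarrow> ('g \<Rightarrow> 'g) \<Rightarrow> ('v \<Rightarrow> 'v) \<Rightarrow>
    nat \<Rightarrow> 'g \<Rightarrow> ((nat \<Rightarrow> 'g) \<Rightarrow> 'v) \<Rightarrow> ((nat \<Rightarrow> 'g) \<Rightarrow> 'v)" where
  "actM br rho J Iv p y f = (\<lambda>xs. actV rho J Iv y (f xs) - (\<Sum>j<p. f (xs(j := act10 br J y (xs j)))))"

text \<open>Chevalley--Eilenberg differential of g^{0,1} with coefficients in Lambda^p (g^{1,0})^* (x) V^{1,0},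
  from degree q to degree q+1.\<close>
definition dbar :: "('g::real_vector \<Rightarrow> 'g \<Rightarrow> 'g) \<Rightarrow> ('g \<Rightarrow> 'v::real_vector \<Rightarrow> 'v) \<Rightarrow> ('g \<Rightarrow> 'g) \<Rightarrow> ('v \<Rightarrow> 'v) \<Rightarrow>
    nat \<Rightarrow> nat \<Rightarrow> ((nat \<Rightarrow> 'g) \<Rightarrow> (nat \<Rightarrow> 'g) \<Rightarrow> 'v) \<Rightarrow> ((nat \<Rightarrow> 'g) \<Rightarrow> (nat \<Rightarrow> 'g) \<Rightarrow> 'v)" where
  "dbar br rho J Iv p q \<phi> = (\<lambda>ys xs.
     (\<Sum>i\<le>q. ((-1::real) ^ i) *\<^sub>R actM br rho J Iv p (ys i) (\<phi> (del_arg i ys)) xs) +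
     (\<Sum>i\<le>q. \<Sum>j\<le>q. if i < j then ((-1::real) ^ (i + j)) *\<^sub>R
          \<phi> (cons_arg (br01 br J (ys i) (ys j)) (del_arg i (del_arg j ys))) xs else 0))"

definition dcocycles where
  "dcocycles br rho J Iv p q = {\<phi>. dcochain J Iv p q \<phi> \<and> dbar br rho J Iv p q \<phi> = (\<lambda>ys xs. 0)}"

definition dcoboundaries where
  "dcoboundaries br rho J Iv p q =
     (if q = 0 then {(\<lambda>ys xs. 0)} else dbar br rho J Iv p (q - 1) ` {\<phi>. dcochain J Iv p (q - 1) \<phi>})"

text \<open>Lambda^k g_C^* = real alternating k-forms on g with complex values.\<close>
definition cform :: "nat \<Rightarrow> ((nat \<Rightarrow> 'g::real_vector) \<Rightarrow> complex) \<Rightarrow> bool" where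
  "cform k \<omega> \<longleftrightarrow>
     (\<forall>xs xs'. (\<forall>j<k. xs j = xs' j) \<longrightarrow> \<omega> xs = \<omega> xs') \<and>
     (\<forall>xs j. j < k \<longrightarrow> linear (\<lambda>x. \<omega> (xs(j := x)))) \<and>
     (\<forall>xs j j'. j < k \<longrightarrow> j' < k \<longrightarrow> j \<noteq> j' \<longrightarrow> xs j = xs j' \<longrightarrow> \<omega> xs = 0)"

definition dCE :: "('g::real_vector \<Rightarrow> 'g \<Rightarrow> 'g) \<Rightarrow> nat \<Rightarrow> ((nat \<Rightarrow> 'g) \<Rightarrow> complex) \<Rightarrow> ((nat \<Rightarrow> 'g) \<Rightarrow> complex)" where
  "dCE br k \<omega> = (\<lambda>xs. \<Sum>i\<le>k. \<Sum>j\<le>k. if i < j then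
      (-1) ^ (i + j) * \<omega> (cons_arg (br (xs i) (xs j)) (del_arg i (del_arg j xs))) else 0)"

definition CE_cocycles where
  "CE_cocycles br k = {\<omega>. cform k \<omega> \<and> dCE br k \<omega> = (\<lambda>xs. 0)}"

definition CE_coboundaries where
  "CE_coboundaries br k = (if k = 0 then {(\<lambda>xs. 0)} else dCE br (k - 1) ` {\<omega>. cform (k - 1) \<omega>})"

definition CE_cohom_iso_C where
  "CE_cohom_iso_C br k \<longleftrightarrow>
     (\<exists>c \<in> CE_cocycles br k. c \<notin> CE_coboundaries br k \<and>
        (\<forall>z \<in> CE_cocycles br k. \<exists>a::complex. (\<lambda>xs. z xs - a * c xs) \<in> CE_coboundaries br k))"

definition shuffles :: "nat \<Rightarrow> nat \<Rightarrow> (nat \<Rightarrow> nat) set" where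
  "shuffles a b = {\<sigma>. \<sigma> permutes {..<a+b} \<and> strict_mono_on {..<a} \<sigma> \<and> strict_mono_on {a..<a+b} \<sigma>}"

text \<open>Evaluation E^{1,0} (x) (E^*)^{1,0} -> C, in the model v |-> (v - iIv)/2, psi |-> (psi - i psi o I)/2.\<close>
definition eval10 :: "('e::real_normed_vector \<Rightarrow> 'e) \<Rightarrow> 'e \<Rightarrow> ('e \<Rightarrow>\<^sub>L real) \<Rightarrow> complex" where
  "eval10 I v \<psi> = Complex (\<psi> v / 2) (- \<psi> (I v) / 2)"

text \<open>alpha in Lambda^{p,q} (x) E^{1,0}, beta in Lambda^{n-p,n-q} (x) (E^*)^{1,0};
  alpha /\ beta in Lambda^{n,n} g^*, viewed as a function of n arguments from g^{0,1} (ys)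
  and n arguments from g^{1,0} (xs).  Sign: (a/\b)/\(a'/\b') = (-1)^{q p'} (a/\a')/\(b/\b').\<close>
definition wedge_pair :: "('e::real_normed_vector \<Rightarrow> 'e) \<Rightarrow> nat \<Rightarrow> nat \<Rightarrow> nat \<Rightarrow>
    ((nat \<Rightarrow> 'g) \<Rightarrow> (nat \<Rightarrow> 'g) \<Rightarrow> 'e) \<Rightarrow> ((nat \<Rightarrow> 'g) \<Rightarrow> (nat \<Rightarrow> 'g) \<Rightarrow> ('e \<Rightarrow>\<^sub>L real)) \<Rightarrow>
    ((nat \<Rightarrow> 'g) \<Rightarrow> (nat \<Rightarrow> 'g) \<Rightarrow> complex)" where
  "wedge_pair I n p q \<alpha> \<beta> = (\<lambda>ys xs. (-1) ^ (q * (n - p)) *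
     (\<Sum>\<sigma>\<in>shuffles p (n - p). \<Sum>\<tau>\<in>shuffles q (n - q).
        of_int (sign \<sigma> * sign \<tau>) *
        eval10 I (\<alpha> (ys \<circ> \<tau>) (xs \<circ> \<sigma>)) (\<beta> (\<lambda>k. ys (\<tau> (q + k))) (\<lambda>k. xs (\<sigma> (p + k))))))"

end

theory Submission
  imports Defs "HOL-Library.Function_Algebras"
begin

text \<open>
  A \<open>(p,q)\<close>-cochain is a \<open>q\<close>-cochain of the Lie algebra \<open>a = g\<^sup>0\<^sup>,\<^sup>1\<close> with coefficients in a space
  of alternating maps, and the wedge product is the exterior product of cochains of \<open>a\<close> over the
  pairing of coefficients with values in \<open>\<Lambda>\<^sup>n(g\<^sup>1\<^sup>,\<^sup>0)\<^sup>*\<close>, itself an exterior product. Cartan's formula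
  gives the Leibniz rule by induction on the degree. Since \<open>H\<^sup>2\<^sup>n\<close> does not vanish, \<open>g\<close> is unimodular;
  hence \<open>a\<close> acts trivially on \<open>\<Lambda>\<^sup>n\<^sup>,\<^sup>n\<close> and the differential into \<open>\<Lambda>\<^sup>n\<^sup>,\<^sup>n\<close> is zero, so the differentials of
  the two complexes are adjoint up to sign. The pairing of cochains is nondegenerate, and in finite
  dimensions the annihilator of the kernel of an operator is the image of its adjoint.
\<close>

text \<open>A space of cochains is a subset of a function type, so neither a basis nor a dimension
  of it is at hand. Its finite dimensionality is used only through finite families of cochains that
  separate the factor they are paired with. Such a family in degree q + 1 arises from one in degree
  q by multiplying with a coframe \<open>\<zeta> i\<close>. Nothing is lost below the top degree,
  because the number operator acts there by the nonzero factor n - q. A functional that vanishes on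
  a kernel is then a combination of finitely many explicit ones, and its coefficients give the
  primitive.

  Exterior multiplication by a covector is set up as the Chevalley-Eilenberg differential of an
  abelian bracket, so the Leibniz rule also yields its associativity.

  The number operator settles the differential into the top degree as well: a form of degree n - 1
  is a sum of contractions of top forms, and on such contractions d is a Lie derivative, hence a
  trace. Real unimodularity meets the action on (n,n)-forms in the trace of ad of (z + i J z) / 2,
  which is half of tr ad z + i tr ad (J z).\<close>

instantiation "fun" :: (type, real_vector) real_vector
begin

definition scaleR_fun :: "real \<Rightarrow> ('a \<Rightarrow> 'b) \<Rightarrow> 'a \<Rightarrow> 'b"
  where "scaleR_fun r f = (\<lambda>x. r *\<^sub>R f x)"

instance
  by standard (simp_all add: scaleR_fun_def fun_eq_iff algebra_simps)

end

lemma scaleR_fun_apply [simp]: "(r *\<^sub>R f) x = r *\<^sub>R f x"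
  by (simp add: scaleR_fun_def)

lemma sum_fun_apply: "(\<Sum>i\<in>A. f i) x = (\<Sum>i\<in>A. f i x)"
  by (induction A rule: infinite_finite_induct) auto

lemma linear_fun_iff: "linear f \<longleftrightarrow> (\<forall>x. linear (\<lambda>v. f v x))"
  unfolding linear_iff by (auto simp: fun_eq_iff)

lemma linear_scaleR_o: "linear f \<Longrightarrow> linear (\<lambda>x. r *\<^sub>R f x)"
  by (simp add: linear_iff scaleR_add_right)

lemma linear_of_comp: "linear f \<Longrightarrow> linear g \<Longrightarrow> linear (\<lambda>x. f (g x))"
  by (simp add: linear_iff)

section \<open>Alternating cochains and the Chevalley--Eilenberg differential\<close>

lemma cons_arg_0 [simp]: "cons_arg a ys 0 = a"
  and cons_arg_Suc [simp]: "cons_arg a ys (Suc k) = ys k"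
  by (simp_all add: cons_arg_def)

lemma cons_arg_upd_0 [simp]: "(cons_arg a ys)(0 := b) = cons_arg b ys"
  and cons_arg_upd_Suc [simp]: "(cons_arg a ys)(Suc k := b) = cons_arg a (ys(k := b))"
  by (auto simp: cons_arg_def fun_eq_iff)

lemma cons_arg_collapse [simp]: "cons_arg (ys 0) (\<lambda>k. ys (Suc k)) = ys"
  by (auto simp: cons_arg_def fun_eq_iff)

lemma upd_0_eq_cons_arg: "ys(0 := b) = cons_arg b (\<lambda>k. ys (Suc k))"
  and upd_Suc_eq_cons_arg: "ys(Suc k := b) = cons_arg (ys 0) ((\<lambda>k. ys (Suc k))(k := b))"
  by (auto simp: cons_arg_def fun_eq_iff)

lemma del_arg_cons_0 [simp]: "del_arg 0 (cons_arg a ys) = ys"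
  and del_arg_cons_Suc [simp]: "del_arg (Suc i) (cons_arg a ys) = cons_arg a (del_arg i ys)"
  by (auto simp: cons_arg_def del_arg_def fun_eq_iff)

lemma cons_arg_del_arg_0: "cons_arg v (del_arg 0 ys) = ys(0 := v)"
  by (auto simp: cons_arg_def del_arg_def fun_eq_iff)

text \<open>One notion with three uses: \<open>K = Iv\<close> gives forms on g^{1,0};
  \<open>K = opp Iv\<close> with \<open>M\<close> a space of such forms gives (p,q)-cochains;
  \<open>J = K = id\<close> gives the real forms behind \<open>cform\<close>. The carrier
  \<open>M\<close> is a set because spaces of forms are not types, and arguments are infinite
  sequences of which only the first \<open>q\<close> entries count.\<close>

definition cochains :: "'m::real_vector set \<Rightarrow> ('g::real_vector \<Rightarrow> 'g) \<Rightarrow> ('m \<Rightarrow> 'm) \<Rightarrow> nat \<Rightarrow>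
    ((nat \<Rightarrow> 'g) \<Rightarrow> 'm) set" where
  "cochains M J K q = {\<phi>.
     (\<forall>ys. \<phi> ys \<in> M) \<and>
     (\<forall>ys ys'. (\<forall>i<q. ys i = ys' i) \<longrightarrow> \<phi> ys = \<phi> ys') \<and>
     (\<forall>ys i. i < q \<longrightarrow> linear (\<lambda>y. \<phi> (ys(i := y)))) \<and>
     (\<forall>ys i j. i < q \<longrightarrow> j < q \<longrightarrow> i \<noteq> j \<longrightarrow> ys i = ys j \<longrightarrow> \<phi> ys = 0) \<and>
     (\<forall>ys i. i < q \<longrightarrow> \<phi> (ys(i := J (ys i))) = K (\<phi> ys))}"

lemma cochainsI:
  assumes "\<And>ys. \<phi> ys \<in> M"
    and "\<And>ys ys'. (\<And>i. i < q \<Longrightarrow> ys i = ys' i) \<Longrightarrow> \<phi> ys = \<phi> ys'"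
    and "\<And>ys i. i < q \<Longrightarrow> linear (\<lambda>y. \<phi> (ys(i := y)))"
    and "\<And>ys i j. i < q \<Longrightarrow> j < q \<Longrightarrow> i \<noteq> j \<Longrightarrow> ys i = ys j \<Longrightarrow> \<phi> ys = 0"
    and "\<And>ys i. i < q \<Longrightarrow> \<phi> (ys(i := J (ys i))) = K (\<phi> ys)"
  shows "\<phi> \<in> cochains M J K q"
  unfolding cochains_def mem_Collect_eq using assms by (intro conjI allI impI) blast+

lemma cochainsD:
  assumes "\<phi> \<in> cochains M J K q"
  shows cochains_in: "\<phi> ys \<in> M"
    and cochains_local: "(\<And>i. i < q \<Longrightarrow> ys i = ys' i) \<Longrightarrow> \<phi> ys = \<phi> ys'"
    and cochains_linear: "i < q \<Longrightarrow> linear (\<lambda>y. \<phi> (ys(i := y)))"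
    and cochains_alt: "i < q \<Longrightarrow> j < q \<Longrightarrow> i \<noteq> j \<Longrightarrow> ys i = ys j \<Longrightarrow> \<phi> ys = 0"
    and cochains_J: "i < q \<Longrightarrow> \<phi> (ys(i := J (ys i))) = K (\<phi> ys)"
  using assms unfolding cochains_def by blast+

lemma cochains_J': "\<phi> \<in> cochains M J K q \<Longrightarrow> i < q \<Longrightarrow> \<phi> (ys(i := J y)) = K (\<phi> (ys(i := y)))"
  using cochains_J[of \<phi> M J K q i "ys(i := y)"] by simp

lemma cochains_swap:
  assumes \<phi>: "\<phi> \<in> cochains M J K q" and ij: "i < q" "j < q" "i \<noteq> j"
  shows "\<phi> (ys(i := ys j, j := ys i)) = - \<phi> ys"
proof -
  define f where "f a b = \<phi> (ys(i := a, j := b))" for a b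
  have self: "f a a = 0" for a
    unfolding f_def by (rule cochains_alt[OF \<phi> ij]) (use ij in auto)
  have "linear (f a)" for a
    unfolding f_def by (rule cochains_linear[OF \<phi> ij(2)])
  moreover have "linear (\<lambda>a. f a b)" for b
    using cochains_linear[OF \<phi> ij(1), of "ys(j := b)"] ij(3)
    by (simp add: f_def fun_upd_twist)
  ultimately have "f (a + b) (a + b) = f a a + f a b + (f b a + f b b)" for a b
    by (simp add: linear_iff algebra_simps)
  from this[of "ys i" "ys j"] have "f (ys j) (ys i) = - f (ys i) (ys j)"
    by (simp add: self eq_neg_iff_add_eq_0 add.commute)
  then show ?thesis
    by (simp add: f_def)
qed

lemma cochains_swap_cons:
  assumes "\<phi> \<in> cochains M J K (Suc (Suc q))"
  shows "\<phi> (cons_arg a (cons_arg b ys)) = - \<phi> (cons_arg b (cons_arg a ys))"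
  using cochains_swap[OF assms, of 0 1 "cons_arg b (cons_arg a ys)"] by simp

text \<open>Moving slot \<open>j\<close> to the front takes \<open>j\<close> adjacent
  transpositions. This sign connects the bracket terms of the differential, which insert in front,
  with the slotwise substitutions of a Lie derivative.\<close>

lemma cochains_move:
  assumes \<phi>: "\<phi> \<in> cochains M J K q"
  shows "j < q \<Longrightarrow> \<phi> (cons_arg v (del_arg j ys)) = (-1) ^ j *\<^sub>R \<phi> (ys(j := v))"
proof (induction j arbitrary: ys)
  case 0
  then show ?case by (simp add: cons_arg_del_arg_0)
next
  case (Suc j)
  \<comment> \<open>Deleting one entry earlier is harmless once the entry \<open>ys j\<close> has
    been saved in slot \<open>Suc j\<close>; the swap below then repairs the order.\<close>
  have "del_arg (Suc j) ys = del_arg j (ys(Suc j := ys j))"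
    by (auto simp: del_arg_def fun_eq_iff less_Suc_eq)
  then have "\<phi> (cons_arg v (del_arg (Suc j) ys)) = (-1) ^ j *\<^sub>R \<phi> (ys(Suc j := ys j, j := v))"
    using Suc.IH[of "ys(Suc j := ys j)"] Suc.prems by (simp only: Suc_lessD)
  also have "\<phi> (ys(Suc j := ys j, j := v)) = - \<phi> (ys(Suc j := v))"
    using cochains_swap[OF \<phi>, of "Suc j" j "ys(Suc j := v)"] Suc.prems by simp
  finally have "\<phi> (cons_arg v (del_arg (Suc j) ys)) = (-1) ^ Suc j *\<^sub>R \<phi> (ys(Suc j := v))"
    by simp
  then show ?case .
qed

lemma cochains_cons:
  assumes \<phi>: "\<phi> \<in> cochains M J K (Suc q)"
  shows "(\<lambda>ys. \<phi> (cons_arg y ys)) \<in> cochains M J K q"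
proof (rule cochainsI)
  show "\<phi> (cons_arg y ys) = \<phi> (cons_arg y ys')" if "\<And>i. i < q \<Longrightarrow> ys i = ys' i" for ys ys'
    by (rule cochains_local[OF \<phi>]) (use that in \<open>auto simp: cons_arg_def\<close>)
  show "linear (\<lambda>v. \<phi> (cons_arg y (ys(i := v))))" if "i < q" for ys i
    using cochains_linear[OF \<phi>, of "Suc i" "cons_arg y ys"] that by simp
  show "\<phi> (cons_arg y ys) = 0" if "i < q" "j < q" "i \<noteq> j" "ys i = ys j" for ys i j
    by (rule cochains_alt[OF \<phi>, of "Suc i" "Suc j"]) (use that in auto)
  show "\<phi> (cons_arg y (ys(i := J (ys i)))) = K (\<phi> (cons_arg y ys))" if "i < q" for ys i
    using cochains_J[OF \<phi>, of "Suc i" "cons_arg y ys"] that by simp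
qed (rule cochains_in[OF \<phi>])

lemma cochains_linear_cons:
  "\<phi> \<in> cochains M J K (Suc q) \<Longrightarrow> linear (\<lambda>y. \<phi> (cons_arg y ys))"
  using cochains_linear[of \<phi> M J K "Suc q" 0 "cons_arg undefined ys"] by simp

lemma cochains_J_cons:
  "\<phi> \<in> cochains M J K (Suc q) \<Longrightarrow> \<phi> (cons_arg (J y) ys) = K (\<phi> (cons_arg y ys))"
  using cochains_J[of \<phi> M J K "Suc q" 0 "cons_arg y ys"] by simp

text \<open>The introduction rule for inductions on the degree: all conditions are read off the
  interior products. Equality of the head with an arbitrary later entry is reduced to equality with
  its neighbour by a swap inside the tail, so alternation has to be checked for the first two slots
  only.\<close>

lemma cochains_SucI:
  assumes \<eta>: "\<And>y. (\<lambda>ys. \<eta> (cons_arg y ys)) \<in> cochains M J K q"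
    and lin: "\<And>ys. linear (\<lambda>y. \<eta> (cons_arg y ys))"
    and alt: "\<And>y ys. 0 < q \<Longrightarrow> \<eta> (cons_arg y (cons_arg y ys)) = 0"
    and J: "\<And>y ys. \<eta> (cons_arg (J y) ys) = K (\<eta> (cons_arg y ys))"
  shows "\<eta> \<in> cochains M J K (Suc q)"
proof -
  have alt0: "\<eta> (cons_arg y zs) = 0" if j: "j < q" "zs j = y" for y zs j
  proof (cases "j = 0")
    case True
    then show ?thesis
      using alt[of y "\<lambda>k. zs (Suc k)"] cons_arg_collapse[of zs] j by auto
  next
    case False
    let ?zs = "zs(0 := zs j, j := zs 0)"
    have "\<eta> (cons_arg y ?zs) = 0"
      using alt[of y "\<lambda>k. ?zs (Suc k)"] cons_arg_collapse[of ?zs] j False by simp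
    then show ?thesis
      using cochains_swap[OF \<eta>[of y], of 0 j zs] j False by simp
  qed
  show ?thesis
  proof (rule cochainsI)
    show "\<eta> ys \<in> M" for ys
      using cochains_in[OF \<eta>, of "ys 0" "\<lambda>k. ys (Suc k)"] by simp
    show "\<eta> ys = \<eta> ys'" if "\<And>i. i < Suc q \<Longrightarrow> ys i = ys' i" for ys ys'
    proof -
      have "\<eta> (cons_arg (ys 0) (\<lambda>k. ys (Suc k))) = \<eta> (cons_arg (ys 0) (\<lambda>k. ys' (Suc k)))"
        by (rule cochains_local[OF \<eta>[of "ys 0"]]) (use that in auto)
      moreover have "ys 0 = ys' 0"
        using that by blast
      ultimately show ?thesis
        using cons_arg_collapse[of ys] cons_arg_collapse[of ys'] by simp
    qed
    show "linear (\<lambda>y. \<eta> (ys(i := y)))" if "i < Suc q" for ys i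
    proof (cases i)
      case 0
      then show ?thesis using lin[of "\<lambda>k. ys (Suc k)"] by (simp only: upd_0_eq_cons_arg)
    next
      case (Suc k)
      then show ?thesis
        using cochains_linear[OF \<eta>[of "ys 0"], of k "\<lambda>k. ys (Suc k)"] that
        by (simp only: upd_Suc_eq_cons_arg Suc_less_eq)
    qed
    show "\<eta> ys = 0" if ij: "i < Suc q" "j < Suc q" "i \<noteq> j" "ys i = ys j" for ys i j
    proof -
      consider k where "i = 0" "j = Suc k" | k where "i = Suc k" "j = 0" | k l where "i = Suc k" "j = Suc l"
        using ij(3) by (metis not0_implies_Suc)
      then show ?thesis
      proof cases
        case 1
        then show ?thesis using alt0[of k "\<lambda>k. ys (Suc k)" "ys 0"] ij by simp
      next
        case 2
        then show ?thesis using alt0[of k "\<lambda>k. ys (Suc k)" "ys 0"] ij by simp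
      next
        case 3
        then show ?thesis
          using cochains_alt[OF \<eta>[of "ys 0"], of k l "\<lambda>k. ys (Suc k)"] ij by simp
      qed
    qed
    show "\<eta> (ys(i := J (ys i))) = K (\<eta> ys)" if "i < Suc q" for ys i
    proof (cases i)
      case 0
      then show ?thesis
        using J[of "ys 0" "\<lambda>k. ys (Suc k)"] by (simp only: upd_0_eq_cons_arg cons_arg_collapse)
    next
      case (Suc k)
      then show ?thesis
        using cochains_J[OF \<eta>[of "ys 0"], of k "\<lambda>k. ys (Suc k)"] that
        by (simp only: upd_Suc_eq_cons_arg Suc_less_eq cons_arg_collapse)
    qed
  qed
qed

lemma subspace_cochains:
  assumes "subspace M" "linear K"
  shows "subspace (cochains M J K q)"
proof (rule subspaceI)
  interpret K: linear K by fact
  show "0 \<in> cochains M J K q"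
    by (rule cochainsI) (auto simp: subspace_0[OF assms(1)] linear_iff K.zero)
  show "\<phi> + \<psi> \<in> cochains M J K q" if "\<phi> \<in> cochains M J K q" "\<psi> \<in> cochains M J K q" for \<phi> \<psi>
  proof (rule cochainsI)
    show "linear (\<lambda>y. (\<phi> + \<psi>) (ys(i := y)))" if "i < q" for ys i
      unfolding plus_fun_apply
      by (rule linear_compose_add[OF cochains_linear[OF \<open>\<phi> \<in> _\<close> that] cochains_linear[OF \<open>\<psi> \<in> _\<close> that]])
    show "(\<phi> + \<psi>) ys = (\<phi> + \<psi>) ys'" if "\<And>i. i < q \<Longrightarrow> ys i = ys' i" for ys ys'
      using cochains_local[OF \<open>\<phi> \<in> _\<close>, of ys ys'] cochains_local[OF \<open>\<psi> \<in> _\<close>, of ys ys'] that by simp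
  qed (use that in \<open>simp_all add: subspace_add[OF assms(1)] cochains_in K.add cochains_J
      cochains_alt[OF that(1)] cochains_alt[OF that(2)]\<close>)
  show "r *\<^sub>R \<phi> \<in> cochains M J K q" if "\<phi> \<in> cochains M J K q" for r \<phi>
  proof (rule cochainsI)
    show "linear (\<lambda>y. (r *\<^sub>R \<phi>) (ys(i := y)))" if "i < q" for ys i
      unfolding scaleR_fun_apply by (rule linear_scaleR_o[OF cochains_linear[OF \<open>\<phi> \<in> _\<close> that]])
    show "(r *\<^sub>R \<phi>) ys = (r *\<^sub>R \<phi>) ys'" if "\<And>i. i < q \<Longrightarrow> ys i = ys' i" for ys ys'
      using cochains_local[OF \<open>\<phi> \<in> _\<close>, of ys ys'] that by simp
  qed (use that in \<open>simp_all add: subspace_scale[OF assms(1)] cochains_in K.scale cochains_J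
      cochains_alt[OF that]\<close>)
qed

lemma cochains_comp:
  assumes \<phi>: "\<phi> \<in> cochains M J K q" and "linear T" "\<And>m. m \<in> M \<Longrightarrow> T m \<in> M'"
    "\<And>m. m \<in> M \<Longrightarrow> T (K m) = K' (T m)"
  shows "(\<lambda>ys. T (\<phi> ys)) \<in> cochains M' J K' q"
proof (rule cochainsI)
  show "T (\<phi> ys) = T (\<phi> ys')" if "\<And>i. i < q \<Longrightarrow> ys i = ys' i" for ys ys'
    using cochains_local[OF \<phi> that] by simp
  show "linear (\<lambda>y. T (\<phi> (ys(i := y))))" if "i < q" for ys i
    by (rule linear_of_comp[OF \<open>linear T\<close> cochains_linear[OF \<phi> that]])
qed (use assms in \<open>simp_all add: cochains_in[OF \<phi>] linear_0 cochains_J[OF \<phi>] cochains_alt[OF \<phi>]\<close>)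

text \<open>A Lie derivative with \<open>D\<close> acting on the arguments and \<open>A\<close> on
  the values. With both left free it is L_y on cochains of \<open>a\<close> and also, one level
  down, the action of \<open>a\<close> on the coefficient forms.\<close>

definition lie :: "('g::real_vector \<Rightarrow> 'g) \<Rightarrow> ('m::real_vector \<Rightarrow> 'm) \<Rightarrow> nat \<Rightarrow>
    ((nat \<Rightarrow> 'g) \<Rightarrow> 'm) \<Rightarrow> (nat \<Rightarrow> 'g) \<Rightarrow> 'm" where
  "lie D A q \<phi> = (\<lambda>ys. A (\<phi> ys) - (\<Sum>i<q. \<phi> (ys(i := D (ys i)))))"

lemma lie_cochains:
  assumes \<phi>: "\<phi> \<in> cochains M J K q" and M: "subspace M" and K: "linear K"
    and D: "linear D" "\<And>y. D (J y) = J (D y)"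
    and A: "linear A" "\<And>m. m \<in> M \<Longrightarrow> A m \<in> M" "\<And>m. m \<in> M \<Longrightarrow> A (K m) = K (A m)"
  shows "lie D A q \<phi> \<in> cochains M J K q"
proof (rule cochainsI)
  interpret A: linear A by fact
  interpret K: linear K by fact
  show "lie D A q \<phi> ys \<in> M" for ys
    unfolding lie_def
    by (intro subspace_diff[OF M] subspace_sum[OF M] A cochains_in[OF \<phi>])
  show "lie D A q \<phi> ys = lie D A q \<phi> ys'" if "\<And>i. i < q \<Longrightarrow> ys i = ys' i" for ys ys'
  proof -
    have "\<phi> (ys(i := D (ys i))) = \<phi> (ys'(i := D (ys' i)))" if "i < q" for i
      by (rule cochains_local[OF \<phi>]) (use that \<open>\<And>i. i < q \<Longrightarrow> ys i = ys' i\<close> in auto)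
    then show ?thesis
      using cochains_local[OF \<phi> that] unfolding lie_def by simp
  qed
  show "linear (\<lambda>y. lie D A q \<phi> (ys(k := y)))" if "k < q" for ys k
    unfolding lie_def
  proof (intro linear_compose_sub linear_compose_sum ballI)
    show "linear (\<lambda>x. A (\<phi> (ys(k := x))))"
      by (rule linear_of_comp[OF A(1) cochains_linear[OF \<phi> that]])
    show "linear (\<lambda>x. \<phi> (ys(k := x, i := D ((ys(k := x)) i))))" if "i \<in> {..<q}" for i
    proof (cases "i = k")
      case True
      then show ?thesis
        using linear_of_comp[OF cochains_linear[OF \<phi> \<open>k < q\<close>] D(1), of ys] by simp
    next
      case False
      then show ?thesis
        using cochains_linear[OF \<phi> \<open>k < q\<close>, of "ys(i := D (ys i))"] by (simp add: fun_upd_twist)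
    qed
  qed
  show "lie D A q \<phi> ys = 0" if kl: "k < q" "l < q" "k \<noteq> l" "ys k = ys l" for ys k l
  proof -
    let ?f = "\<lambda>i. \<phi> (ys(i := D (ys i)))"
    \<comment> \<open>A substitution outside slots \<open>k\<close> and \<open>l\<close> leaves two
      equal entries; the two remaining terms differ by a swap and cancel.\<close>
    have "(\<Sum>i<q. ?f i) = (\<Sum>i\<in>{k,l}. ?f i)"
    proof (rule sum.mono_neutral_right)
      show "\<forall>i\<in>{..<q} - {k,l}. ?f i = 0"
        by (intro ballI cochains_alt[OF \<phi> kl(1,2,3)]) (use kl in auto)
    qed (use kl in auto)
    also have "\<dots> = ?f k + ?f l"
      using kl by simp
    also have "?f l = - ?f k"
      using cochains_swap[OF \<phi> kl(1,2,3), of "ys(k := D (ys k))"] kl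
      by (simp add: fun_upd_twist)
        (metis fun_upd_triv fun_upd_twist)
    finally have "(\<Sum>i<q. ?f i) = 0"
      by (simp only: add.right_inverse)
    then show ?thesis
      unfolding lie_def cochains_alt[OF \<phi> kl] by (simp only: A.zero diff_self)
  qed
  show "lie D A q \<phi> (ys(k := J (ys k))) = K (lie D A q \<phi> ys)" if "k < q" for ys k
  proof -
    have "\<phi> (ys(k := J (ys k), i := D ((ys(k := J (ys k))) i))) = K (\<phi> (ys(i := D (ys i))))"
      if "i < q" for i
    proof (cases "i = k")
      case True
      then show ?thesis using cochains_J'[OF \<phi> that] by (simp add: D)
    next
      case False
      then show ?thesis
        using cochains_J[OF \<phi> \<open>k < q\<close>, of "ys(i := D (ys i))"] by (simp add: fun_upd_twist)
    qed
    then show ?thesis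
      using that
      by (simp add: lie_def cochains_J[OF \<phi>] A(3) cochains_in[OF \<phi>] K.diff K.sum)
  qed
qed

text \<open>The differential for an arbitrary bracket and action: \<open>dbar\<close>,
  \<open>dCE\<close> and exterior multiplication by a covector are all instances.\<close>

definition cd :: "('g::real_vector \<Rightarrow> 'g \<Rightarrow> 'g) \<Rightarrow> ('g \<Rightarrow> 'm::real_vector \<Rightarrow> 'm) \<Rightarrow> nat \<Rightarrow>
    ((nat \<Rightarrow> 'g) \<Rightarrow> 'm) \<Rightarrow> (nat \<Rightarrow> 'g) \<Rightarrow> 'm" where
  "cd b act q \<phi> = (\<lambda>ys.
     (\<Sum>i\<le>q. ((-1::real) ^ i) *\<^sub>R act (ys i) (\<phi> (del_arg i ys))) +
     (\<Sum>i\<le>q. \<Sum>j\<le>q. if i < j then ((-1::real) ^ (i + j)) *\<^sub>R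
          \<phi> (cons_arg (b (ys i) (ys j)) (del_arg i (del_arg j ys))) else 0))"

text \<open>Records skewness of the bracket and complex bilinearity of bracket and action, with
  \<open>J\<close> and \<open>K\<close> in the role of the same complex scalar. The abelian bracket
  with multiplication by a covector also fits, so that \<open>d_in\<close> and
  \<open>leibniz\<close> apply to exterior multiplication.\<close>

locale ce_structure =
  fixes M :: "'m::real_vector set" and J :: "'g::real_vector \<Rightarrow> 'g" and K :: "'m \<Rightarrow> 'm"
    and b :: "'g \<Rightarrow> 'g \<Rightarrow> 'g" and act :: "'g \<Rightarrow> 'm \<Rightarrow> 'm"
  assumes subspace_M: "subspace M" and linear_K: "linear K" and K_in: "m \<in> M \<Longrightarrow> K m \<in> M"
    and linear_b: "linear (b y)" and linear_b_left: "linear (\<lambda>x. b x y)" and b_self: "b y y = 0"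
    and b_J: "b y (J z) = J (b y z)"
    and linear_act: "linear (act y)" and act_in: "m \<in> M \<Longrightarrow> act y m \<in> M"
    and linear_act_left: "m \<in> M \<Longrightarrow> linear (\<lambda>y. act y m)"
    and act_K: "m \<in> M \<Longrightarrow> act y (K m) = K (act y m)"
    and act_J: "m \<in> M \<Longrightarrow> act (J y) m = K (act y m)"
begin

abbreviation C where "C \<equiv> cochains M J K"
abbreviation d where "d \<equiv> cd b act"
abbreviation L where "L y \<equiv> lie (b y) (act y)"

lemma subspace_C: "subspace (C q)"
  by (rule subspace_cochains[OF subspace_M linear_K])

lemma L_in: "\<phi> \<in> C q \<Longrightarrow> L y q \<phi> \<in> C q"
  by (rule lie_cochains)
    (use subspace_M linear_K linear_b b_J linear_act act_in act_K in auto)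

lemma linear_d: "linear (d q)"
proof -
  have eval: "linear (\<lambda>\<phi>. r *\<^sub>R \<phi> zs)" for r and zs :: "nat \<Rightarrow> 'g"
    by (rule linear_scaleR_o) (simp add: linear_iff)
  have "linear (\<lambda>\<phi>. if i < j then r *\<^sub>R \<phi> zs else 0)" for i j :: nat and r and zs :: "nat \<Rightarrow> 'g"
    using eval[of r zs] by (cases "i < j") (simp_all add: linear_iff)
  moreover have "linear (\<lambda>\<phi>. r *\<^sub>R act y (\<phi> zs))" for r y and zs :: "nat \<Rightarrow> 'g"
    using eval[of 1 zs] by (intro linear_scaleR_o linear_of_comp[OF linear_act]) simp
  ultimately show ?thesis
    unfolding linear_fun_iff cd_def by (intro allI linear_compose_add linear_compose_sum ballI)
qed

lemma d_K: "\<phi> \<in> C q \<Longrightarrow> d q (\<lambda>ys. K (\<phi> ys)) = (\<lambda>ys. K (d q \<phi> ys))"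
  unfolding cd_def
  by (rule ext) (auto simp: linear_add[OF linear_K] linear_sum[OF linear_K] linear_scale[OF linear_K]
      act_K cochains_in linear_0[OF linear_K] intro!: arg_cong2[where f = "(+)"] sum.cong)

lemma cartan_0: "\<phi> \<in> C 0 \<Longrightarrow> d 0 \<phi> (cons_arg y ys) = L y 0 \<phi> ys"
  by (simp add: cd_def lie_def)

text \<open>Cartan's formula read as a recursion on the degree. Membership of
  \<open>d q \<phi>\<close> in the cochains and the Leibniz rule are both derived from it, so the
  signs of the double sum are handled here.\<close>

lemma cartan:
  assumes \<phi>: "\<phi> \<in> C (Suc q)"
  shows "d (Suc q) \<phi> (cons_arg y ys) = L y (Suc q) \<phi> ys - d q (\<lambda>ys. \<phi> (cons_arg y ys)) ys"
proof -
  let ?c = "cons_arg y ys"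
  define g where "g i j = ((-1::real) ^ (i + j)) *\<^sub>R
     \<phi> (cons_arg (b (?c i) (?c j)) (del_arg i (del_arg j ?c)))" for i j
  define h where "h i j = ((-1::real) ^ (i + j)) *\<^sub>R
     \<phi> (cons_arg y (cons_arg (b (ys i) (ys j)) (del_arg i (del_arg j ys))))" for i j
  have split: "(\<Sum>i\<le>Suc q. \<Sum>j\<le>Suc q. if i < j then G i j else 0) =
      (\<Sum>j\<le>q. G 0 (Suc j)) + (\<Sum>i\<le>q. \<Sum>j\<le>q. if i < j then G (Suc i) (Suc j) else 0)"
    for G :: "nat \<Rightarrow> nat \<Rightarrow> 'm"
    by (simp only: sum.atMost_Suc_shift) simp
  \<comment> \<open>Pairs with i = 0: the bracket of \<open>y\<close> with entry \<open>j\<close> is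
    moved from the front into slot \<open>j\<close>. The sign (-1)^j of the move meets (-1)^(j+1)
    and leaves -1.\<close>
  have g0: "(\<Sum>j\<le>q. g 0 (Suc j)) = - (\<Sum>j<Suc q. \<phi> (ys(j := b y (ys j))))"
    unfolding lessThan_Suc_atMost sum_negf[symmetric]
  proof (rule sum.cong)
    fix j assume "j \<in> {..q}"
    then have "\<phi> (cons_arg (b y (ys j)) (del_arg j ys)) = (-1) ^ j *\<^sub>R \<phi> (ys(j := b y (ys j)))"
      by (intro cochains_move[OF \<phi>]) simp
    then show "g 0 (Suc j) = - \<phi> (ys(j := b y (ys j)))"
      unfolding g_def by (simp flip: power_mult_distrib)
  qed simp
  \<comment> \<open>Pairs not involving \<open>y\<close>: exchanging \<open>y\<close> with the
    bracket in front of it turns the term into one of d applied to the interior product.\<close>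
  have gS: "(if i < j then g (Suc i) (Suc j) else 0) = - (if i < j then h i j else 0)"
    if j: "j \<in> {..q}" for i j
  proof (cases "i < j")
    case True
    then obtain q' where q': "q = Suc q'"
      using j True by (cases q) auto
    have "\<phi> (cons_arg (b (ys i) (ys j)) (cons_arg y (del_arg i (del_arg j ys)))) =
        - \<phi> (cons_arg y (cons_arg (b (ys i) (ys j)) (del_arg i (del_arg j ys))))"
      by (rule cochains_swap_cons[OF \<phi>[unfolded q']])
    then show ?thesis
      using True unfolding g_def h_def by simp
  qed simp
  have "d (Suc q) \<phi> ?c = (\<Sum>i\<le>Suc q. (-1) ^ i *\<^sub>R act (?c i) (\<phi> (del_arg i ?c))) +
      (\<Sum>i\<le>Suc q. \<Sum>j\<le>Suc q. if i < j then g i j else 0)"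
    unfolding cd_def g_def ..
  also have "(\<Sum>i\<le>Suc q. (-1) ^ i *\<^sub>R act (?c i) (\<phi> (del_arg i ?c))) =
      act y (\<phi> ys) - (\<Sum>i\<le>q. (-1) ^ i *\<^sub>R act (ys i) (\<phi> (cons_arg y (del_arg i ys))))"
    by (simp only: sum.atMost_Suc_shift) (simp add: sum_negf)
  also have "(\<Sum>i\<le>Suc q. \<Sum>j\<le>Suc q. if i < j then g i j else 0) =
      - (\<Sum>j<Suc q. \<phi> (ys(j := b y (ys j)))) - (\<Sum>i\<le>q. \<Sum>j\<le>q. if i < j then h i j else 0)"
  proof -
    have "(\<Sum>i\<le>q. \<Sum>j\<le>q. if i < j then g (Suc i) (Suc j) else 0) =
        (\<Sum>i\<le>q. \<Sum>j\<le>q. - (if i < j then h i j else 0))"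
      by (intro sum.cong refl gS)
    then show ?thesis
      unfolding split g0 by (simp only: sum_negf diff_conv_add_uminus)
  qed
  also have "act y (\<phi> ys) - (\<Sum>i\<le>q. (-1) ^ i *\<^sub>R act (ys i) (\<phi> (cons_arg y (del_arg i ys)))) +
      (- (\<Sum>j<Suc q. \<phi> (ys(j := b y (ys j)))) - (\<Sum>i\<le>q. \<Sum>j\<le>q. if i < j then h i j else 0)) =
      L y (Suc q) \<phi> ys - d q (\<lambda>ys. \<phi> (cons_arg y ys)) ys"
  proof -
    have "X - A + (- S - H) = X - S - (A + H)" for X A S H :: 'm
      by simp
    then show ?thesis
      unfolding cd_def lie_def h_def by blast
  qed
  finally show ?thesis .
qed

lemma linear_L_left:
  assumes "\<phi> \<in> C q" shows "linear (\<lambda>y. L y q \<phi> ys)"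
proof -
  have "linear (\<lambda>y. \<phi> (ys(i := b y (ys i))))" if "i \<in> {..<q}" for i
    using that by (intro linear_of_comp[OF cochains_linear[OF assms, of i ys] linear_b_left[of "ys i"]]) simp
  then have "linear (\<lambda>y. \<Sum>i<q. \<phi> (ys(i := b y (ys i))))"
    by (intro linear_compose_sum ballI)
  then show ?thesis
    unfolding lie_def by (rule linear_compose_sub[OF linear_act_left[OF cochains_in[OF assms]]])
qed

lemma b_J_left: "b (J y) z = J (b y z)"
proof -
  have skew: "b x x' = - b x' x" for x x'
  proof -
    have "b (x + x') (x + x') = b x x + b x x' + (b x' x + b x' x')"
      by (simp only: linear_add[OF linear_b] linear_add[OF linear_b_left] add_ac)
    then show ?thesis
      by (simp add: b_self eq_neg_iff_add_eq_0)
  qed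
  have "b (J y) z = b (- z) (J y)"
    by (simp only: skew[of "J y" z] linear_neg[OF linear_b_left])
  also have "\<dots> = J (b (- z) y)"
    by (rule b_J)
  also have "\<dots> = J (b y z)"
    by (simp only: linear_neg[OF linear_b_left] skew[of y z])
  finally show ?thesis .
qed

lemma L_J:
  assumes "\<phi> \<in> C q" shows "L (J y) q \<phi> ys = K (L y q \<phi> ys)"
  unfolding lie_def
  by (simp add: b_J_left act_J cochains_in[OF assms] cochains_J'[OF assms] linear_diff[OF linear_K]
      linear_sum[OF linear_K])

lemma L_cons:
  assumes "\<phi> \<in> C (Suc q)"
  shows "L y (Suc q) \<phi> (cons_arg z ys) =
    L y q (\<lambda>ys. \<phi> (cons_arg z ys)) ys - \<phi> (cons_arg (b y z) ys)"
  by (simp add: lie_def sum.lessThan_Suc_shift del: sum.lessThan_Suc)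

text \<open>Induction on the degree through \<open>cartan\<close>: both terms of the formula are
  cochains of lower degree in the remaining arguments.\<close>

lemma d_in: "\<phi> \<in> C q \<Longrightarrow> d q \<phi> \<in> C (Suc q)"
proof (induction q arbitrary: \<phi>)
  case 0
  show ?case
    by (rule cochains_SucI)
      (simp_all add: cartan_0 L_in L_J linear_L_left 0)
next
  case (Suc q)
  note \<phi> = Suc.prems
  let ?\<iota> = "\<lambda>y ys. \<phi> (cons_arg y ys)"
  have \<iota>: "?\<iota> y \<in> C q" for y
    by (rule cochains_cons[OF \<phi>])
  have lin: "linear (\<lambda>y. d q (?\<iota> y) ys)" for ys
  proof -
    have "linear ?\<iota>"
      by (simp add: linear_fun_iff cochains_linear_cons[OF \<phi>])
    from linear_of_comp[OF linear_d this] show ?thesis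
      by (simp add: linear_fun_iff)
  qed
  show ?case
  proof (rule cochains_SucI)
    show "(\<lambda>ys. d (Suc q) \<phi> (cons_arg y ys)) \<in> C (Suc q)" for y
      using subspace_diff[OF subspace_C L_in[OF \<phi>] Suc.IH[OF \<iota>], of y y]
      by (simp add: cartan[OF \<phi>] fun_diff_def)
    show "linear (\<lambda>y. d (Suc q) \<phi> (cons_arg y ys))" for ys
      unfolding cartan[OF \<phi>] by (intro linear_compose_sub linear_L_left[OF \<phi>] lin)
    show "d (Suc q) \<phi> (cons_arg (J y) ys) = K (d (Suc q) \<phi> (cons_arg y ys))" for y ys
    proof -
      have "?\<iota> (J y) = (\<lambda>ys. K (?\<iota> y ys))"
        by (rule ext) (rule cochains_J_cons[OF \<phi>])
      then show ?thesis
        by (simp add: cartan[OF \<phi>] L_J[OF \<phi>] d_K[OF \<iota>] linear_diff[OF linear_K])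
    qed
    \<comment> \<open>Contracting twice with \<open>y\<close> and using Cartan's formula twice gives
      L_y i_y - L_y i_y + d i_y i_y. The first two terms cancel, where b y y = 0 lets L_y commute
      with i_y, and i_y i_y vanishes by alternation.\<close>
    show "d (Suc q) \<phi> (cons_arg y (cons_arg y ys)) = 0" for y ys
    proof (cases q)
      case 0
      then show ?thesis
        using \<phi> \<iota> by (simp add: cartan cartan_0 L_cons b_self
            linear_0[OF cochains_linear_cons[OF \<phi>]])
    next
      case (Suc q')
      have "(\<lambda>ys. \<phi> (cons_arg y (cons_arg y ys))) = (\<lambda>_. 0)"
        by (rule ext) (rule cochains_alt[OF \<phi>, of 0 1], use Suc in auto)
      then show ?thesis
        using \<phi> \<iota> Suc linear_0[OF linear_d, of q']
        by (simp add: cartan L_cons b_self linear_0[OF cochains_linear_cons[OF \<phi>]] zero_fun_def)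
    qed
  qed
qed

end

section \<open>Shuffles and the exterior product\<close>

definition lift_perm :: "(nat \<Rightarrow> nat) \<Rightarrow> nat \<Rightarrow> nat"
  where "lift_perm \<sigma> k = (case k of 0 \<Rightarrow> 0 | Suc j \<Rightarrow> Suc (\<sigma> j))"

lemma lift_perm_0 [simp]: "lift_perm \<sigma> 0 = 0"
  and lift_perm_Suc [simp]: "lift_perm \<sigma> (Suc j) = Suc (\<sigma> j)"
  by (simp_all add: lift_perm_def)

lemma inj_lift_perm: "inj lift_perm"
  by (rule injI) (metis ext lift_perm_Suc nat.inject)

text \<open>Brings the sign of a shifted permutation within reach of
  \<open>sign_map_permutation\<close>.\<close>

lemma lift_perm_eq_map_permutation:
  assumes "\<sigma> permutes {..<N}"
  shows "lift_perm \<sigma> = map_permutation {..<N} Suc \<sigma>"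
proof
  fix k
  show "lift_perm \<sigma> k = map_permutation {..<N} Suc \<sigma> k"
  proof (cases k)
    case 0
    then show ?thesis
      by (auto simp: map_permutation_def restrict_id_def)
  next
    case (Suc j)
    show ?thesis
    proof (cases "j < N")
      case True
      then show ?thesis
        using Suc by (simp add: map_permutation_apply)
    next
      case False
      then show ?thesis
        using Suc permutes_not_in[OF assms, of j] by (auto simp: map_permutation_def restrict_id_def)
    qed
  qed
qed

lemma lift_perm_permutes:
  assumes "\<sigma> permutes {..<N}"
  shows "lift_perm \<sigma> permutes {..<Suc N}"
proof -
  have "lift_perm \<sigma> permutes Suc ` {..<N}"
    unfolding lift_perm_eq_map_permutation[OF assms] by (rule map_permutation_permutes) (use assms in auto)
  then show ?thesis
    by (rule permutes_subset) auto
qed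

lemma sign_lift_perm: "\<sigma> permutes {..<N} \<Longrightarrow> sign (lift_perm \<sigma>) = sign \<sigma>"
  by (simp add: lift_perm_eq_map_permutation sign_map_permutation)

lemma lift_perm_cases:
  assumes "\<rho> permutes {..<Suc N}" "\<rho> 0 = 0"
  obtains \<sigma> where "\<sigma> permutes {..<N}" "\<rho> = lift_perm \<sigma>"
proof
  define \<sigma> where "\<sigma> k = \<rho> (Suc k) - 1" for k
  have Suc: "\<rho> (Suc k) = Suc (\<sigma> k)" for k
    using permutes_inj[OF assms(1)] assms(2) by (auto simp: \<sigma>_def inj_def) (metis Suc_pred gr0I nat.simps(3))
  then show "\<rho> = lift_perm \<sigma>"
    using assms(2) by (auto simp: fun_eq_iff lift_perm_def split: nat.split)
  show "\<sigma> permutes {..<N}"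
  proof (rule inj_imp_permutes)
    show "inj_on \<sigma> {..<N}"
      by (rule inj_onI) (metis Suc Suc_inject injD permutes_inj[OF assms(1)])
    show "\<sigma> k \<in> {..<N}" if "k \<in> {..<N}" for k
      using permutes_in_image[OF assms(1), of "Suc k"] that by (simp add: Suc)
    show "\<sigma> k = k" if "k \<notin> {..<N}" for k
      using permutes_not_in[OF assms(1), of "Suc k"] that by (simp add: Suc)
  qed simp
qed

text \<open>The cycle that carries the first slot of the second block past the \<open>a\<close>
  slots of the first block. Its sign (-1)^a is the Koszul sign in the contraction of an exterior
  product.\<close>

definition cycle_perm :: "nat \<Rightarrow> nat \<Rightarrow> nat"
  where "cycle_perm a k = (if k = a then 0 else if k < a then Suc k else k)"

lemma cycle_perm_0: "cycle_perm 0 = id"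
  by (auto simp: cycle_perm_def fun_eq_iff)

lemma cycle_perm_Suc: "cycle_perm (Suc a) = cycle_perm a \<circ> Transposition.transpose a (Suc a)"
  by (auto simp: cycle_perm_def fun_eq_iff Transposition.transpose_def)

lemma cycle_perm_permutes: "a < N \<Longrightarrow> cycle_perm a permutes {..<N}"
  by (induction a) (auto simp: cycle_perm_0 cycle_perm_Suc permutes_id intro!: permutes_compose permutes_swap_id)

lemma permutation_cycle_perm: "permutation (cycle_perm a)"
  using cycle_perm_permutes[of a "Suc a"] permutes_imp_permutation[of "{..<Suc a}"] by simp

lemma sign_cycle_perm: "sign (cycle_perm a) = (-1) ^ a"
proof (induction a)
  case (Suc a)
  then show ?case
    unfolding cycle_perm_Suc sign_compose[OF permutation_cycle_perm permutation_swap_id]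
    by (simp add: sign_swap_id)
qed (simp add: cycle_perm_0)

lemma finite_shuffles: "finite (shuffles a b)"
  unfolding shuffles_def by (rule finite_subset[OF _ finite_permutations[of "{..<a + b}"]]) auto

lemma shuffles_0_0: "shuffles 0 0 = {id}"
  by (auto simp: shuffles_def strict_mono_on_def)

lemma shuffles_permutes: "\<sigma> \<in> shuffles a b \<Longrightarrow> \<sigma> permutes {..<a + b}"
  by (simp add: shuffles_def)

lemma shuffles_head_0: "{\<sigma> \<in> shuffles (Suc a) b. \<sigma> 0 = 0} = lift_perm ` shuffles a b"
proof (intro equalityI subsetI)
  fix \<rho> assume "\<rho> \<in> {\<sigma> \<in> shuffles (Suc a) b. \<sigma> 0 = 0}"
  then have \<rho>: "\<rho> permutes {..<Suc (a + b)}" "\<rho> 0 = 0" "strict_mono_on {..<Suc a} \<rho>"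
      "strict_mono_on {Suc a..<Suc a + b} \<rho>"
    by (auto simp: shuffles_def)
  from \<rho>(1,2) obtain \<sigma> where \<sigma>: "\<sigma> permutes {..<a + b}" "\<rho> = lift_perm \<sigma>"
    by (rule lift_perm_cases)
  have "\<sigma> i < \<sigma> j" if "i < j" "j < a" for i j
    using strict_mono_onD[OF \<rho>(3), of "Suc i" "Suc j"] that by (simp add: \<sigma>)
  moreover have "\<sigma> i < \<sigma> j" if "i < j" "a \<le> i" "j < a + b" for i j
    using strict_mono_onD[OF \<rho>(4), of "Suc i" "Suc j"] that by (simp add: \<sigma>)
  ultimately show "\<rho> \<in> lift_perm ` shuffles a b"
    using \<sigma> by (auto simp: shuffles_def strict_mono_on_def)
next
  fix \<rho> assume "\<rho> \<in> lift_perm ` shuffles a b"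
  then obtain \<sigma> where \<sigma>: "\<sigma> permutes {..<a + b}" "\<rho> = lift_perm \<sigma>" "strict_mono_on {..<a} \<sigma>"
      "strict_mono_on {a..<a + b} \<sigma>"
    by (auto simp: shuffles_def)
  have "\<rho> i < \<rho> j" if "i < j" "j < Suc a" for i j
    using strict_mono_onD[OF \<sigma>(3), of "i - 1" "j - 1"] that
    by (cases i; cases j) (auto simp: \<sigma>)
  moreover have "\<rho> i < \<rho> j" if "i < j" "Suc a \<le> i" "j < Suc a + b" for i j
    using strict_mono_onD[OF \<sigma>(4), of "i - 1" "j - 1"] that
    by (cases i; cases j) (auto simp: \<sigma>)
  ultimately show "\<rho> \<in> {\<sigma> \<in> shuffles (Suc a) b. \<sigma> 0 = 0}"
    using lift_perm_permutes[OF \<sigma>(1)] by (auto simp: shuffles_def strict_mono_on_def \<sigma>(2))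
qed

text \<open>Undoing the cycle puts the value 0 into slot 0; removing that slot leaves a shuffle with
  second block shorter by one.\<close>

lemma shuffles_tail_0:
  "{\<sigma> \<in> shuffles a (Suc b). \<sigma> a = 0} = (\<lambda>\<sigma>. lift_perm \<sigma> \<circ> cycle_perm a) ` shuffles a b"
proof (intro equalityI subsetI)
  fix \<rho> assume "\<rho> \<in> {\<sigma> \<in> shuffles a (Suc b). \<sigma> a = 0}"
  then have \<rho>: "\<rho> permutes {..<Suc (a + b)}" "\<rho> a = 0" "strict_mono_on {..<a} \<rho>"
      "strict_mono_on {a..<Suc a + b} \<rho>"
    by (auto simp: shuffles_def)
  have cyc: "cycle_perm a permutes {..<Suc (a + b)}"
    by (rule cycle_perm_permutes) simp
  have "inv (cycle_perm a) 0 = a"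
    using permutes_inv_eq[OF cyc, of 0 a] by (simp add: cycle_perm_def)
  with permutes_compose[OF permutes_inv[OF cyc] \<rho>(1)] \<rho>(2) obtain \<sigma>
    where \<sigma>: "\<sigma> permutes {..<a + b}" "\<rho> \<circ> inv (cycle_perm a) = lift_perm \<sigma>"
    by (metis comp_apply lift_perm_cases)
  have \<rho>_eq: "\<rho> = lift_perm \<sigma> \<circ> cycle_perm a"
    using \<sigma>(2) permutes_inv_o(2)[OF cyc] by (metis comp_assoc comp_id)
  have "\<sigma> i < \<sigma> j" if "i < j" "j < a" for i j
    using strict_mono_onD[OF \<rho>(3), of i j] that by (simp add: \<rho>_eq cycle_perm_def)
  moreover have "\<sigma> i < \<sigma> j" if "i < j" "a \<le> i" "j < a + b" for i j
    using strict_mono_onD[OF \<rho>(4), of "Suc i" "Suc j"] that by (simp add: \<rho>_eq cycle_perm_def)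
  ultimately show "\<rho> \<in> (\<lambda>\<sigma>. lift_perm \<sigma> \<circ> cycle_perm a) ` shuffles a b"
    using \<sigma>(1) \<rho>_eq by (auto simp: shuffles_def strict_mono_on_def)
next
  fix \<rho> assume "\<rho> \<in> (\<lambda>\<sigma>. lift_perm \<sigma> \<circ> cycle_perm a) ` shuffles a b"
  then obtain \<sigma> where \<sigma>: "\<sigma> permutes {..<a + b}" "\<rho> = lift_perm \<sigma> \<circ> cycle_perm a"
      "strict_mono_on {..<a} \<sigma>" "strict_mono_on {a..<a + b} \<sigma>"
    by (auto simp: shuffles_def)
  have "\<rho> i < \<rho> j" if "i < j" "j < a" for i j
    using strict_mono_onD[OF \<sigma>(3), of i j] that by (auto simp: \<sigma>(2) cycle_perm_def)
  moreover have "\<rho> i < \<rho> j" if "i < j" "a \<le> i" "j < a + Suc b" for i j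
    using strict_mono_onD[OF \<sigma>(4), of "i - 1" "j - 1"] that
    by (cases i; cases j) (auto simp: \<sigma>(2) cycle_perm_def)
  moreover have "\<rho> permutes {..<Suc (a + b)}"
    unfolding \<sigma>(2) by (intro permutes_compose[OF cycle_perm_permutes lift_perm_permutes] \<sigma>(1)) simp
  ultimately show "\<rho> \<in> {\<sigma> \<in> shuffles a (Suc b). \<sigma> a = 0}"
    by (auto simp: shuffles_def strict_mono_on_def \<sigma>(2)) (auto simp: cycle_perm_def)
qed

text \<open>A shuffle increases on each block, so the value 0 is taken at the start of one of the
  two.\<close>

lemma shuffles_split:
  assumes "0 < a + b"
  shows "shuffles a b = {\<sigma> \<in> shuffles a b. 0 < a \<and> \<sigma> 0 = 0} \<union> {\<sigma> \<in> shuffles a b. 0 < b \<and> \<sigma> a = 0}"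
proof -
  have "0 < a \<and> \<sigma> 0 = 0 \<or> 0 < b \<and> \<sigma> a = 0" if \<sigma>: "\<sigma> \<in> shuffles a b" for \<sigma>
  proof -
    have "0 \<in> \<sigma> ` {..<a + b}"
      using permutes_image[OF shuffles_permutes[OF \<sigma>]] assms by simp
    then obtain k where k: "k < a + b" "\<sigma> k = 0"
      by (metis image_iff lessThan_iff)
    have mono: "strict_mono_on {..<a} \<sigma>" "strict_mono_on {a..<a + b} \<sigma>"
      using \<sigma> by (auto simp: shuffles_def)
    show ?thesis
    proof (cases "k < a")
      case True
      then show ?thesis
        using strict_mono_onD[OF mono(1), of 0 k] k by (cases "k = 0") auto
    next
      case False
      then show ?thesis
        using strict_mono_onD[OF mono(2), of a k] k by (cases "k = a") auto
    qed
  qed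
  then show ?thesis by blast
qed

text \<open>The exterior product over an arbitrary pairing \<open>P\<close> of the coefficients. As
  \<open>P\<close> may itself be of the form \<open>wed\<close>, the product of (p,q)-cochains is an
  iterated one: the inner product shuffles the g^{1,0} arguments, the outer one those from
  g^{0,1}.\<close>

definition wed :: "('m \<Rightarrow> 'w \<Rightarrow> 'u::real_vector) \<Rightarrow> nat \<Rightarrow> nat \<Rightarrow> ((nat \<Rightarrow> 'g) \<Rightarrow> 'm) \<Rightarrow>
    ((nat \<Rightarrow> 'g) \<Rightarrow> 'w) \<Rightarrow> (nat \<Rightarrow> 'g) \<Rightarrow> 'u" where
  "wed P a b \<phi> \<psi> ys =
     (\<Sum>\<tau>\<in>shuffles a b. real_of_int (sign \<tau>) *\<^sub>R P (\<phi> (ys \<circ> \<tau>)) (\<psi> (\<lambda>k. ys (\<tau> (a + k)))))"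

text \<open>The interior product. Its value 0 in degree 0 keeps the formulas with
  \<open>q - 1\<close> valid although the subtraction truncates.\<close>

definition contract :: "nat \<Rightarrow> 'g \<Rightarrow> ((nat \<Rightarrow> 'g) \<Rightarrow> 'm::zero) \<Rightarrow> (nat \<Rightarrow> 'g) \<Rightarrow> 'm" where
  "contract q y \<phi> = (if q = 0 then (\<lambda>_. 0) else (\<lambda>ys. \<phi> (cons_arg y ys)))"

lemma contract_0 [simp]: "contract 0 y \<phi> = (\<lambda>_. 0)"
  and contract_Suc [simp]: "contract (Suc q) y \<phi> = (\<lambda>ys. \<phi> (cons_arg y ys))"
  by (simp_all add: contract_def)

lemma contract_cochains:
  assumes "\<phi> \<in> cochains M J K q" "subspace M" "linear K"
  shows "contract q y \<phi> \<in> cochains M J K (q - 1)"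
proof (cases q)
  case 0
  then show ?thesis
    using subspace_0[OF subspace_cochains[OF assms(2,3)]] by (simp add: zero_fun_def)
next
  case (Suc q')
  then show ?thesis
    using cochains_cons[of \<phi> M J K q' y] assms(1) by simp
qed

lemma contract_contract:
  assumes "\<phi> \<in> cochains M J K q"
  shows "contract (q - 1) y (contract q y \<phi>) = (\<lambda>_. 0)"
proof -
  consider "q = 0" | "q = Suc 0" | q' where "q = Suc (Suc q')"
    by (metis not0_implies_Suc)
  then show ?thesis
  proof cases
    case (3 q')
    then show ?thesis
      using cochains_alt[OF assms, of 0 1] by (auto simp: fun_eq_iff)
  qed auto
qed

lemma linear_contract: "\<phi> \<in> cochains M J K q \<Longrightarrow> linear (\<lambda>y. contract q y \<phi>)"
  by (cases q) (auto simp: linear_fun_iff cochains_linear_cons linear_zero)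

lemma contract_J: "\<phi> \<in> cochains M J K q \<Longrightarrow> linear K \<Longrightarrow>
    contract q (J y) \<phi> = (\<lambda>ys. K (contract q y \<phi> ys))"
  by (cases q) (auto simp: cochains_J_cons linear_0)

text \<open>Interior multiplication is an antiderivation: the shuffles are sorted by the block that
  receives \<open>y\<close>, and reaching the second block costs the sign of
  \<open>cycle_perm a\<close>.\<close>

lemma wed_cons:
  assumes local: "\<And>zs zs'. (\<And>i. i < a \<Longrightarrow> zs i = zs' i) \<Longrightarrow> \<phi> zs = \<phi> zs'"
    and P0: "\<And>w. P 0 w = 0" "\<And>m. P m 0 = 0" and "0 < a + b"
  shows "wed P a b \<phi> \<psi> (cons_arg y ys) =
    wed P (a - 1) b (contract a y \<phi>) \<psi> ys + (-1) ^ a *\<^sub>R wed P a (b - 1) \<phi> (contract b y \<psi>) ys"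
proof -
  let ?t = "\<lambda>\<tau>. real_of_int (sign \<tau>) *\<^sub>R
    P (\<phi> (cons_arg y ys \<circ> \<tau>)) (\<psi> (\<lambda>k. cons_arg y ys (\<tau> (a + k))))"
  let ?A = "{\<sigma> \<in> shuffles a b. 0 < a \<and> \<sigma> 0 = 0}" and ?B = "{\<sigma> \<in> shuffles a b. 0 < b \<and> \<sigma> a = 0}"
  have "?A \<inter> ?B = {}"
    by (auto dest!: shuffles_permutes permutes_inj) (metis injD less_irrefl)
  then have "wed P a b \<phi> \<psi> (cons_arg y ys) = sum ?t ?A + sum ?t ?B"
    unfolding wed_def by (subst shuffles_split[OF \<open>0 < a + b\<close>], subst sum.union_disjoint)
      (auto simp: finite_shuffles)
  also have "sum ?t ?A = wed P (a - 1) b (contract a y \<phi>) \<psi> ys"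
  proof (cases a)
    case 0
    then show ?thesis by (simp add: wed_def P0)
  next
    case (Suc a')
    have "sum ?t ?A = sum ?t (lift_perm ` shuffles a' b)"
      using Suc by (simp add: shuffles_head_0)
    also have "\<dots> = (\<Sum>\<tau>\<in>shuffles a' b. ?t (lift_perm \<tau>))"
      by (rule sum.reindex_cong[OF inj_on_subset[OF inj_lift_perm]]) auto
    also have "\<dots> = wed P a' b (contract a y \<phi>) \<psi> ys"
      unfolding wed_def
    proof (rule sum.cong[OF refl])
      fix \<tau> assume "\<tau> \<in> shuffles a' b"
      then have "sign (lift_perm \<tau>) = sign \<tau>"
        using sign_lift_perm shuffles_permutes by blast
      moreover have "cons_arg y ys \<circ> lift_perm \<tau> = cons_arg y (ys \<circ> \<tau>)"
        by (auto simp: fun_eq_iff lift_perm_def cons_arg_def split: nat.split)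
      ultimately show "?t (lift_perm \<tau>) = real_of_int (sign \<tau>) *\<^sub>R
          P (contract a y \<phi> (ys \<circ> \<tau>)) (\<psi> (\<lambda>k. ys (\<tau> (a' + k))))"
        using Suc by simp
    qed
    finally show ?thesis using Suc by simp
  qed
  also have "sum ?t ?B = (-1) ^ a *\<^sub>R wed P a (b - 1) \<phi> (contract b y \<psi>) ys"
  proof (cases b)
    case 0
    then show ?thesis by (simp add: wed_def P0)
  next
    case (Suc b')
    let ?f = "\<lambda>\<sigma>. lift_perm \<sigma> \<circ> cycle_perm a"
    have "inj ?f"
    proof (rule injI)
      fix \<sigma> \<tau> assume "?f \<sigma> = ?f \<tau>"
      then have "?f \<sigma> \<circ> inv (cycle_perm a) = ?f \<tau> \<circ> inv (cycle_perm a)"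
        by simp
      then have "lift_perm \<sigma> = lift_perm \<tau>"
        using permutes_inv_o(1)[OF cycle_perm_permutes[of a "Suc a"]] by (simp add: comp_assoc)
      then show "\<sigma> = \<tau>"
        by (rule injD[OF inj_lift_perm])
    qed
    have "sum ?t ?B = sum ?t (?f ` shuffles a b')"
      using Suc by (simp add: shuffles_tail_0)
    also have "\<dots> = (\<Sum>\<tau>\<in>shuffles a b'. ?t (?f \<tau>))"
      by (rule sum.reindex_cong[OF inj_on_subset[OF \<open>inj ?f\<close>]]) auto
    also have "\<dots> = (-1) ^ a *\<^sub>R wed P a b' \<phi> (contract b y \<psi>) ys"
      unfolding wed_def scaleR_sum_right
    proof (rule sum.cong[OF refl])
      fix \<tau> assume "\<tau> \<in> shuffles a b'"
      then have \<tau>: "\<tau> permutes {..<a + b'}"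
        by (rule shuffles_permutes)
      have "sign (?f \<tau>) = sign \<tau> * (-1) ^ a"
        using \<tau> permutes_imp_permutation[OF _ lift_perm_permutes[OF \<tau>]]
        by (simp add: sign_compose permutation_cycle_perm sign_cycle_perm sign_lift_perm)
      moreover have "\<phi> (cons_arg y ys \<circ> ?f \<tau>) = \<phi> (ys \<circ> \<tau>)"
        by (rule local) (simp add: cycle_perm_def)
      moreover have "(\<lambda>k. cons_arg y ys (?f \<tau> (a + k))) = cons_arg y (\<lambda>k. ys (\<tau> (a + k)))"
        by (auto simp: fun_eq_iff cycle_perm_def cons_arg_def lift_perm_def split: nat.split)
      ultimately show "?t (?f \<tau>) = (-1) ^ a *\<^sub>R real_of_int (sign \<tau>) *\<^sub>R
          P (\<phi> (ys \<circ> \<tau>)) (contract b y \<psi> (\<lambda>k. ys (\<tau> (a + k))))"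
        using Suc by simp
    qed
    finally show ?thesis using Suc by simp
  qed
  finally show ?thesis .
qed

lemma linear_wed_left:
  assumes "\<And>w. linear (\<lambda>m. P m w)"
  shows "linear (\<lambda>\<phi>. wed P a b \<phi> \<psi>)"
proof -
  have "linear (\<lambda>\<phi>. r *\<^sub>R P (\<phi> zs) w)" for r zs w
    using linear_of_comp[OF assms[of w], of "\<lambda>\<phi>. \<phi> zs"] by (intro linear_scaleR_o) (simp add: linear_iff)
  then show ?thesis
    unfolding linear_fun_iff wed_def by (intro allI linear_compose_sum ballI)
qed

lemma linear_wed_right:
  assumes "\<And>m. linear (P m)"
  shows "linear (wed P a b \<phi>)"
proof -
  have "linear (\<lambda>\<psi>. r *\<^sub>R P m (\<psi> zs))" for r zs m
    using linear_of_comp[OF assms[of m], of "\<lambda>\<psi>. \<psi> zs"] by (intro linear_scaleR_o) (simp add: linear_iff)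
  then show ?thesis
    unfolding linear_fun_iff wed_def by (intro allI linear_compose_sum ballI)
qed

lemma sum_lessThan_add: "(\<Sum>k<a + b. f k) = (\<Sum>k<a. f k) + (\<Sum>k<b. f (a + k))"
  for f :: "nat \<Rightarrow> 'a::comm_monoid_add"
  by (induction b) (auto simp: add.assoc)

section \<open>Exterior products over a complex bilinear pairing, up to the Leibniz rule\<close>

locale pairing =
  fixes M :: "'m::real_vector set" and M' :: "'w::real_vector set" and N :: "'u::real_vector set"
    and J :: "'g::real_vector \<Rightarrow> 'g" and K :: "'m \<Rightarrow> 'm" and K' :: "'w \<Rightarrow> 'w" and L :: "'u \<Rightarrow> 'u"
    and P :: "'m \<Rightarrow> 'w \<Rightarrow> 'u"
  assumes subspaces: "subspace M" "subspace M'" "subspace N"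
    and linears: "linear K" "linear K'" "linear L"
    and P_left: "linear (\<lambda>m. P m w)" and P_right: "linear (P m)"
    and P_in: "m \<in> M \<Longrightarrow> w \<in> M' \<Longrightarrow> P m w \<in> N"
    and P_K: "P (K m) w = L (P m w)" and P_K': "P m (K' w) = L (P m w)"
begin

lemma P0 [simp]: "P 0 w = 0" "P m 0 = 0"
  using linear_0[OF P_left] linear_0[OF P_right] by auto

lemmas wed_left = linear_wed_left[of P, OF P_left]
lemmas wed_right = linear_wed_right[of P, OF P_right]

lemma wed_0 [simp]: "wed P a b (\<lambda>_. 0) \<psi> ys = 0" "wed P a b \<phi> (\<lambda>_. 0) ys = 0"
  by (simp_all add: wed_def)

lemma wed_step:
  assumes "\<phi> \<in> cochains M J K a" "0 < a + b"
  shows "wed P a b \<phi> \<psi> (cons_arg y ys) =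
    wed P (a - 1) b (contract a y \<phi>) \<psi> ys + (-1) ^ a *\<^sub>R wed P a (b - 1) \<phi> (contract b y \<psi>) ys"
proof (rule wed_cons)
  show "\<phi> zs = \<phi> zs'" if "\<And>i. i < a \<Longrightarrow> zs i = zs' i" for zs zs'
    by (rule cochains_local[OF assms(1) that])
qed (use assms(2) in simp_all)

lemma wed_K: "wed P a b (\<lambda>ys. K (\<phi> ys)) \<psi> ys = L (wed P a b \<phi> \<psi> ys)"
  "wed P a b \<phi> (\<lambda>ys. K' (\<psi> ys)) ys = L (wed P a b \<phi> \<psi> ys)"
  by (simp_all add: wed_def P_K P_K' linear_sum[OF linears(3)] linear_scale[OF linears(3)])

lemma wed_degree_0:
  assumes "\<phi> \<in> cochains M J K 0"
  shows "wed P 0 b \<phi> \<psi> ys = P (\<phi> ys) (\<psi> ys)"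
proof (induction b arbitrary: \<psi> ys)
  case 0
  then show ?case by (simp add: wed_def shuffles_0_0)
next
  case (Suc b)
  have "wed P 0 (Suc b) \<phi> \<psi> (cons_arg (ys 0) (\<lambda>k. ys (Suc k))) =
      P (\<phi> (\<lambda>k. ys (Suc k))) (\<psi> (cons_arg (ys 0) (\<lambda>k. ys (Suc k))))"
    using Suc.IH by (subst wed_step[OF assms]) simp_all
  then show ?case
    using cochains_local[OF assms, of "\<lambda>k. ys (Suc k)" ys] by simp
qed

lemma wed_cochains:
  assumes "\<phi> \<in> cochains M J K a" "\<psi> \<in> cochains M' J K' b"
  shows "wed P a b \<phi> \<psi> \<in> cochains N J L (a + b)"
  using assms
proof (induction "a + b" arbitrary: a b \<phi> \<psi>)
  case 0
  then have "a = 0" "b = 0" by auto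
  note \<phi> = 0(2)[unfolded \<open>a = 0\<close>] and \<psi> = 0(3)[unfolded \<open>b = 0\<close>]
  show ?case
    unfolding \<open>a = 0\<close> \<open>b = 0\<close>
  proof (rule cochainsI)
    show "wed P 0 0 \<phi> \<psi> ys = wed P 0 0 \<phi> \<psi> ys'" for ys ys'
      using cochains_local[OF \<phi>, of ys ys'] cochains_local[OF \<psi>, of ys ys'] by (simp add: wed_degree_0[OF \<phi>])
  qed (simp_all add: wed_degree_0[OF \<phi>] P_in cochains_in[OF \<phi>] cochains_in[OF \<psi>])
next
  case (Suc n)
  note \<phi> = Suc.prems(1) and \<psi> = Suc.prems(2)
  have pos: "0 < a + b" using Suc.hyps(2) by linarith
  note step = wed_step[OF \<phi> pos]
  note c\<phi> = contract_cochains[OF \<phi> subspaces(1) linears(1)]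
  note c\<psi> = contract_cochains[OF \<psi> subspaces(2) linears(2)]
  note sub = subspace_cochains[OF subspaces(3) linears(3)]
  have l: "wed P (a - 1) b (contract a y \<phi>) \<psi> \<in> cochains N J L n" for y
  proof (cases "a = 0")
    case True
    then have "wed P (a - 1) b (contract a y \<phi>) \<psi> = 0"
      by (simp add: fun_eq_iff)
    then show ?thesis using subspace_0[OF sub] by simp
  next
    case False
    then have "n = a - 1 + b" using Suc.hyps(2) by simp
    with Suc.hyps(1)[OF this c\<phi> \<psi>] show ?thesis by simp
  qed
  have r: "wed P a (b - 1) \<phi> (contract b y \<psi>) \<in> cochains N J L n" for y
  proof (cases "b = 0")
    case True
    then have "wed P a (b - 1) \<phi> (contract b y \<psi>) = 0"
      by (simp add: fun_eq_iff)
    then show ?thesis using subspace_0[OF sub] by simp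
  next
    case False
    then have "n = a + (b - 1)" using Suc.hyps(2) by simp
    with Suc.hyps(1)[OF this \<phi> c\<psi>] show ?thesis by simp
  qed
  show ?case
    unfolding Suc.hyps(2)[symmetric]
  proof (rule cochains_SucI)
    show "(\<lambda>ys. wed P a b \<phi> \<psi> (cons_arg y ys)) \<in> cochains N J L n" for y
      using subspace_add[OF sub l[of y] subspace_scale[OF sub r[of y], of "(-1) ^ a"]]
      by (simp add: step plus_fun_def scaleR_fun_def)
    show "linear (\<lambda>y. wed P a b \<phi> \<psi> (cons_arg y ys))" for ys
    proof -
      have "linear (\<lambda>y. wed P (a - 1) b (contract a y \<phi>) \<psi> ys)"
        using linear_of_comp[OF wed_left linear_contract[OF \<phi>]] by (simp add: linear_fun_iff)
      moreover have "linear (\<lambda>y. wed P a (b - 1) \<phi> (contract b y \<psi>) ys)"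
        using linear_of_comp[OF wed_right linear_contract[OF \<psi>]] by (simp add: linear_fun_iff)
      ultimately show ?thesis
        unfolding step by (intro linear_compose_add linear_scaleR_o)
    qed
    show "wed P a b \<phi> \<psi> (cons_arg (J y) ys) = L (wed P a b \<phi> \<psi> (cons_arg y ys))" for y ys
      by (simp add: step contract_J[OF \<phi> linears(1)] contract_J[OF \<psi> linears(2)] wed_K
          linear_add[OF linears(3)] linear_scale[OF linears(3)])
    \<comment> \<open>Of the four terms of a double contraction, two contract one factor twice and
      vanish. The two mixed ones carry the signs (-1)^(a-1) and (-1)^a and cancel.\<close>
    show "wed P a b \<phi> \<psi> (cons_arg y (cons_arg y ys)) = 0" if "0 < n" for y ys
    proof (cases "a = 0")
      case True
      then have "0 < b - 1" using that Suc.hyps(2) by simp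
      then show ?thesis
        unfolding step using wed_step[OF \<phi>, of "b - 1"] contract_contract[OF \<psi>] True by simp
    next
      case a: False
      have "wed P (a - 1) b (contract a y \<phi>) \<psi> (cons_arg y ys) =
          (-1) ^ (a - 1) *\<^sub>R wed P (a - 1) (b - 1) (contract a y \<phi>) (contract b y \<psi>) ys"
        using wed_step[OF c\<phi>, of b] contract_contract[OF \<phi>] Suc.hyps(2) that a by simp
      moreover have "wed P a (b - 1) \<phi> (contract b y \<psi>) (cons_arg y ys) =
          wed P (a - 1) (b - 1) (contract a y \<phi>) (contract b y \<psi>) ys"
        using wed_step[OF \<phi>, of "b - 1"] contract_contract[OF \<psi>] Suc.hyps(2) a by simp
      moreover have "(-1 :: real) ^ a = - ((-1) ^ (a - 1))"
        using a by (cases a) auto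
      ultimately show ?thesis
        by (simp add: step)
    qed
  qed
qed

text \<open>The product rule holds shuffle by shuffle: reindexing the slots along
  \<open>\<tau>\<close> separates the substitutions that hit the first factor from those that hit
  the second.\<close>

lemma lie_wed:
  assumes \<phi>: "\<phi> \<in> cochains M J K a" and \<psi>: "\<psi> \<in> cochains M' J K' b" and "linear A3"
    and A: "\<And>m w. m \<in> M \<Longrightarrow> w \<in> M' \<Longrightarrow> A3 (P m w) = P (A1 m) w + P m (A2 w)"
  shows "lie D A3 (a + b) (wed P a b \<phi> \<psi>) ys =
    wed P a b (lie D A1 a \<phi>) \<psi> ys + wed P a b \<phi> (lie D A2 b \<psi>) ys"
proof -
  let ?s = "\<lambda>\<tau>. real_of_int (sign \<tau>)"
  let ?T = "\<lambda>\<tau> k. ys (\<tau> (a + k))"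
  have shift: "(\<Sum>i<a + b. P (\<phi> (ys(i := D (ys i)) \<circ> \<tau>)) (\<psi> (\<lambda>k. (ys(i := D (ys i))) (\<tau> (a + k))))) =
      (\<Sum>k<a. P (\<phi> ((ys \<circ> \<tau>)(k := D (ys (\<tau> k))))) (\<psi> (?T \<tau>))) +
      (\<Sum>k<b. P (\<phi> (ys \<circ> \<tau>)) (\<psi> ((?T \<tau>)(k := D (?T \<tau> k)))))"
    if \<tau>: "\<tau> \<in> shuffles a b" for \<tau>
  proof -
    let ?f = "\<lambda>i. P (\<phi> (ys(i := D (ys i)) \<circ> \<tau>)) (\<psi> (\<lambda>k. (ys(i := D (ys i))) (\<tau> (a + k))))"
    note inj = permutes_inj[OF shuffles_permutes[OF \<tau>]]
    have "(\<Sum>i<a + b. ?f i) = (\<Sum>k<a + b. ?f (\<tau> k))"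
      using sum.permute[OF shuffles_permutes[OF \<tau>], of ?f] by (simp add: comp_def)
    also have "\<dots> = (\<Sum>k<a. ?f (\<tau> k)) + (\<Sum>k<b. ?f (\<tau> (a + k)))"
      by (rule sum_lessThan_add)
    also have "(\<Sum>k<a. ?f (\<tau> k)) = (\<Sum>k<a. P (\<phi> ((ys \<circ> \<tau>)(k := D (ys (\<tau> k))))) (\<psi> (?T \<tau>)))"
    proof (rule sum.cong[OF refl])
      fix k assume "k \<in> {..<a}"
      then have "ys(\<tau> k := D (ys (\<tau> k))) \<circ> \<tau> = (ys \<circ> \<tau>)(k := D (ys (\<tau> k)))"
        "(\<lambda>j. (ys(\<tau> k := D (ys (\<tau> k)))) (\<tau> (a + j))) = ?T \<tau>"
        using inj by (auto simp: fun_eq_iff inj_eq)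
      then show "?f (\<tau> k) = P (\<phi> ((ys \<circ> \<tau>)(k := D (ys (\<tau> k))))) (\<psi> (?T \<tau>))"
        by simp
    qed
    also have "(\<Sum>k<b. ?f (\<tau> (a + k))) = (\<Sum>k<b. P (\<phi> (ys \<circ> \<tau>)) (\<psi> ((?T \<tau>)(k := D (?T \<tau> k)))))"
    proof (rule sum.cong[OF refl])
      fix k assume "k \<in> {..<b}"
      have "\<phi> (ys(\<tau> (a + k) := D (?T \<tau> k)) \<circ> \<tau>) = \<phi> (ys \<circ> \<tau>)"
        by (rule cochains_local[OF \<phi>]) (use inj in \<open>auto simp: inj_eq\<close>)
      moreover have "(\<lambda>j. (ys(\<tau> (a + k) := D (?T \<tau> k))) (\<tau> (a + j))) = (?T \<tau>)(k := D (?T \<tau> k))"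
        using inj by (auto simp: fun_eq_iff inj_eq)
      ultimately show "?f (\<tau> (a + k)) = P (\<phi> (ys \<circ> \<tau>)) (\<psi> ((?T \<tau>)(k := D (?T \<tau> k))))"
        by simp
    qed
    finally show ?thesis .
  qed
  have "lie D A3 (a + b) (wed P a b \<phi> \<psi>) ys =
      (\<Sum>\<tau>\<in>shuffles a b. ?s \<tau> *\<^sub>R A3 (P (\<phi> (ys \<circ> \<tau>)) (\<psi> (?T \<tau>)))) -
      (\<Sum>\<tau>\<in>shuffles a b. ?s \<tau> *\<^sub>R (\<Sum>i<a + b.
        P (\<phi> (ys(i := D (ys i)) \<circ> \<tau>)) (\<psi> (\<lambda>k. (ys(i := D (ys i))) (\<tau> (a + k))))))"
    unfolding lie_def wed_def linear_sum[OF \<open>linear A3\<close>] linear_scale[OF \<open>linear A3\<close>] scaleR_sum_right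
    by (subst (2) sum.swap) simp
  also have "\<dots> = (\<Sum>\<tau>\<in>shuffles a b. ?s \<tau> *\<^sub>R P (lie D A1 a \<phi> (ys \<circ> \<tau>)) (\<psi> (?T \<tau>)) +
      ?s \<tau> *\<^sub>R P (\<phi> (ys \<circ> \<tau>)) (lie D A2 b \<psi> (?T \<tau>)))"
    unfolding sum_subtractf[symmetric]
  proof (rule sum.cong[OF refl])
    fix \<tau> assume \<tau>: "\<tau> \<in> shuffles a b"
    show "?s \<tau> *\<^sub>R A3 (P (\<phi> (ys \<circ> \<tau>)) (\<psi> (?T \<tau>))) - ?s \<tau> *\<^sub>R (\<Sum>i<a + b.
        P (\<phi> (ys(i := D (ys i)) \<circ> \<tau>)) (\<psi> (\<lambda>k. (ys(i := D (ys i))) (\<tau> (a + k))))) =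
      ?s \<tau> *\<^sub>R P (lie D A1 a \<phi> (ys \<circ> \<tau>)) (\<psi> (?T \<tau>)) + ?s \<tau> *\<^sub>R P (\<phi> (ys \<circ> \<tau>)) (lie D A2 b \<psi> (?T \<tau>))"
      unfolding shift[OF \<tau>] A[OF cochains_in[OF \<phi>] cochains_in[OF \<psi>]] lie_def
        linear_diff[OF P_left] linear_diff[OF P_right] linear_sum[OF P_left] linear_sum[OF P_right]
        scaleR_diff_right[symmetric] scaleR_add_right[symmetric]
      by (simp add: algebra_simps)
  qed
  also have "\<dots> = wed P a b (lie D A1 a \<phi>) \<psi> ys + wed P a b \<phi> (lie D A2 b \<psi>) ys"
    unfolding wed_def sum.distrib ..
  finally show ?thesis .
qed

end

lemma (in ce_structure) d_cons:
  "\<phi> \<in> C q \<Longrightarrow> d q \<phi> (cons_arg y ys) = L y q \<phi> ys - d (q - 1) (contract q y \<phi>) ys"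
  by (cases q) (simp_all add: cartan cartan_0 linear_0[OF linear_d, unfolded zero_fun_def])

text \<open>Both sides are compared after fixing the first argument \<open>y\<close>. Cartan's
  formula leaves L_y, which is a derivation by \<open>lie_wed\<close>, and d of a contraction, to
  which the induction hypothesis applies since contraction lowers the total degree.\<close>

theorem (in pairing) leibniz:
  assumes "ce_structure M J K br act1" "ce_structure M' J K' br act2" "ce_structure N J L br act3"
    and act: "\<And>y m w. m \<in> M \<Longrightarrow> w \<in> M' \<Longrightarrow> act3 y (P m w) = P (act1 y m) w + P m (act2 y w)"
    and "\<phi> \<in> cochains M J K a" "\<psi> \<in> cochains M' J K' b"
  shows "cd br act3 (a + b) (wed P a b \<phi> \<psi>) =
    wed P (Suc a) b (cd br act1 a \<phi>) \<psi> + (-1) ^ a *\<^sub>R wed P a (Suc b) \<phi> (cd br act2 b \<psi>)"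
  using assms(5,6)
proof (induction "a + b" arbitrary: a b \<phi> \<psi> rule: less_induct)
  case less
  interpret E1: ce_structure M J K br act1 by fact
  interpret E2: ce_structure M' J K' br act2 by fact
  interpret E3: ce_structure N J L br act3 by fact
  note \<phi> = less.prems(1) and \<psi> = less.prems(2)
  note c\<phi> = contract_cochains[OF \<phi> subspaces(1) linears(1)]
  note c\<psi> = contract_cochains[OF \<psi> subspaces(2) linears(2)]
  have zero: "E1.d q (\<lambda>_. 0) = (\<lambda>_. 0)" "E2.d q (\<lambda>_. 0) = (\<lambda>_. 0)" "E3.d q (\<lambda>_. 0) = (\<lambda>_. 0)" for q
    using linear_0[OF E1.linear_d] linear_0[OF E2.linear_d] linear_0[OF E3.linear_d]
    by (simp_all add: zero_fun_def)
  \<comment> \<open>The induction hypothesis with \<open>\<phi>\<close> contracted; its sign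
    (-1)^(a-1) is written as -(-1)^a. In degree a = 0 both sides are zero by the convention in
    \<open>contract\<close>.\<close>
  have T1: "E3.d (a + b - 1) (wed P (a - 1) b (contract a y \<phi>) \<psi>) zs =
      wed P a b (E1.d (a - 1) (contract a y \<phi>)) \<psi> zs -
      (-1) ^ a *\<^sub>R wed P (a - 1) (Suc b) (contract a y \<phi>) (E2.d b \<psi>) zs" for y zs
  proof (cases a)
    case 0
    then have "wed P (a - 1) b (contract a y \<phi>) \<psi> = (\<lambda>_. 0)"
      by (auto simp: fun_eq_iff)
    then show ?thesis using 0 by (simp add: zero)
  next
    case (Suc a')
    then show ?thesis
      using less.hyps[OF _ c\<phi> \<psi>, of y] by simp
  qed
  have T2: "E3.d (a + b - 1) (wed P a (b - 1) \<phi> (contract b y \<psi>)) zs =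
      wed P (Suc a) (b - 1) (E1.d a \<phi>) (contract b y \<psi>) zs +
      (-1) ^ a *\<^sub>R wed P a b \<phi> (E2.d (b - 1) (contract b y \<psi>)) zs" for y zs
  proof (cases b)
    case 0
    then have "wed P a (b - 1) \<phi> (contract b y \<psi>) = (\<lambda>_. 0)"
      by (auto simp: fun_eq_iff)
    then show ?thesis using 0 by (simp add: zero)
  next
    case (Suc b')
    then show ?thesis
      using less.hyps[OF _ \<phi> c\<psi>, of y] by simp
  qed
  show ?case
  proof (rule ext)
    fix ys :: "nat \<Rightarrow> 'g"
    define y where "y = ys 0"
    define zs where "zs k = ys (Suc k)" for k
    have ys: "ys = cons_arg y zs"
      by (simp add: y_def zs_def[abs_def])
    have "contract (a + b) y (wed P a b \<phi> \<psi>) =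
        wed P (a - 1) b (contract a y \<phi>) \<psi> + (-1) ^ a *\<^sub>R wed P a (b - 1) \<phi> (contract b y \<psi>)"
    proof (cases "a + b = 0")
      case False
      then obtain n where "a + b = Suc n"
        by (metis not0_implies_Suc)
      then have "contract (a + b) y (wed P a b \<phi> \<psi>) = (\<lambda>ys. wed P a b \<phi> \<psi> (cons_arg y ys))"
        by simp
      then show ?thesis
        using wed_step[OF \<phi>, of b] False by (auto simp: fun_eq_iff)
    qed (auto simp: fun_eq_iff)
    then have lhs: "E3.d (a + b) (wed P a b \<phi> \<psi>) ys = E3.L y (a + b) (wed P a b \<phi> \<psi>) zs -
        (E3.d (a + b - 1) (wed P (a - 1) b (contract a y \<phi>) \<psi>) zs +
         (-1) ^ a *\<^sub>R E3.d (a + b - 1) (wed P a (b - 1) \<phi> (contract b y \<psi>)) zs)"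
      unfolding ys E3.d_cons[OF wed_cochains[OF \<phi> \<psi>]]
      by (simp add: linear_add[OF E3.linear_d] linear_scale[OF E3.linear_d])
    have L: "E3.L y (a + b) (wed P a b \<phi> \<psi>) zs = wed P a b (E1.L y a \<phi>) \<psi> zs + wed P a b \<phi> (E2.L y b \<psi>) zs"
      by (rule lie_wed[OF \<phi> \<psi> E3.linear_act act])
    have "contract (Suc a) y (E1.d a \<phi>) = E1.L y a \<phi> - E1.d (a - 1) (contract a y \<phi>)"
      by (auto simp: fun_eq_iff E1.d_cons[OF \<phi>])
    then have r1: "wed P (Suc a) b (E1.d a \<phi>) \<psi> ys = wed P a b (E1.L y a \<phi>) \<psi> zs -
        wed P a b (E1.d (a - 1) (contract a y \<phi>)) \<psi> zs -
        (-1) ^ a *\<^sub>R wed P (Suc a) (b - 1) (E1.d a \<phi>) (contract b y \<psi>) zs"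
      unfolding ys using wed_step[OF E1.d_in[OF \<phi>], of b \<psi> y zs] by (simp add: linear_diff[OF wed_left])
    have "contract (Suc b) y (E2.d b \<psi>) = E2.L y b \<psi> - E2.d (b - 1) (contract b y \<psi>)"
      by (auto simp: fun_eq_iff E2.d_cons[OF \<psi>])
    then have r2: "wed P a (Suc b) \<phi> (E2.d b \<psi>) ys =
        wed P (a - 1) (Suc b) (contract a y \<phi>) (E2.d b \<psi>) zs + (-1) ^ a *\<^sub>R
          (wed P a b \<phi> (E2.L y b \<psi>) zs - wed P a b \<phi> (E2.d (b - 1) (contract b y \<psi>)) zs)"
      unfolding ys using wed_step[OF \<phi>, of "Suc b" "E2.d b \<psi>" y zs] by (simp add: linear_diff[OF wed_right])
    have sq: "(-1) ^ a * (-1) ^ a = (1::real)"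
      by (simp flip: power_mult_distrib)
    show "E3.d (a + b) (wed P a b \<phi> \<psi>) ys =
        (wed P (Suc a) b (E1.d a \<phi>) \<psi> + (-1) ^ a *\<^sub>R wed P a (Suc b) \<phi> (E2.d b \<psi>)) ys"
      unfolding plus_fun_apply scaleR_fun_apply lhs L r1 r2 T1 T2
      by (simp add: algebra_simps sq)
  qed
qed

section \<open>Top-degree forms and nondegeneracy of the exterior product\<close>

text \<open>A multilinear map is determined by its values on tuples of basis vectors. The
  coefficient maps \<open>s k y\<close> stay abstract so that a real basis and a complex basis
  acting through \<open>K\<close> are both covered.\<close>

lemma cochains_expansion_eq_0:
  assumes \<phi>: "\<phi> \<in> cochains M J K q"
    and expansion: "\<And>ys i y. i < q \<Longrightarrow> \<phi> (ys(i := y)) = (\<Sum>k<N. s k y (\<phi> (ys(i := e k))))"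
    and s0: "\<And>k y. s k y 0 = 0"
    and basis: "\<And>t. (\<And>i. i < q \<Longrightarrow> t i < N) \<Longrightarrow> \<phi> (e \<circ> t) = 0"
  shows "\<phi> ys = 0"
proof -
  \<comment> \<open>Here \<open>m\<close> bounds the slots that may still hold arbitrary vectors;
    each induction step expands one of them.\<close>
  have "m \<le> q \<Longrightarrow> (\<And>i. m \<le> i \<Longrightarrow> i < q \<Longrightarrow> \<exists>j<N. ys i = e j) \<Longrightarrow> \<phi> ys = 0" for m ys
  proof (induction m arbitrary: ys)
    case 0
    then obtain t where t: "t i < N" "ys i = e (t i)" if "i < q" for i
      by (metis zero_le)
    have "\<phi> ys = \<phi> (e \<circ> t)"
      by (rule cochains_local[OF \<phi>]) (simp add: t(2))
    then show ?case
      using basis t(1) by metis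
  next
    case (Suc m)
    have "\<phi> (ys(m := e k)) = 0" if "k < N" for k
    proof (rule Suc.IH)
      show "\<exists>j<N. (ys(m := e k)) i = e j" if "m \<le> i" "i < q" for i
        using Suc.prems(2)[of i] that \<open>k < N\<close> by (cases "i = m") auto
    qed (use Suc.prems in simp)
    then have "\<phi> (ys(m := ys m)) = 0"
      using Suc.prems(1) by (subst expansion) (simp_all add: s0)
    then show ?case
      by (simp only: fun_upd_triv)
  qed
  from this[of q] show ?thesis by simp
qed

lemma cochains_permute_eq_0:
  assumes \<phi>: "\<phi> \<in> cochains M J K q" and "\<phi> e = 0" and "\<pi> permutes {..<q}"
  shows "\<phi> (e \<circ> \<pi>) = 0"
  using finite_lessThan assms(3)
proof (induction rule: permutes_rev_induct)
  case id
  then show ?case using assms(2) by simp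
next
  case (swap a b p)
  show ?case
  proof (cases "a = b")
    case True
    then show ?thesis using swap by simp
  next
    case False
    have "e \<circ> (p \<circ> Transposition.transpose a b) = (e \<circ> p)(a := (e \<circ> p) b, b := (e \<circ> p) a)"
      using False by (auto simp: fun_eq_iff Transposition.transpose_def)
    moreover have "\<phi> ((e \<circ> p)(a := (e \<circ> p) b, b := (e \<circ> p) a)) = - \<phi> (e \<circ> p)"
      using swap False by (intro cochains_swap[OF \<phi>]) auto
    ultimately show ?thesis
      using swap by (simp only: neg_0_equal_iff_equal minus_zero)
  qed
qed

text \<open>A tuple of basis vectors either repeats, which is forced in degrees above
  \<open>N\<close>, or is a permutation of \<open>e\<close>, where the value is the one at
  \<open>e\<close> up to sign.\<close>

lemma cochains_top_eq_0:
  assumes \<phi>: "\<phi> \<in> cochains M J K q"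
    and expansion: "\<And>ys i y. i < q \<Longrightarrow> \<phi> (ys(i := y)) = (\<Sum>k<N. s k y (\<phi> (ys(i := e k))))"
    and s0: "\<And>k y. s k y 0 = 0"
    and top: "N < q \<or> N = q \<and> \<phi> e = 0"
  shows "\<phi> = 0"
proof
  fix ys
  show "\<phi> ys = 0 ys"
    unfolding zero_fun_apply
  proof (rule cochains_expansion_eq_0[OF \<phi> expansion s0])
    fix t :: "nat \<Rightarrow> nat" assume t: "\<And>i. i < q \<Longrightarrow> t i < N"
    show "\<phi> (e \<circ> t) = 0"
    proof (cases "inj_on t {..<q}")
      case False
      then obtain i j where "i < q" "j < q" "i \<noteq> j" "t i = t j"
        by (auto simp: inj_on_def)
      then show ?thesis
        by (intro cochains_alt[OF \<phi>, of i j]) auto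
    next
      case True
      have "t ` {..<q} \<subseteq> {..<N}"
        using t by auto
      then have "q \<le> N"
        using card_inj_on_le[OF True, of "{..<N}"] by simp
      then have N: "N = q" "\<phi> e = 0"
        using top by auto
      \<comment> \<open>Only the values of \<open>t\<close> below \<open>q\<close> matter; the
        identity elsewhere makes it a permutation.\<close>
      define \<pi> where "\<pi> i = (if i < q then t i else i)" for i
      have "\<pi> permutes {..<q}"
        by (rule inj_imp_permutes) (use True t N in \<open>auto simp: \<pi>_def inj_on_def\<close>)
      then have "\<phi> (e \<circ> \<pi>) = 0"
        by (rule cochains_permute_eq_0[OF \<phi> N(2)])
      moreover have "\<phi> (e \<circ> t) = \<phi> (e \<circ> \<pi>)"
        by (rule cochains_local[OF \<phi>]) (simp add: \<pi>_def)
      ultimately show ?thesis by simp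
    qed
  qed
qed

text \<open>In top degree, replacing \<open>e i\<close> by another basis vector creates a
  repetition, so only the diagonal coefficients of \<open>D\<close> survive.\<close>

lemma cochains_top_trace:
  assumes \<phi>: "\<phi> \<in> cochains M J K N"
    and expansion: "\<And>ys i y. i < N \<Longrightarrow> \<phi> (ys(i := y)) = (\<Sum>k<N. s k y (\<phi> (ys(i := e k))))"
    and s0: "\<And>k y. s k y 0 = 0"
  shows "(\<Sum>i<N. \<phi> (e(i := D (e i)))) = (\<Sum>i<N. s i (D (e i)) (\<phi> e))"
proof (rule sum.cong[OF refl])
  fix i assume "i \<in> {..<N}"
  then have i: "i < N" by simp
  have "(\<Sum>k<N. s k (D (e i)) (\<phi> (e(i := e k)))) = (\<Sum>k\<in>{i}. s k (D (e i)) (\<phi> (e(i := e k))))"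
  proof (rule sum.mono_neutral_right)
    show "\<forall>k\<in>{..<N} - {i}. s k (D (e i)) (\<phi> (e(i := e k))) = 0"
    proof
      fix k assume "k \<in> {..<N} - {i}"
      then show "s k (D (e i)) (\<phi> (e(i := e k))) = 0"
        using cochains_alt[OF \<phi>, of i k "e(i := e k)"] i by (simp add: s0)
    qed
  qed (use i in auto)
  then show "\<phi> (e(i := D (e i))) = s i (D (e i)) (\<phi> e)"
    using expansion[OF i, of e "D (e i)"] by simp
qed

text \<open>The scalar z on a space where \<open>K\<close> plays the role of i. On g^{0,1} slots of
  scalar forms \<open>K\<close> is multiplication by -i, so this becomes multiplication by the
  conjugate of z.\<close>

definition cmul :: "('m::real_vector \<Rightarrow> 'm) \<Rightarrow> complex \<Rightarrow> 'm \<Rightarrow> 'm"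
  where "cmul K z m = Re z *\<^sub>R m + Im z *\<^sub>R K m"

lemma linear_cmul: "linear K \<Longrightarrow> linear (cmul K z)"
  by (simp add: cmul_def linear_iff algebra_simps)

lemma linear_cmul_left: "linear f \<Longrightarrow> linear (\<lambda>y. cmul K (f y) m)"
  by (simp add: cmul_def linear_iff algebra_simps)

lemma cmul_one [simp]: "cmul K 1 m = m" and cmul_zero [simp]: "cmul K 0 m = 0"
  by (simp_all add: cmul_def)

section \<open>Complex coefficients, a complex basis and its coframe\<close>

locale complex_coeffs =
  fixes M :: "'m::real_vector set" and K :: "'m \<Rightarrow> 'm"
  assumes subspace: "subspace M" and linear: "linear K" and K_in: "m \<in> M \<Longrightarrow> K m \<in> M"
    and K_K: "K (K m) = - m"

text \<open>A complex basis of (g,J) with its dual coframe. Since g^{1,0} and g^{0,1} are both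
  modelled on g, the same data serve the arguments of either type.\<close>

locale complex_basis =
  fixes J :: "'g::real_vector \<Rightarrow> 'g" and e :: "nat \<Rightarrow> 'g" and \<zeta> :: "nat \<Rightarrow> 'g \<Rightarrow> complex" and n :: nat
  assumes linear_J: "linear J" and J_J: "J (J y) = - y"
    and linear_\<zeta>: "linear (\<zeta> i)" and \<zeta>_J: "\<zeta> i (J y) = \<i> * \<zeta> i y"
    and expansion: "y = (\<Sum>i<n. Re (\<zeta> i y) *\<^sub>R e i + Im (\<zeta> i y) *\<^sub>R J (e i))"
    and dual: "i < n \<Longrightarrow> j < n \<Longrightarrow> \<zeta> i (e j) = (if i = j then 1 else 0)"
begin

lemma cochains_expansion:
  assumes \<phi>: "\<phi> \<in> cochains M J K q" and i: "i < q"
  shows "\<phi> (ys(i := y)) = (\<Sum>k<n. cmul K (\<zeta> k y) (\<phi> (ys(i := e k))))"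
proof -
  note lin = cochains_linear[OF \<phi> i, of ys]
  have "\<phi> (ys(i := y)) = \<phi> (ys(i := (\<Sum>k<n. Re (\<zeta> k y) *\<^sub>R e k + Im (\<zeta> k y) *\<^sub>R J (e k))))"
    using expansion by simp
  also have "\<dots> = (\<Sum>k<n. Re (\<zeta> k y) *\<^sub>R \<phi> (ys(i := e k)) + Im (\<zeta> k y) *\<^sub>R \<phi> (ys(i := J (e k))))"
    by (simp only: linear_sum[OF lin] linear_add[OF lin] linear_scale[OF lin])
  also have "\<dots> = (\<Sum>k<n. cmul K (\<zeta> k y) (\<phi> (ys(i := e k))))"
    by (simp only: cochains_J'[OF \<phi> i] cmul_def)
  finally show ?thesis .
qed

lemma top_eq_0:
  assumes "\<phi> \<in> cochains M J K q" "linear K" "n < q \<or> n = q \<and> \<phi> e = 0"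
  shows "\<phi> = 0"
proof (rule cochains_top_eq_0[OF assms(1) _ _ assms(3)])
  show "\<phi> (ys(i := y)) = (\<Sum>k<n. cmul K (\<zeta> k y) (\<phi> (ys(i := e k))))" if "i < q" for ys i y
    by (rule cochains_expansion[OF assms(1) that])
qed (rule linear_0[OF linear_cmul[OF assms(2)]])

lemma top_trace:
  assumes "\<phi> \<in> cochains M J K n" "linear K"
  shows "(\<Sum>i<n. \<phi> (e(i := D (e i)))) = (\<Sum>i<n. cmul K (\<zeta> i (D (e i))) (\<phi> e))"
proof (rule cochains_top_trace[OF assms(1), where s = "\<lambda>k y. cmul K (\<zeta> k y)"])
  show "\<phi> (ys(i := y)) = (\<Sum>k<n. cmul K (\<zeta> k y) (\<phi> (ys(i := e k))))" if "i < n" for ys i y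
    by (rule cochains_expansion[OF assms(1) that])
qed (rule linear_0[OF linear_cmul[OF assms(2)]])

text \<open>Exterior multiplication by \<open>\<zeta> i\<close>, encoded as a differential of the
  abelian bracket in order to inherit \<open>d_in\<close> and \<open>leibniz\<close>.\<close>

definition ext_mult :: "('m::real_vector \<Rightarrow> 'm) \<Rightarrow> nat \<Rightarrow> nat \<Rightarrow> ((nat \<Rightarrow> 'g) \<Rightarrow> 'm) \<Rightarrow> (nat \<Rightarrow> 'g) \<Rightarrow> 'm"
  where "ext_mult K i = cd (\<lambda>_ _. 0) (\<lambda>y. cmul K (\<zeta> i y))"

lemma ce_structure_abelian:
  assumes "complex_coeffs M K"
    and "\<And>y. linear (act y)" "\<And>m y. m \<in> M \<Longrightarrow> act y m \<in> M" "\<And>m. m \<in> M \<Longrightarrow> linear (\<lambda>y. act y m)"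
    "\<And>y m. m \<in> M \<Longrightarrow> act y (K m) = K (act y m)" "\<And>y m. m \<in> M \<Longrightarrow> act (J y) m = K (act y m)"
  shows "ce_structure M J K (\<lambda>_ _. 0) act"
proof -
  interpret complex_coeffs M K by fact
  show ?thesis
  proof (rule ce_structure.intro)
    show "0 = J 0" by (rule linear_0[OF linear_J, symmetric])
  qed (fact subspace linear K_in assms(2-) linear_zero refl)+
qed

lemma ce_structure_ext:
  assumes "complex_coeffs M K"
  shows "ce_structure M J K (\<lambda>_ _. 0) (\<lambda>y. cmul K (\<zeta> i y))"
proof -
  interpret complex_coeffs M K by fact
  show ?thesis
  proof (rule ce_structure_abelian[OF assms linear_cmul[OF linear] _ linear_cmul_left[OF linear_\<zeta>]])
    show "cmul K (\<zeta> i y) m \<in> M" if "m \<in> M" for m y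
      unfolding cmul_def by (intro subspace_add subspace_scale subspace K_in that)
  qed (simp_all add: cmul_def linear_add[OF linear] linear_scale[OF linear] K_K \<zeta>_J)
qed

lemma ce_structure_trivial:
  assumes "complex_coeffs M K"
  shows "ce_structure M J K (\<lambda>_ _. 0) (\<lambda>_ _. 0)"
proof -
  interpret complex_coeffs M K by fact
  show ?thesis
    by (rule ce_structure_abelian[OF assms])
      (simp_all add: linear_zero linear_0[OF linear] subspace_0[OF subspace])
qed

lemma cd_abelian:
  assumes \<phi>: "\<phi> \<in> cochains M J K q"
  shows "cd (\<lambda>_ _. 0) act q \<phi> ys = (\<Sum>i\<le>q. (-1) ^ i *\<^sub>R act (ys i) (\<phi> (del_arg i ys)))"
proof -
  have "(if i < j then (-1) ^ (i + j) *\<^sub>R \<phi> (cons_arg 0 (del_arg i (del_arg j ys))) else 0) = 0"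
    if j: "j \<le> q" for i j
  proof (cases q)
    case (Suc q')
    then show ?thesis
      using linear_0[OF cochains_linear_cons[OF \<phi>[unfolded Suc]]] by simp
  qed (use j in auto)
  then show ?thesis
    unfolding cd_def by (simp cong: sum.cong_simp)
qed

text \<open>The number operator, counting the missing degrees.\<close>

lemma sum_contract_ext_mult:
  assumes \<phi>: "\<phi> \<in> cochains M J K q" and "linear K"
  shows "(\<Sum>i<n. ext_mult K i q \<phi> (cons_arg (e i) ys)) = (real n - real q) *\<^sub>R \<phi> ys"
proof -
  \<comment> \<open>Contracting the product of \<open>\<zeta> i\<close> and \<open>\<phi>\<close>
    with \<open>e i\<close> gives \<open>\<phi>\<close> minus the product of
    \<open>\<zeta> i\<close> with the contraction of \<open>\<phi>\<close>.\<close>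
  have step: "ext_mult K i q \<phi> (cons_arg (e i) ys) =
      \<phi> ys - (\<Sum>l<q. (-1) ^ l *\<^sub>R cmul K (\<zeta> i (ys l)) (\<phi> (cons_arg (e i) (del_arg l ys))))"
    if "i < n" for i
  proof -
    have "ext_mult K i q \<phi> (cons_arg (e i) ys) = (\<Sum>l<Suc q. (-1) ^ l *\<^sub>R
        cmul K (\<zeta> i (cons_arg (e i) ys l)) (\<phi> (del_arg l (cons_arg (e i) ys))))"
      unfolding ext_mult_def cd_abelian[OF \<phi>] lessThan_Suc_atMost ..
    also have "\<dots> = \<phi> ys - (\<Sum>l<q. (-1) ^ l *\<^sub>R cmul K (\<zeta> i (ys l)) (\<phi> (cons_arg (e i) (del_arg l ys))))"
      by (subst sum.lessThan_Suc_shift) (simp add: dual that sum_negf)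
    finally show ?thesis .
  qed
  \<comment> \<open>Summed over \<open>i\<close>, this is the expansion of \<open>\<phi> ys\<close>
    in its slot \<open>l\<close>; the \<open>q\<close> slots contribute \<open>\<phi> ys\<close>
    each.\<close>
  have move: "(\<Sum>i<n. (-1) ^ l *\<^sub>R cmul K (\<zeta> i (ys l)) (\<phi> (cons_arg (e i) (del_arg l ys)))) = \<phi> ys"
    if l: "l < q" for l
  proof -
    interpret cm: linear "cmul K z" for z by (rule linear_cmul[OF assms(2)])
    have "(-1) ^ l *\<^sub>R cmul K (\<zeta> i (ys l)) (\<phi> (cons_arg (e i) (del_arg l ys))) =
        cmul K (\<zeta> i (ys l)) (\<phi> (ys(l := e i)))" for i
      by (simp add: cochains_move[OF \<phi> l] cm.scale flip: power_mult_distrib)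
    then have "(\<Sum>i<n. (-1) ^ l *\<^sub>R cmul K (\<zeta> i (ys l)) (\<phi> (cons_arg (e i) (del_arg l ys)))) =
        \<phi> (ys(l := ys l))"
      using cochains_expansion[OF \<phi> l, of ys "ys l"] by simp
    then show ?thesis by (simp only: fun_upd_triv)
  qed
  have "(\<Sum>i<n. ext_mult K i q \<phi> (cons_arg (e i) ys)) = (\<Sum>i<n. \<phi> ys) -
      (\<Sum>i<n. \<Sum>l<q. (-1) ^ l *\<^sub>R cmul K (\<zeta> i (ys l)) (\<phi> (cons_arg (e i) (del_arg l ys))))"
    unfolding sum_subtractf[symmetric] by (intro sum.cong refl step) simp
  also have "(\<Sum>i<n. \<Sum>l<q. (-1) ^ l *\<^sub>R cmul K (\<zeta> i (ys l)) (\<phi> (cons_arg (e i) (del_arg l ys)))) =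
      (\<Sum>l<q. \<phi> ys)"
    by (subst sum.swap) (simp add: move)
  finally show ?thesis
    by (simp add: scaleR_diff_left sum_constant_scaleR)
qed

text \<open>The number operator multiplies \<open>\<phi>\<close> by n - q, which is nonzero below
  the top degree. This takes the place of a basis of monomials.\<close>

lemma ext_mult_eq_0_imp:
  assumes "\<phi> \<in> cochains M J K q" "linear K" "q < n" "\<And>i. i < n \<Longrightarrow> ext_mult K i q \<phi> = 0"
  shows "\<phi> = 0"
proof
  fix ys
  have "(real n - real q) *\<^sub>R \<phi> ys = 0"
    unfolding sum_contract_ext_mult[OF assms(1,2), symmetric] using assms(4) by simp
  then show "\<phi> ys = 0 ys"
    using assms(3) by simp
qed

section \<open>Finite families separating the factors of an exterior product\<close>

context
  fixes M :: "'m::real_vector set" and M' :: "'w::real_vector set" and N :: "'u::real_vector set"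
    and K K' L and P :: "'m \<Rightarrow> 'w \<Rightarrow> 'u"
  assumes pairing: "pairing M M' N K K' L P"
    and coeffs: "complex_coeffs M K" "complex_coeffs M' K'" "complex_coeffs N L"
begin

interpretation pairing M M' N J K K' L P by (rule pairing)

text \<open>Associativity as a Leibniz rule: \<open>a\<close> becomes abelian and acts by
  \<open>\<zeta> i\<close> on the left coefficients and by zero on the right ones.\<close>

lemma wed_ext_mult_left:
  assumes \<phi>: "\<phi> \<in> cochains M J K a" and \<psi>: "\<psi> \<in> cochains M' J K' b"
  shows "ext_mult L i (a + b) (wed P a b \<phi> \<psi>) = wed P (Suc a) b (ext_mult K i a \<phi>) \<psi>"
proof -
  have "cd (\<lambda>_ _. 0) (\<lambda>_ _. 0) b \<psi> = 0"
    by (simp add: fun_eq_iff cd_abelian[OF \<psi>])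
  moreover have "cmul L z (P m w) = P (cmul K z m) w + P m 0" for z m w
    by (simp add: cmul_def linear_add[OF P_left] linear_scale[OF P_left] P_K)
  ultimately show ?thesis
    using leibniz[OF ce_structure_ext[OF coeffs(1), of i] ce_structure_trivial[OF coeffs(2)]
        ce_structure_ext[OF coeffs(3), of i] _ \<phi> \<psi>]
    by (simp add: ext_mult_def linear_0[OF wed_right])
qed

lemma wed_ext_mult_right:
  assumes \<phi>: "\<phi> \<in> cochains M J K a" and \<psi>: "\<psi> \<in> cochains M' J K' b"
  shows "ext_mult L i (a + b) (wed P a b \<phi> \<psi>) = (-1) ^ a *\<^sub>R wed P a (Suc b) \<phi> (ext_mult K' i b \<psi>)"
proof -
  have "cd (\<lambda>_ _. 0) (\<lambda>_ _. 0) a \<phi> = 0"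
    by (simp add: fun_eq_iff cd_abelian[OF \<phi>])
  moreover have "cmul L z (P m w) = P 0 w + P m (cmul K' z w)" for z m w
    by (simp add: cmul_def linear_add[OF P_right] linear_scale[OF P_right] P_K')
  ultimately show ?thesis
    using leibniz[OF ce_structure_trivial[OF coeffs(1)] ce_structure_ext[OF coeffs(2), of i]
        ce_structure_ext[OF coeffs(3), of i] _ \<phi> \<psi>]
    by (simp add: ext_mult_def linear_0[OF wed_left])
qed

text \<open>Induction on \<open>a\<close>, multiplying the family by every \<open>\<zeta> i\<close>.
  If all these products kill \<open>\<psi>\<close>, then every \<open>\<zeta> i\<close> kills the
  product of \<open>\<gamma>\<close> and \<open>\<psi>\<close>, whose degree is still below
  \<open>n\<close>, so that product is zero.\<close>

lemma wed_separating_left: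
  assumes U: "finite U" "U \<subseteq> M" "\<And>w. w \<in> M' \<Longrightarrow> (\<And>u. u \<in> U \<Longrightarrow> P u w = 0) \<Longrightarrow> w = 0"
  shows "\<exists>\<Gamma>. finite \<Gamma> \<and> \<Gamma> \<subseteq> cochains M J K a \<and> (\<forall>b. a + b \<le> n \<longrightarrow>
    (\<forall>\<psi>\<in>cochains M' J K' b. (\<forall>\<gamma>\<in>\<Gamma>. wed P a b \<gamma> \<psi> = 0) \<longrightarrow> \<psi> = 0))"
proof (induction a)
  case 0
  have const: "(\<lambda>_. u) \<in> cochains M J K 0" if "u \<in> U" for u
    by (rule cochainsI) (use that U in auto)
  show ?case
  proof (intro exI conjI allI ballI impI)
    show "finite ((\<lambda>u _. u) ` U)" using U by simp
    show "(\<lambda>u _. u) ` U \<subseteq> cochains M J K 0" using const by auto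
    fix b \<psi> assume \<psi>: "\<psi> \<in> cochains M' J K' b" and "\<forall>\<gamma>\<in>(\<lambda>u _. u) ` U. wed P 0 b \<gamma> \<psi> = 0"
    then have "P u (\<psi> ys) = 0" if "u \<in> U" for u ys
      using wed_degree_0[OF const[OF that], of b \<psi> ys] that by simp
    then show "\<psi> = 0"
      using U(3)[OF cochains_in[OF \<psi>]] by (auto simp: fun_eq_iff)
  qed
next
  case (Suc a)
  then obtain \<Gamma> where \<Gamma>: "finite \<Gamma>" "\<Gamma> \<subseteq> cochains M J K a" and sep: "\<forall>b. a + b \<le> n \<longrightarrow>
      (\<forall>\<psi>\<in>cochains M' J K' b. (\<forall>\<gamma>\<in>\<Gamma>. wed P a b \<gamma> \<psi> = 0) \<longrightarrow> \<psi> = 0)"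
    by (elim exE conjE)
  let ?G = "(\<lambda>(i, \<gamma>). ext_mult K i a \<gamma>) ` ({..<n} \<times> \<Gamma>)"
  show ?case
  proof (intro exI conjI allI ballI impI)
    show "finite ?G" using \<Gamma> by simp
    show "?G \<subseteq> cochains M J K (Suc a)"
    proof clarify
      show "ext_mult K i a \<gamma> \<in> cochains M J K (Suc a)" if "\<gamma> \<in> \<Gamma>" for i \<gamma>
        unfolding ext_mult_def
        by (rule ce_structure.d_in[OF ce_structure_ext[OF coeffs(1)]]) (use \<Gamma>(2) that in blast)
    qed
    fix b \<psi> assume b: "Suc a + b \<le> n" and \<psi>: "\<psi> \<in> cochains M' J K' b"
      and 0: "\<forall>\<gamma>\<in>?G. wed P (Suc a) b \<gamma> \<psi> = 0"
    have "wed P a b \<gamma> \<psi> = 0" if \<gamma>: "\<gamma> \<in> \<Gamma>" for \<gamma>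
    proof (rule ext_mult_eq_0_imp)
      have \<gamma>': "\<gamma> \<in> cochains M J K a" using \<gamma> \<Gamma>(2) by blast
      show "wed P a b \<gamma> \<psi> \<in> cochains N J L (a + b)"
        by (rule wed_cochains[OF \<gamma>' \<psi>])
      show "ext_mult L i (a + b) (wed P a b \<gamma> \<psi>) = 0" if "i < n" for i
        unfolding wed_ext_mult_left[OF \<gamma>' \<psi>] using 0 that \<gamma> by auto
    qed (use b linears in auto)
    then show "\<psi> = 0"
      using sep[rule_format, OF _ \<psi>] b by simp
  qed
qed

lemma wed_degree_0_right:
  assumes "\<phi> \<in> cochains M J K a" "\<psi> \<in> cochains M' J K' 0"
  shows "wed P a 0 \<phi> \<psi> ys = P (\<phi> ys) (\<psi> ys)"
  using assms(1)
proof (induction a arbitrary: \<phi> ys)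
  case 0
  then show ?case by (simp add: wed_degree_0)
next
  case (Suc a)
  have "wed P (Suc a) 0 \<phi> \<psi> (cons_arg (ys 0) (\<lambda>k. ys (Suc k))) =
      P (\<phi> (cons_arg (ys 0) (\<lambda>k. ys (Suc k)))) (\<psi> (\<lambda>k. ys (Suc k)))"
    using Suc.IH[OF cochains_cons[OF Suc.prems]] by (subst wed_step[OF Suc.prems]) simp_all
  then show ?case
    using cochains_local[OF assms(2), of "\<lambda>k. ys (Suc k)" ys] by simp
qed

text \<open>The mirror image: the coframe multiplies the right factor, at the cost of a sign that
  does not affect vanishing.\<close>

lemma wed_separating_right:
  assumes U: "finite U" "U \<subseteq> M'" "\<And>m. m \<in> M \<Longrightarrow> (\<And>u. u \<in> U \<Longrightarrow> P m u = 0) \<Longrightarrow> m = 0"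
  shows "\<exists>\<Gamma>. finite \<Gamma> \<and> \<Gamma> \<subseteq> cochains M' J K' b \<and> (\<forall>a. a + b \<le> n \<longrightarrow>
    (\<forall>\<phi>\<in>cochains M J K a. (\<forall>\<gamma>\<in>\<Gamma>. wed P a b \<phi> \<gamma> = 0) \<longrightarrow> \<phi> = 0))"
proof (induction b)
  case 0
  have const: "(\<lambda>_. u) \<in> cochains M' J K' 0" if "u \<in> U" for u
    by (rule cochainsI) (use that U in auto)
  show ?case
  proof (intro exI conjI allI ballI impI)
    show "finite ((\<lambda>u _. u) ` U)" using U by simp
    show "(\<lambda>u _. u) ` U \<subseteq> cochains M' J K' 0" using const by auto
    fix a \<phi> assume \<phi>: "\<phi> \<in> cochains M J K a" and "\<forall>\<gamma>\<in>(\<lambda>u _. u) ` U. wed P a 0 \<phi> \<gamma> = 0"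
    then have "P (\<phi> ys) u = 0" if "u \<in> U" for u ys
      using wed_degree_0_right[OF \<phi> const[OF that], of ys] that by simp
    then show "\<phi> = 0"
      using U(3)[OF cochains_in[OF \<phi>]] by (auto simp: fun_eq_iff)
  qed
next
  case (Suc b)
  then obtain \<Gamma> where \<Gamma>: "finite \<Gamma>" "\<Gamma> \<subseteq> cochains M' J K' b" and sep: "\<forall>a. a + b \<le> n \<longrightarrow>
      (\<forall>\<phi>\<in>cochains M J K a. (\<forall>\<gamma>\<in>\<Gamma>. wed P a b \<phi> \<gamma> = 0) \<longrightarrow> \<phi> = 0)"
    by (elim exE conjE)
  let ?G = "(\<lambda>(i, \<gamma>). ext_mult K' i b \<gamma>) ` ({..<n} \<times> \<Gamma>)"
  show ?case
  proof (intro exI conjI allI ballI impI)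
    show "finite ?G" using \<Gamma> by simp
    show "?G \<subseteq> cochains M' J K' (Suc b)"
    proof clarify
      show "ext_mult K' i b \<gamma> \<in> cochains M' J K' (Suc b)" if "\<gamma> \<in> \<Gamma>" for i \<gamma>
        unfolding ext_mult_def
        by (rule ce_structure.d_in[OF ce_structure_ext[OF coeffs(2)]]) (use \<Gamma>(2) that in blast)
    qed
    fix a \<phi> assume a: "a + Suc b \<le> n" and \<phi>: "\<phi> \<in> cochains M J K a"
      and 0: "\<forall>\<gamma>\<in>?G. wed P a (Suc b) \<phi> \<gamma> = 0"
    have "wed P a b \<phi> \<gamma> = 0" if \<gamma>: "\<gamma> \<in> \<Gamma>" for \<gamma>
    proof (rule ext_mult_eq_0_imp)
      have \<gamma>': "\<gamma> \<in> cochains M' J K' b" using \<gamma> \<Gamma>(2) by blast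
      show "wed P a b \<phi> \<gamma> \<in> cochains N J L (a + b)"
        by (rule wed_cochains[OF \<phi> \<gamma>'])
      show "ext_mult L i (a + b) (wed P a b \<phi> \<gamma>) = 0" if "i < n" for i
        unfolding wed_ext_mult_right[OF \<phi> \<gamma>'] using 0 that \<gamma> by auto
    qed (use a linears in auto)
    then show "\<phi> = 0"
      using sep[rule_format, OF _ \<phi>] a by simp
  qed
qed

end

end

section \<open>Finite-dimensional linear algebra\<close>

text \<open>Induction on \<open>F\<close>: on the kernel of one \<open>g k\<close> the remaining
  functionals suffice, and one vector outside that kernel fixes the missing coefficient.\<close>

lemma functional_combination:
  fixes D :: "'v::real_vector set" and f :: "'v \<Rightarrow> real" and g :: "'k \<Rightarrow> 'v \<Rightarrow> real"
  assumes "finite F" "subspace D" "linear f" "\<And>k. k \<in> F \<Longrightarrow> linear (g k)"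
    and "\<And>x. x \<in> D \<Longrightarrow> (\<And>k. k \<in> F \<Longrightarrow> g k x = 0) \<Longrightarrow> f x = 0"
  shows "\<exists>c. \<forall>x\<in>D. f x = (\<Sum>k\<in>F. c k * g k x)"
  using assms
proof (induction F arbitrary: D rule: finite_induct)
  case empty
  then show ?case by simp
next
  case (insert k F)
  define D' where "D' = {x \<in> D. g k x = 0}"
  have lin: "linear (g k)" using insert.prems(3) by simp
  have "subspace D'"
    using insert.prems(1) by (simp add: D'_def subspace_def linear_0[OF lin] linear_add[OF lin] linear_scale[OF lin])
  then have "\<exists>c. \<forall>x\<in>D'. f x = (\<Sum>k\<in>F. c k * g k x)"
  proof (rule insert.IH)
    show "f x = 0" if "x \<in> D'" "\<And>l. l \<in> F \<Longrightarrow> g l x = 0" for x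
      using that insert.prems(4)[of x] by (auto simp: D'_def)
  qed (use insert.prems in auto)
  then obtain c where c: "\<And>x. x \<in> D' \<Longrightarrow> f x = (\<Sum>k\<in>F. c k * g k x)"
    by blast
  show ?case
  proof (cases "\<exists>x0\<in>D. g k x0 \<noteq> 0")
    case False
    then have "f x = (\<Sum>l\<in>insert k F. c l * g l x)" if "x \<in> D" for x
      using c[of x] that insert.hyps by (simp add: D'_def)
    then show ?thesis by blast
  next
    case True
    then obtain x0 where x0: "x0 \<in> D" "g k x0 \<noteq> 0" by blast
    \<comment> \<open>The value forced by evaluating the desired identity at
      \<open>x0\<close>.\<close>
    define t where "t = (f x0 - (\<Sum>l\<in>F. c l * g l x0)) / g k x0"
    have "f x = (\<Sum>l\<in>insert k F. (c(k := t)) l * g l x)" if x: "x \<in> D" for x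
    proof -
      let ?r = "g k x / g k x0"
      have lins: "linear (g l)" if "l \<in> F" for l
        using insert.prems(3) that by simp
      have "x - ?r *\<^sub>R x0 \<in> D'"
        using x0 x insert.prems(1)
        by (simp add: D'_def subspace_diff subspace_scale linear_diff[OF lin] linear_scale[OF lin])
      then have "f (x - ?r *\<^sub>R x0) = (\<Sum>l\<in>F. c l * g l (x - ?r *\<^sub>R x0))"
        by (rule c)
      then have "f x - ?r * f x0 = (\<Sum>l\<in>F. c l * g l (x - ?r *\<^sub>R x0))"
        by (simp only: linear_diff[OF \<open>linear f\<close>] linear_scale[OF \<open>linear f\<close>] real_scaleR_def)
      also have "\<dots> = (\<Sum>l\<in>F. c l * g l x) - ?r * (\<Sum>l\<in>F. c l * g l x0)"
        unfolding sum_distrib_left sum_subtractf[symmetric]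
        by (intro sum.cong refl) (simp add: linear_diff[OF lins] linear_scale[OF lins] algebra_simps)
      finally have "f x = t * g k x + (\<Sum>l\<in>F. c l * g l x)"
        using x0(2) by (simp add: t_def field_simps)
      also have "(\<Sum>l\<in>F. c l * g l x) = (\<Sum>l\<in>F. (c(k := t)) l * g l x)"
        using insert.hyps by (intro sum.cong) auto
      finally show ?thesis
        using insert.hyps by simp
    qed
    then show ?thesis by blast
  qed
qed

text \<open>Vanishing on the kernel of \<open>\<delta>\<close> makes \<open>P \<alpha>\<close> a
  combination of the functionals obtained by pairing \<open>\<delta>\<close> with the members of
  \<open>\<Gamma>\<close>. By adjointness that combination is the pairing with some
  \<open>d \<gamma>\<close>, and nondegeneracy gives equality. Finiteness enters only through
  \<open>\<Gamma>\<close>.\<close>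

lemma annihilator_kernel_in_image:
  fixes P :: "'a::real_vector \<Rightarrow> 'b::real_vector \<Rightarrow> real" and P' :: "'c::real_vector \<Rightarrow> 'd::real_vector \<Rightarrow> real"
  assumes sub: "subspace A" "subspace B" "subspace C"
    and d: "linear d" "\<And>\<gamma>. \<gamma> \<in> C \<Longrightarrow> d \<gamma> \<in> A" and \<delta>: "linear \<delta>"
    and P: "\<And>\<phi>. linear (P \<phi>)" "\<And>\<beta>. linear (\<lambda>\<phi>. P \<phi> \<beta>)"
    and P': "\<And>\<gamma>. linear (P' \<gamma>)" "\<And>\<eta>. linear (\<lambda>\<gamma>. P' \<gamma> \<eta>)"
    and \<Gamma>: "finite \<Gamma>" "\<Gamma> \<subseteq> C"
      "\<And>\<beta>. \<beta> \<in> B \<Longrightarrow> (\<And>\<gamma>. \<gamma> \<in> \<Gamma> \<Longrightarrow> P' \<gamma> (\<delta> \<beta>) = 0) \<Longrightarrow> \<delta> \<beta> = 0"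
    and adjoint: "\<And>\<gamma> \<beta>. \<gamma> \<in> C \<Longrightarrow> \<beta> \<in> B \<Longrightarrow> P (d \<gamma>) \<beta> = s * P' \<gamma> (\<delta> \<beta>)" and "s \<noteq> 0"
    and nondeg: "\<And>\<phi>. \<phi> \<in> A \<Longrightarrow> (\<And>\<beta>. \<beta> \<in> B \<Longrightarrow> P \<phi> \<beta> = 0) \<Longrightarrow> \<phi> = 0"
    and \<alpha>: "\<alpha> \<in> A" "\<And>\<beta>. \<beta> \<in> B \<Longrightarrow> \<delta> \<beta> = 0 \<Longrightarrow> P \<alpha> \<beta> = 0"
  shows "\<exists>\<gamma>\<in>C. \<alpha> = d \<gamma>"
proof -
  have "\<exists>c. \<forall>\<beta>\<in>B. P \<alpha> \<beta> = (\<Sum>\<gamma>\<in>\<Gamma>. c \<gamma> * P' \<gamma> (\<delta> \<beta>))"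
  proof (rule functional_combination[OF \<Gamma>(1) sub(2) P(1)])
    show "linear (\<lambda>\<beta>. P' \<gamma> (\<delta> \<beta>))" for \<gamma>
      by (rule linear_of_comp[OF P'(1) \<delta>])
    show "P \<alpha> \<beta> = 0" if "\<beta> \<in> B" "\<And>\<gamma>. \<gamma> \<in> \<Gamma> \<Longrightarrow> P' \<gamma> (\<delta> \<beta>) = 0" for \<beta>
      by (rule \<alpha>(2)[OF that(1) \<Gamma>(3)[OF that]])
  qed
  then obtain c where c: "\<And>\<beta>. \<beta> \<in> B \<Longrightarrow> P \<alpha> \<beta> = (\<Sum>\<gamma>\<in>\<Gamma>. c \<gamma> * P' \<gamma> (\<delta> \<beta>))"
    by blast
  \<comment> \<open>Division by \<open>s\<close> undoes the factor in the adjointness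
    relation.\<close>
  define \<gamma> where "\<gamma> = (\<Sum>\<gamma>\<in>\<Gamma>. (c \<gamma> / s) *\<^sub>R \<gamma>)"
  have \<gamma>: "\<gamma> \<in> C"
    unfolding \<gamma>_def using \<Gamma>(2) by (intro subspace_sum[OF sub(3)] subspace_scale[OF sub(3)]) blast
  have "P (\<alpha> - d \<gamma>) \<beta> = 0" if "\<beta> \<in> B" for \<beta>
  proof -
    have "P (d \<gamma>) \<beta> = s * (\<Sum>\<gamma>\<in>\<Gamma>. (c \<gamma> / s) * P' \<gamma> (\<delta> \<beta>))"
      unfolding adjoint[OF \<gamma> that] unfolding \<gamma>_def linear_sum[OF P'(2)] linear_scale[OF P'(2)] by simp
    also have "\<dots> = P \<alpha> \<beta>"
      unfolding c[OF that] sum_distrib_left using \<open>s \<noteq> 0\<close> by (intro sum.cong) auto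
    finally show ?thesis
      by (simp add: linear_diff[OF P(2)])
  qed
  then have "\<alpha> - d \<gamma> = 0"
    by (rule nondeg[OF subspace_diff[OF sub(1) \<alpha>(1) d(2)[OF \<gamma>]]])
  then show ?thesis
    using \<gamma> by auto
qed

text \<open>Coordinates in a finite-dimensional normed space are bounded by the norm. The induction
  needs the new vector to have positive distance from the span of the old ones, that is, closedness
  of this span.\<close>

lemma coefficients_bounded:
  fixes B :: "'e::real_normed_vector set"
  assumes "finite B" "independent B"
  shows "\<exists>c. \<forall>a. (\<Sum>b\<in>B. \<bar>a b\<bar>) \<le> c * norm (\<Sum>b\<in>B. a b *\<^sub>R b)"
  using assms
proof (induction B rule: finite_induct)
  case empty
  then show ?case by simp
next
  case (insert v B)
  have ind: "independent B" "v \<notin> span B"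
    using insert.prems insert.hyps by (auto simp: independent_insert)
  then obtain c where c: "\<And>a. (\<Sum>b\<in>B. \<bar>a b\<bar>) \<le> c * norm (\<Sum>b\<in>B. a b *\<^sub>R b)"
    using insert.IH by blast
  \<comment> \<open>Otherwise combinations of \<open>B\<close> converge to \<open>v\<close>; by the
    bound for \<open>B\<close> their coefficients are Cauchy, and the limits write \<open>v\<close>
    as a combination of \<open>B\<close>.\<close>
  have "\<exists>\<delta>>0. \<forall>a. \<delta> \<le> norm (v - (\<Sum>b\<in>B. a b *\<^sub>R b))"
  proof (rule ccontr)
    assume "\<not> ?thesis"
    then have "\<exists>a. norm (v - (\<Sum>b\<in>B. a b *\<^sub>R b)) < inverse (real (Suc m))" for m
      by (metis inverse_positive_iff_positive not_le of_nat_0_less_iff zero_less_Suc)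
    then obtain a where a: "\<And>m. norm (v - (\<Sum>b\<in>B. a m b *\<^sub>R b)) < inverse (real (Suc m))"
      by metis
    define s where "s m = (\<Sum>b\<in>B. a m b *\<^sub>R b)" for m
    have "(\<lambda>m. v - s m) \<longlonglongrightarrow> 0"
      by (rule tendsto_norm_zero_cancel, rule tendsto_sandwich[OF _ _ tendsto_const LIMSEQ_inverse_real_of_nat])
        (use a in \<open>auto simp: s_def intro!: always_eventually less_imp_le\<close>)
    then have s: "s \<longlonglongrightarrow> v"
      using tendsto_diff[OF tendsto_const[of v]] by fastforce
    have "convergent (\<lambda>m. a m b)" if b: "b \<in> B" for b
    proof -
      have "Cauchy (\<lambda>m. a m b)"
      proof (rule metric_CauchyI)
        fix \<epsilon> :: real assume "\<epsilon> > 0"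
        then have "\<epsilon> / (\<bar>c\<bar> + 1) > 0" by simp
        then obtain M where M: "\<And>k l. k \<ge> M \<Longrightarrow> l \<ge> M \<Longrightarrow> dist (s k) (s l) < \<epsilon> / (\<bar>c\<bar> + 1)"
          using metric_CauchyD[OF LIMSEQ_imp_Cauchy[OF s]] by blast
        have "dist (a k b) (a l b) < \<epsilon>" if "k \<ge> M" "l \<ge> M" for k l
        proof -
          have "dist (a k b) (a l b) \<le> (\<Sum>b\<in>B. \<bar>a k b - a l b\<bar>)"
            using member_le_sum[OF b _ insert.hyps(1), of "\<lambda>b. \<bar>a k b - a l b\<bar>"] by (simp add: dist_real_def)
          also have "\<dots> \<le> c * norm (s k - s l)"
            using c[of "\<lambda>b. a k b - a l b"] by (simp add: s_def sum_subtractf scaleR_diff_left)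
          also have "\<dots> \<le> (\<bar>c\<bar> + 1) * dist (s k) (s l)"
            by (simp add: dist_norm mult_right_mono)
          also have "\<dots> < \<epsilon>"
            using M[OF that] by (simp add: field_simps)
          finally show ?thesis .
        qed
        then show "\<exists>M. \<forall>k\<ge>M. \<forall>l\<ge>M. dist (a k b) (a l b) < \<epsilon>" by blast
      qed
      then show ?thesis
        by (simp add: Cauchy_convergent_iff)
    qed
    then have "\<forall>b\<in>B. \<exists>l. (\<lambda>m. a m b) \<longlonglongrightarrow> l"
      by (simp add: convergent_def)
    then obtain l where l: "\<And>b. b \<in> B \<Longrightarrow> (\<lambda>m. a m b) \<longlonglongrightarrow> l b"
      by metis
    have "s \<longlonglongrightarrow> (\<Sum>b\<in>B. l b *\<^sub>R b)"
      unfolding s_def[abs_def] by (intro tendsto_sum tendsto_scaleR l tendsto_const)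
    then have "v = (\<Sum>b\<in>B. l b *\<^sub>R b)"
      by (rule LIMSEQ_unique[OF s])
    then have "v \<in> span B"
      by (auto intro!: span_sum span_scale intro: span_base)
    with ind show False by simp
  qed
  then obtain \<delta> where \<delta>: "\<delta> > 0" "\<And>a. \<delta> \<le> norm (v - (\<Sum>b\<in>B. a b *\<^sub>R b))"
    by blast
  have "(\<Sum>b\<in>insert v B. \<bar>a b\<bar>) \<le>
      (1 / \<delta> + \<bar>c\<bar> * (1 + norm v / \<delta>)) * norm (\<Sum>b\<in>insert v B. a b *\<^sub>R b)" for a
  proof -
    define w where "w = (\<Sum>b\<in>B. a b *\<^sub>R b)"
    define t where "t = a v"
    let ?N = "norm (t *\<^sub>R v + w)"
    have t: "\<bar>t\<bar> \<le> ?N / \<delta>"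
    proof (cases "t = 0")
      case False
      \<comment> \<open>Scaling by \<open>t\<close> turns the distance bound into a bound on the
        coefficient of \<open>v\<close>.\<close>
      have "\<delta> \<le> norm (v - (\<Sum>b\<in>B. (- a b / t) *\<^sub>R b))" by (rule \<delta>(2))
      also have "(\<Sum>b\<in>B. (- a b / t) *\<^sub>R b) = - (1 / t) *\<^sub>R w"
        by (simp add: w_def scaleR_sum_right sum_negf divide_inverse mult.commute)
      finally have "\<bar>t\<bar> * \<delta> \<le> \<bar>t\<bar> * norm (v - - (1 / t) *\<^sub>R w)"
        by (simp add: mult_left_mono)
      also have "\<dots> = norm (t *\<^sub>R (v - - (1 / t) *\<^sub>R w))" by simp
      also have "t *\<^sub>R (v - - (1 / t) *\<^sub>R w) = t *\<^sub>R v + w"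
        using False by (simp add: algebra_simps)
      finally show ?thesis using \<delta>(1) by (simp add: field_simps)
    qed (use \<delta> in simp)
    have "norm w \<le> ?N + \<bar>t\<bar> * norm v"
      using norm_triangle_ineq4[of "t *\<^sub>R v + w" "t *\<^sub>R v"] by simp
    also have "\<dots> \<le> ?N + ?N / \<delta> * norm v"
      using mult_right_mono[OF t, of "norm v"] by simp
    finally have "\<bar>c\<bar> * norm w \<le> \<bar>c\<bar> * (?N + ?N / \<delta> * norm v)"
      by (rule mult_left_mono) simp
    moreover have "(\<Sum>b\<in>B. \<bar>a b\<bar>) \<le> \<bar>c\<bar> * norm w"
      using c[of a] by (simp add: w_def) (meson abs_ge_self mult_right_mono norm_ge_zero order_trans)
    ultimately have "\<bar>t\<bar> + (\<Sum>b\<in>B. \<bar>a b\<bar>) \<le> ?N / \<delta> + \<bar>c\<bar> * (?N + ?N / \<delta> * norm v)"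
      using t by linarith
    also have "\<dots> = (1 / \<delta> + \<bar>c\<bar> * (1 + norm v / \<delta>)) * ?N"
      by (simp add: algebra_simps)
    finally show ?thesis
      using insert.hyps by (simp add: t_def w_def)
  qed
  then show ?case by blast
qed

lemma fin_dim_basis:
  assumes "fin_dim (UNIV :: 'e::real_vector set)"
  obtains B :: "'e::real_vector set" where "finite B" "independent B" "span B = UNIV"
proof -
  obtain S :: "'e set" where S: "finite S" "span S = UNIV"
    using assms by (auto simp: fin_dim_def)
  obtain B where "B \<subseteq> S" "independent B" "S \<subseteq> span B"
    using maximal_independent_subset[of S] by blast
  moreover from this have "span B = UNIV"
    using S(2) span_minimal[OF \<open>S \<subseteq> span B\<close> subspace_span] by auto
  ultimately show thesis
    using that finite_subset S(1) by blast
qed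

text \<open>\<open>dual_rho\<close> and \<open>dual_cs\<close> use \<open>Blinfun\<close>, which has
  its intended value on bounded maps only; this supplies the boundedness of \<open>rho x\<close>, of
  \<open>I\<close> and of the coordinate functionals.\<close>

lemma fin_dim_bounded_linear:
  fixes f :: "'e::real_normed_vector \<Rightarrow> 'f::real_normed_vector"
  assumes "fin_dim (UNIV :: 'e set)" "linear f"
  shows "bounded_linear f"
proof -
  obtain B :: "'e set" where B: "finite B" "independent B" "span B = UNIV"
    using fin_dim_basis[OF assms(1)] .
  obtain c where c: "\<And>a. (\<Sum>b\<in>B. \<bar>a b\<bar>) \<le> c * norm (\<Sum>b\<in>B. a b *\<^sub>R b)"
    using coefficients_bounded[OF B(1,2)] by blast
  define C where "C = (\<Sum>b\<in>B. norm (f b))"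
  show ?thesis
  proof (rule bounded_linear_intro)
    show "norm (f x) \<le> norm x * (c * C)" for x
    proof -
      let ?r = "representation B x"
      have x: "x = (\<Sum>b\<in>B. ?r b *\<^sub>R b)"
        using sum_representation_eq[OF B(2) _ B(1), of x] B(3) by simp
      have "f x = (\<Sum>b\<in>B. ?r b *\<^sub>R f b)"
        by (subst x) (simp add: linear_sum[OF assms(2)] linear_scale[OF assms(2)])
      then have "norm (f x) \<le> (\<Sum>b\<in>B. \<bar>?r b\<bar> * norm (f b))"
        by (auto intro!: order_trans[OF norm_sum] sum_mono)
      also have "\<dots> \<le> (\<Sum>b\<in>B. \<bar>?r b\<bar> * C)"
        unfolding C_def by (intro sum_mono mult_left_mono member_le_sum B(1)) auto
      also have "\<dots> = (\<Sum>b\<in>B. \<bar>?r b\<bar>) * C"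
        by (simp add: sum_distrib_right)
      also have "\<dots> \<le> (c * norm x) * C"
        using c[of ?r] x by (intro mult_right_mono) (auto simp: C_def sum_nonneg)
      finally show ?thesis by (simp add: algebra_simps)
    qed
  qed (simp_all add: linear_add[OF assms(2)] linear_scale[OF assms(2)])
qed

text \<open>Applying J + k to (J - k) v gives -(1 + k^2) v, and 1 + k^2 is never zero. Hence J v is
  not in the span of \<open>v\<close> and a J-stable subspace missing \<open>v\<close>.\<close>

lemma complex_span_step:
  assumes J: "linear J" "\<And>y. J (J y) = - y" and W: "subspace W" "\<And>w. w \<in> W \<Longrightarrow> J w \<in> W"
    and v: "v \<notin> W"
  shows "J v - k *\<^sub>R v \<notin> W"
proof
  assume w: "J v - k *\<^sub>R v \<in> W"
  have "k *\<^sub>R (J v - k *\<^sub>R v) + J (J v - k *\<^sub>R v) \<in> W"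
    by (intro subspace_add subspace_scale W w)
  also have "k *\<^sub>R (J v - k *\<^sub>R v) + J (J v - k *\<^sub>R v) = (- (1 + k\<^sup>2)) *\<^sub>R v"
    by (simp add: linear_diff[OF J(1)] linear_scale[OF J(1)] J(2) algebra_simps power2_eq_square)
  finally have "inverse (- (1 + k\<^sup>2)) *\<^sub>R (- (1 + k\<^sup>2)) *\<^sub>R v \<in> W"
    by (rule subspace_scale[OF W(1)])
  moreover have "1 + k\<^sup>2 \<noteq> 0"
    using zero_le_power2[of k] by linarith
  ultimately show False
    using v by (simp add: add_eq_0_iff)
qed

text \<open>Take \<open>S\<close> of greatest cardinality such that \<open>S\<close> and its image
  under \<open>J\<close> are disjoint and jointly independent. Their span is J-stable, so a vector
  outside it could be added to \<open>S\<close>.\<close>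

lemma exists_complex_spanning_set:
  fixes J :: "'g::real_vector \<Rightarrow> 'g"
  assumes fd: "fin_dim (UNIV :: 'g set)" and J: "linear J" "\<And>y. J (J y) = - y"
  obtains S where "finite S" "S \<inter> J ` S = {}" "independent (S \<union> J ` S)" "span (S \<union> J ` S) = UNIV"
proof -
  obtain B :: "'g set" where B: "finite B" "independent B" "span B = UNIV"
    using fin_dim_basis[OF fd] .
  define Q where "Q S \<longleftrightarrow> S \<inter> J ` S = {} \<and> independent (S \<union> J ` S)" for S
  have bound: "finite S \<and> card S \<le> card B" if "Q S" for S
  proof -
    have "finite (S \<union> J ` S) \<and> card (S \<union> J ` S) \<le> card B"
      by (rule independent_span_bound) (use that B in \<open>auto simp: Q_def\<close>)
    then show ?thesis
      by (meson card_mono finite_Un order_trans sup_ge1)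
  qed
  have "Q {}" by (simp add: Q_def independent_empty)
  moreover have "\<forall>T. Q T \<longrightarrow> card T < Suc (card B)"
    using bound by (simp add: less_Suc_eq_le)
  ultimately have "\<exists>S. Q S \<and> (\<forall>T. Q T \<longrightarrow> card T \<le> card S)"
    by (rule ex_has_greatest_nat)
  then obtain S where S: "Q S" "\<And>T. Q T \<Longrightarrow> card T \<le> card S"
    by auto
  let ?W = "span (S \<union> J ` S)"
  have JW: "J w \<in> ?W" if "w \<in> ?W" for w
    using that
  proof (induction rule: span_induct_alt)
    case base
    then show ?case by (simp add: linear_0[OF J(1)] span_zero)
  next
    case (step c x y)
    have "J x \<in> ?W"
    proof (cases "x \<in> S")
      case False
      then obtain s where "s \<in> S" "x = J s" using step by blast
      then show ?thesis by (auto simp: J(2) intro: span_neg span_base)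
    qed (auto intro: span_base)
    then show ?case
      using step by (simp add: linear_add[OF J(1)] linear_scale[OF J(1)] span_add span_scale)
  qed
  have "?W = UNIV"
  proof (rule ccontr)
    assume "?W \<noteq> UNIV"
    then obtain v where v: "v \<notin> ?W" by blast
    have Jv: "J v \<notin> span (insert v (S \<union> J ` S))"
      using complex_span_step[OF J subspace_span JW v] unfolding span_breakdown_eq by blast
    have Jv': "J v \<notin> insert v (S \<union> J ` S)"
      using Jv span_superset[of "insert v (S \<union> J ` S)"] by auto
    have v': "v \<notin> S \<union> J ` S"
      using v span_superset[of "S \<union> J ` S"] by auto
    have "independent (insert (J v) (insert v (S \<union> J ` S)))"
      by (intro independent_insertI Jv v) (use S(1) in \<open>simp add: Q_def\<close>)
    then have "Q (insert v S)"
      using S(1) Jv' v' unfolding Q_def by (auto simp: insert_commute)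
    then have "card (insert v S) \<le> card S"
      by (rule S(2))
    then show False
      using v' bound[OF S(1)] by simp
  qed
  then show thesis
    using that[of S] S(1) bound by (auto simp: Q_def)
qed

lemma exists_complex_basis:
  fixes J :: "'g::real_vector \<Rightarrow> 'g"
  assumes fd: "fin_dim (UNIV :: 'g set)" and dim: "dim (UNIV :: 'g set) = 2 * n"
    and J: "linear J" "\<And>y. J (J y) = - y"
  obtains e \<zeta> where "complex_basis J e \<zeta> n"
proof -
  obtain S where S: "finite S" "S \<inter> J ` S = {}" "independent (S \<union> J ` S)" "span (S \<union> J ` S) = UNIV"
    using exists_complex_spanning_set[OF fd J] .
  let ?T = "S \<union> J ` S"
  have inj: "inj J"
    by (rule injI) (metis J(2) minus_equation_iff)
  have "dim (UNIV :: 'g set) = card ?T"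
    using dim_eq_card[of ?T UNIV] S by simp
  also have "\<dots> = 2 * card S"
    using S by (simp add: card_Un_disjoint card_image inj_on_subset[OF inj])
  finally have card: "card S = n"
    using dim by simp
  obtain e where e: "bij_betw e {..<n} S"
    using ex_bij_betw_nat_finite[OF S(1)] card by (auto simp: atLeast0LessThan)
  have eS: "e i \<in> S" if "i < n" for i
    using e that by (auto simp: bij_betw_def)
  have e_eq: "e i = e j \<longleftrightarrow> i = j" if "i < n" "j < n" for i j
    using e that by (auto simp: bij_betw_def inj_on_def)
  have Je: "e i \<noteq> J (e j)" if "i < n" "j < n" for i j
    using eS[OF that(1)] eS[OF that(2)] S(2) by blast
  let ?r = "representation ?T"
  \<comment> \<open>The real coordinates along \<open>e i\<close> and \<open>J (e i)\<close> become
    real and imaginary part. The value 0 beyond \<open>n\<close> makes linearity and compatibility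
    with \<open>J\<close> hold for every index.\<close>
  define \<zeta> where "\<zeta> i y = (if i < n then Complex (?r y (e i)) (?r y (J (e i))) else 0)" for i y
  have in_span: "y \<in> span ?T" for y using S(4) by simp
  have lin: "linear (\<zeta> i)" for i
    unfolding \<zeta>_def linear_iff
    by (auto simp: complex_eq_iff representation_add[OF S(3) in_span in_span] representation_scale[OF S(3) in_span])
  have \<zeta>_e: "\<zeta> i (e k) = (if i = k then 1 else 0)" if "i < n" "k < n" for i k
    using that eS[OF that(2)] Je[OF that(2) that(1)]
    by (auto simp: \<zeta>_def representation_basis[OF S(3)] complex_eq_iff e_eq)
  have \<zeta>_Je: "\<zeta> i (J (e k)) = (if i = k then \<i> else 0)" if "i < n" "k < n" for i k
    using that eS[OF that(2)] Je[OF that]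
    by (auto simp: \<zeta>_def representation_basis[OF S(3)] complex_eq_iff e_eq inj_eq[OF inj])
  have expansion: "y = (\<Sum>i<n. Re (\<zeta> i y) *\<^sub>R e i + Im (\<zeta> i y) *\<^sub>R J (e i))" for y
  proof -
    have "y = (\<Sum>b\<in>?T. ?r y b *\<^sub>R b)"
      using sum_representation_eq[OF S(3) in_span _ order_refl, of y] S(1) by simp
    also have "\<dots> = (\<Sum>b\<in>S. ?r y b *\<^sub>R b) + (\<Sum>b\<in>J ` S. ?r y b *\<^sub>R b)"
      using S by (intro sum.union_disjoint) auto
    also have "(\<Sum>b\<in>J ` S. ?r y b *\<^sub>R b) = (\<Sum>b\<in>S. ?r y (J b) *\<^sub>R J b)"
      by (simp add: sum.reindex inj_on_subset[OF inj])
    also have "(\<Sum>b\<in>S. ?r y b *\<^sub>R b) = (\<Sum>i<n. ?r y (e i) *\<^sub>R e i)"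
      by (rule sum.reindex_bij_betw[OF e, symmetric])
    also have "(\<Sum>b\<in>S. ?r y (J b) *\<^sub>R J b) = (\<Sum>i<n. ?r y (J (e i)) *\<^sub>R J (e i))"
      by (rule sum.reindex_bij_betw[OF e, symmetric])
    finally show ?thesis
      by (simp add: \<zeta>_def sum.distrib)
  qed
  have "complex_basis J e \<zeta> n"
  proof (rule complex_basis.intro)
    show "\<zeta> i (J y) = \<i> * \<zeta> i y" for i y
    proof (cases "i < n")
      case True
      have "J y = (\<Sum>k<n. Re (\<zeta> k y) *\<^sub>R J (e k) + Im (\<zeta> k y) *\<^sub>R (- e k))"
        by (subst expansion[of y]) (simp add: linear_sum[OF J(1)] linear_add[OF J(1)] linear_scale[OF J(1)] J(2))
      then have "\<zeta> i (J y) = (\<Sum>k<n. Re (\<zeta> k y) *\<^sub>R \<zeta> i (J (e k)) + Im (\<zeta> k y) *\<^sub>R - \<zeta> i (e k))"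
        by (simp only: linear_sum[OF lin] linear_add[OF lin] linear_scale[OF lin] linear_neg[OF lin])
      also have "\<dots> = (\<Sum>k<n. if i = k then \<i> * \<zeta> i y else 0)"
        using True by (intro sum.cong) (auto simp: \<zeta>_e \<zeta>_Je complex_eq_iff)
      also have "\<dots> = \<i> * \<zeta> i y"
        using True by simp
      finally show ?thesis .
    qed (simp add: \<zeta>_def)
  qed (fact J lin expansion \<zeta>_e)+
  then show thesis by (rule that)
qed

section \<open>Duality for the Chevalley--Eilenberg complexes\<close>

text \<open>The duality argument in abstract form. \<open>top_closed\<close> is the guise in which
  unimodularity enters, \<open>ev\<close> identifies the top coefficients with complex numbers, with
  -i because \<open>L\<close> is the structure for g^{0,1} slots, and \<open>U\<close>,
  \<open>U'\<close> separate the coefficients.\<close>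

locale ce_duality = complex_basis J e \<zeta> n + pairing M M' N J K K' L P
  for J :: "'g::real_vector \<Rightarrow> 'g" and e \<zeta> n
    and M :: "'m::real_vector set" and M' :: "'w::real_vector set" and N :: "'u::real_vector set"
    and K K' L P +
  fixes br :: "'g \<Rightarrow> 'g \<Rightarrow> 'g" and act1 act2 act3 and ev :: "'u \<Rightarrow> complex" and U :: "'m set" and U' :: "'w set"
  assumes coeffs: "complex_coeffs M K" "complex_coeffs M' K'" "complex_coeffs N L"
    and ce: "ce_structure M J K br act1" "ce_structure M' J K' br act2" "ce_structure N J L br act3"
    and act: "\<And>y m w. m \<in> M \<Longrightarrow> w \<in> M' \<Longrightarrow> act3 y (P m w) = P (act1 y m) w + P m (act2 y w)"
    and top_closed: "\<And>q \<phi>. Suc q = n \<Longrightarrow> \<phi> \<in> cochains N J L q \<Longrightarrow> cd br act3 q \<phi> = 0"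
    and ev: "linear ev" "\<And>m. m \<in> N \<Longrightarrow> ev (L m) = - \<i> * ev m" "\<And>m. m \<in> N \<Longrightarrow> ev m = 0 \<Longrightarrow> m = 0"
    and U: "finite U" "U \<subseteq> M" "\<And>w. w \<in> M' \<Longrightarrow> (\<And>u. u \<in> U \<Longrightarrow> P u w = 0) \<Longrightarrow> w = 0"
    and U': "finite U'" "U' \<subseteq> M'" "\<And>m. m \<in> M \<Longrightarrow> (\<And>u. u \<in> U' \<Longrightarrow> P m u = 0) \<Longrightarrow> m = 0"
begin

interpretation E1: ce_structure M J K br act1 by (rule ce(1))
interpretation E2: ce_structure M' J K' br act2 by (rule ce(2))
interpretation E3: ce_structure N J L br act3 by (rule ce(3))

text \<open>The Leibniz rule for a product of degree n - 1, whose differential vanishes by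
  \<open>top_closed\<close>.\<close>

lemma wed_adjoint:
  assumes "Suc (a + b) = n" "\<gamma> \<in> E1.C a" "\<beta> \<in> E2.C b"
  shows "wed P (Suc a) b (E1.d a \<gamma>) \<beta> = - ((-1) ^ a *\<^sub>R wed P a (Suc b) \<gamma> (E2.d b \<beta>))"
  using leibniz[OF ce act assms(2,3)] top_closed[OF assms(1) wed_cochains[OF assms(2,3)]]
  by (simp add: eq_neg_iff_add_eq_0)

lemma K_cochain: "\<phi> \<in> E1.C a \<Longrightarrow> (\<lambda>ys. K (\<phi> ys)) \<in> E1.C a"
  and K'_cochain: "\<psi> \<in> E2.C b \<Longrightarrow> (\<lambda>ys. K' (\<psi> ys)) \<in> E2.C b"
  by (rule cochains_comp, assumption, rule linears, rule E1.K_in E2.K_in, assumption, rule refl)+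

text \<open>The real part of the pairing, so that linear algebra over the reals applies. The
  imaginary part is recovered by applying \<open>K\<close> or \<open>K'\<close> to one
  argument.\<close>

definition re_pair :: "nat \<Rightarrow> nat \<Rightarrow> ((nat \<Rightarrow> 'g) \<Rightarrow> 'm) \<Rightarrow> ((nat \<Rightarrow> 'g) \<Rightarrow> 'w) \<Rightarrow> real"
  where "re_pair a b \<phi> \<psi> = Re (ev (wed P a b \<phi> \<psi> e))"

lemma linear_re_pair: "linear (re_pair a b \<phi>)" "linear (\<lambda>\<phi>. re_pair a b \<phi> \<psi>)"
proof -
  have Re_ev: "linear (\<lambda>f. Re (ev (f e)))"
    using ev(1) by (simp add: linear_iff)
  show "linear (re_pair a b \<phi>)" "linear (\<lambda>\<phi>. re_pair a b \<phi> \<psi>)"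
    unfolding re_pair_def[abs_def]
    by (rule linear_of_comp[OF Re_ev wed_right], rule linear_of_comp[OF Re_ev wed_left])
qed

lemma wed_eq_0_iff_ev:
  assumes "a + b = n" "\<phi> \<in> E1.C a" "\<psi> \<in> E2.C b" "ev (wed P a b \<phi> \<psi> e) = 0"
  shows "wed P a b \<phi> \<psi> = 0"
proof -
  have w: "wed P a b \<phi> \<psi> \<in> cochains N J L n"
    using wed_cochains[OF assms(2,3)] assms(1) by simp
  have "wed P a b \<phi> \<psi> e = 0"
    by (rule ev(3)[OF cochains_in[OF w] assms(4)])
  then show ?thesis
    by (intro top_eq_0[OF w linears(3)]) simp
qed

text \<open>Applying \<open>K\<close> multiplies the value by -i, and the real part of -i z is the
  imaginary part of z.\<close>

lemma wed_eq_0_if_re_left: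
  assumes "a + b = n" "\<phi> \<in> E1.C a" "\<psi> \<in> E2.C b"
    and "re_pair a b \<phi> \<psi> = 0" "re_pair a b (\<lambda>ys. K (\<phi> ys)) \<psi> = 0"
  shows "wed P a b \<phi> \<psi> = 0"
proof (rule wed_eq_0_iff_ev[OF assms(1-3)])
  show "ev (wed P a b \<phi> \<psi> e) = 0"
    using assms(4,5) cochains_in[OF wed_cochains[OF assms(2,3)], of e]
    by (simp add: re_pair_def wed_K ev(2) complex_eq_iff)
qed

lemma wed_eq_0_if_re_right:
  assumes "a + b = n" "\<phi> \<in> E1.C a" "\<psi> \<in> E2.C b"
    and "re_pair a b \<phi> \<psi> = 0" "re_pair a b \<phi> (\<lambda>ys. K' (\<psi> ys)) = 0"
  shows "wed P a b \<phi> \<psi> = 0"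
proof (rule wed_eq_0_iff_ev[OF assms(1-3)])
  show "ev (wed P a b \<phi> \<psi> e) = 0"
    using assms(4,5) cochains_in[OF wed_cochains[OF assms(2,3)], of e]
    by (simp add: re_pair_def wed_K ev(2) complex_eq_iff)
qed

lemma re_separating_left:
  assumes "a + b = n"
  obtains \<Gamma> where "finite \<Gamma>" "\<Gamma> \<subseteq> E1.C a"
    "\<And>\<psi>. \<psi> \<in> E2.C b \<Longrightarrow> (\<And>\<gamma>. \<gamma> \<in> \<Gamma> \<Longrightarrow> re_pair a b \<gamma> \<psi> = 0) \<Longrightarrow> \<psi> = 0"
proof -
  have "\<exists>\<Gamma>. finite \<Gamma> \<and> \<Gamma> \<subseteq> E1.C a \<and> (\<forall>b. a + b \<le> n \<longrightarrow>
      (\<forall>\<psi>\<in>E2.C b. (\<forall>\<gamma>\<in>\<Gamma>. wed P a b \<gamma> \<psi> = 0) \<longrightarrow> \<psi> = 0))"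
    by (rule wed_separating_left[OF pairing_axioms coeffs U(1,2)]) (rule U(3))
  then obtain \<Gamma> where \<Gamma>: "finite \<Gamma>" "\<Gamma> \<subseteq> E1.C a" and sep: "\<forall>b. a + b \<le> n \<longrightarrow>
      (\<forall>\<psi>\<in>E2.C b. (\<forall>\<gamma>\<in>\<Gamma>. wed P a b \<gamma> \<psi> = 0) \<longrightarrow> \<psi> = 0)"
    by (elim exE conjE)
  \<comment> \<open>Adjoining the images under \<open>K\<close> makes the real pairing as separating
    as the complex one.\<close>
  let ?G = "\<Gamma> \<union> (\<lambda>\<gamma> ys. K (\<gamma> ys)) ` \<Gamma>"
  show thesis
  proof (rule that)
    show "finite ?G" using \<Gamma> by simp
    show "?G \<subseteq> E1.C a" using \<Gamma>(2) K_cochain by auto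
    fix \<psi> assume \<psi>: "\<psi> \<in> E2.C b" and 0: "\<And>\<gamma>. \<gamma> \<in> ?G \<Longrightarrow> re_pair a b \<gamma> \<psi> = 0"
    have "wed P a b \<gamma> \<psi> = 0" if "\<gamma> \<in> \<Gamma>" for \<gamma>
      by (rule wed_eq_0_if_re_left[OF assms _ \<psi>]) (use that \<Gamma>(2) in \<open>auto intro: 0\<close>)
    then show "\<psi> = 0"
      using sep[rule_format, OF _ \<psi>] assms by simp
  qed
qed

lemma re_separating_right:
  assumes "a + b = n"
  obtains \<Gamma> where "finite \<Gamma>" "\<Gamma> \<subseteq> E2.C b"
    "\<And>\<phi>. \<phi> \<in> E1.C a \<Longrightarrow> (\<And>\<gamma>. \<gamma> \<in> \<Gamma> \<Longrightarrow> re_pair a b \<phi> \<gamma> = 0) \<Longrightarrow> \<phi> = 0"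
proof -
  have "\<exists>\<Gamma>. finite \<Gamma> \<and> \<Gamma> \<subseteq> E2.C b \<and> (\<forall>a. a + b \<le> n \<longrightarrow>
      (\<forall>\<phi>\<in>E1.C a. (\<forall>\<gamma>\<in>\<Gamma>. wed P a b \<phi> \<gamma> = 0) \<longrightarrow> \<phi> = 0))"
    by (rule wed_separating_right[OF pairing_axioms coeffs U'(1,2)]) (rule U'(3))
  then obtain \<Gamma> where \<Gamma>: "finite \<Gamma>" "\<Gamma> \<subseteq> E2.C b" and sep: "\<forall>a. a + b \<le> n \<longrightarrow>
      (\<forall>\<phi>\<in>E1.C a. (\<forall>\<gamma>\<in>\<Gamma>. wed P a b \<phi> \<gamma> = 0) \<longrightarrow> \<phi> = 0)"
    by (elim exE conjE)
  let ?G = "\<Gamma> \<union> (\<lambda>\<gamma> ys. K' (\<gamma> ys)) ` \<Gamma>"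
  show thesis
  proof (rule that)
    show "finite ?G" using \<Gamma> by simp
    show "?G \<subseteq> E2.C b" using \<Gamma>(2) K'_cochain by auto
    fix \<phi> assume \<phi>: "\<phi> \<in> E1.C a" and 0: "\<And>\<gamma>. \<gamma> \<in> ?G \<Longrightarrow> re_pair a b \<phi> \<gamma> = 0"
    have "wed P a b \<phi> \<gamma> = 0" if "\<gamma> \<in> \<Gamma>" for \<gamma>
      by (rule wed_eq_0_if_re_right[OF assms \<phi>]) (use that \<Gamma>(2) in \<open>auto intro: 0\<close>)
    then show "\<phi> = 0"
      using sep[rule_format, OF _ \<phi>] assms by simp
  qed
qed

lemma nondegenerate_left:
  assumes "a + b = n" "\<phi> \<in> E1.C a" "\<And>\<beta>. \<beta> \<in> E2.C b \<Longrightarrow> re_pair a b \<phi> \<beta> = 0"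
  shows "\<phi> = 0"
proof -
  obtain \<Gamma> where "\<Gamma> \<subseteq> E2.C b"
    "\<And>\<phi>. \<phi> \<in> E1.C a \<Longrightarrow> (\<And>\<gamma>. \<gamma> \<in> \<Gamma> \<Longrightarrow> re_pair a b \<phi> \<gamma> = 0) \<Longrightarrow> \<phi> = 0"
    using re_separating_right[OF assms(1)] by metis
  then show ?thesis using assms(2,3) by blast
qed

lemma nondegenerate_right:
  assumes "a + b = n" "\<psi> \<in> E2.C b" "\<And>\<alpha>. \<alpha> \<in> E1.C a \<Longrightarrow> re_pair a b \<alpha> \<psi> = 0"
  shows "\<psi> = 0"
proof -
  obtain \<Gamma> where "\<Gamma> \<subseteq> E1.C a"
    "\<And>\<psi>. \<psi> \<in> E2.C b \<Longrightarrow> (\<And>\<gamma>. \<gamma> \<in> \<Gamma> \<Longrightarrow> re_pair a b \<gamma> \<psi> = 0) \<Longrightarrow> \<psi> = 0"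
    using re_separating_left[OF assms(1)] by metis
  then show ?thesis using assms(2,3) by blast
qed

lemma re_pair_if_wed: "wed P a b \<phi> \<psi> = 0 \<Longrightarrow> re_pair a b \<phi> \<psi> = 0"
  by (simp add: re_pair_def linear_0[OF ev(1)])

text \<open>In degree 0 the partner has degree \<open>n\<close>, so it is closed for degree reasons
  and nondegeneracy on cochains suffices. In higher degrees the kernel of one differential is
  annihilated exactly by the image of its adjoint.\<close>

theorem exact_if_orthogonal_left:
  assumes n: "a + b = n" and \<alpha>: "\<alpha> \<in> E1.C a"
    and orth: "\<And>\<beta>. \<beta> \<in> E2.C b \<Longrightarrow> E2.d b \<beta> = 0 \<Longrightarrow> wed P a b \<alpha> \<beta> = 0"
  shows "if a = 0 then \<alpha> = 0 else \<exists>\<gamma>\<in>E1.C (a - 1). \<alpha> = E1.d (a - 1) \<gamma>"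
proof (cases a)
  case 0
  have "\<alpha> = 0"
  proof (rule nondegenerate_left[OF n \<alpha>])
    fix \<beta> assume \<beta>: "\<beta> \<in> E2.C b"
    have "E2.d b \<beta> = 0"
      by (rule top_eq_0[OF E2.d_in[OF \<beta>] linears(2)]) (use n 0 in simp)
    then show "re_pair a b \<alpha> \<beta> = 0"
      by (intro re_pair_if_wed orth \<beta>)
  qed
  then show ?thesis using 0 by simp
next
  case (Suc a')
  have n': "a' + Suc b = n" using n Suc by simp
  obtain \<Gamma> where \<Gamma>: "finite \<Gamma>" "\<Gamma> \<subseteq> E1.C a'"
    "\<And>\<psi>. \<psi> \<in> E2.C (Suc b) \<Longrightarrow> (\<And>\<gamma>. \<gamma> \<in> \<Gamma> \<Longrightarrow> re_pair a' (Suc b) \<gamma> \<psi> = 0) \<Longrightarrow> \<psi> = 0"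
    using re_separating_left[OF n'] by metis
  have "\<exists>\<gamma>\<in>E1.C a'. \<alpha> = E1.d a' \<gamma>"
  proof (rule annihilator_kernel_in_image[where P = "re_pair a b" and P' = "re_pair a' (Suc b)"
        and \<delta> = "E2.d b" and s = "- ((-1) ^ a')" and \<Gamma> = \<Gamma>])
    show "E1.d a' \<gamma> \<in> E1.C a" if "\<gamma> \<in> E1.C a'" for \<gamma>
      using E1.d_in[OF that] Suc by simp
    show "re_pair a b (E1.d a' \<gamma>) \<beta> = - ((-1) ^ a') * re_pair a' (Suc b) \<gamma> (E2.d b \<beta>)"
      if "\<gamma> \<in> E1.C a'" "\<beta> \<in> E2.C b" for \<gamma> \<beta>
      using wed_adjoint[OF _ that] n Suc
      by (simp add: re_pair_def linear_neg[OF ev(1)] linear_scale[OF ev(1)])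
    show "E2.d b \<beta> = 0" if "\<beta> \<in> E2.C b" "\<And>\<gamma>. \<gamma> \<in> \<Gamma> \<Longrightarrow> re_pair a' (Suc b) \<gamma> (E2.d b \<beta>) = 0" for \<beta>
      by (rule \<Gamma>(3)[OF E2.d_in[OF that(1)] that(2)])
    show "\<phi> = 0" if "\<phi> \<in> E1.C a" "\<And>\<beta>. \<beta> \<in> E2.C b \<Longrightarrow> re_pair a b \<phi> \<beta> = 0" for \<phi>
      by (rule nondegenerate_left[OF n that])
    show "re_pair a b \<alpha> \<beta> = 0" if "\<beta> \<in> E2.C b" "E2.d b \<beta> = 0" for \<beta>
      by (rule re_pair_if_wed[OF orth[OF that]])
  qed (simp_all add: E1.subspace_C E2.subspace_C E1.linear_d E2.linear_d linear_re_pair \<Gamma>(1,2) \<alpha>)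
  then show ?thesis using Suc by simp
qed

theorem exact_if_orthogonal_right:
  assumes n: "a + b = n" and \<beta>: "\<beta> \<in> E2.C b"
    and orth: "\<And>\<alpha>. \<alpha> \<in> E1.C a \<Longrightarrow> E1.d a \<alpha> = 0 \<Longrightarrow> wed P a b \<alpha> \<beta> = 0"
  shows "if b = 0 then \<beta> = 0 else \<exists>\<gamma>\<in>E2.C (b - 1). \<beta> = E2.d (b - 1) \<gamma>"
proof (cases b)
  case 0
  have "\<beta> = 0"
  proof (rule nondegenerate_right[OF n \<beta>])
    fix \<alpha> assume \<alpha>: "\<alpha> \<in> E1.C a"
    have "E1.d a \<alpha> = 0"
      by (rule top_eq_0[OF E1.d_in[OF \<alpha>] linears(1)]) (use n 0 in simp)
    then show "re_pair a b \<alpha> \<beta> = 0"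
      by (intro re_pair_if_wed orth \<alpha>)
  qed
  then show ?thesis using 0 by simp
next
  case (Suc b')
  have n': "Suc a + b' = n" using n Suc by simp
  obtain \<Gamma> where \<Gamma>: "finite \<Gamma>" "\<Gamma> \<subseteq> E2.C b'"
    "\<And>\<phi>. \<phi> \<in> E1.C (Suc a) \<Longrightarrow> (\<And>\<gamma>. \<gamma> \<in> \<Gamma> \<Longrightarrow> re_pair (Suc a) b' \<phi> \<gamma> = 0) \<Longrightarrow> \<phi> = 0"
    using re_separating_right[OF n'] by metis
  have "\<exists>\<gamma>\<in>E2.C b'. \<beta> = E2.d b' \<gamma>"
  \<comment> \<open>The same lemma with the two complexes exchanged. The adjointness factor can be
    moved to the other side because it is its own inverse.\<close>
  proof (rule annihilator_kernel_in_image[where P = "\<lambda>\<psi> \<phi>. re_pair a b \<phi> \<psi>"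
        and P' = "\<lambda>\<psi> \<phi>. re_pair (Suc a) b' \<phi> \<psi>" and \<delta> = "E1.d a" and s = "- ((-1) ^ a)" and \<Gamma> = \<Gamma>])
    show "E2.d b' \<gamma> \<in> E2.C b" if "\<gamma> \<in> E2.C b'" for \<gamma>
      using E2.d_in[OF that] Suc by simp
    show "re_pair a b \<alpha> (E2.d b' \<gamma>) = - ((-1) ^ a) * re_pair (Suc a) b' (E1.d a \<alpha>) \<gamma>"
      if "\<gamma> \<in> E2.C b'" "\<alpha> \<in> E1.C a" for \<gamma> \<alpha>
    proof -
      have "re_pair (Suc a) b' (E1.d a \<alpha>) \<gamma> = - ((-1) ^ a * re_pair a b \<alpha> (E2.d b' \<gamma>))"
        using wed_adjoint[OF _ that(2,1)] n Suc
        by (simp add: re_pair_def linear_neg[OF ev(1)] linear_scale[OF ev(1)])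
      moreover have "(-1) ^ a * ((-1) ^ a * x) = x" for x :: real
        by (simp flip: mult.assoc power_mult_distrib)
      ultimately show ?thesis by simp
    qed
    show "E1.d a \<alpha> = 0" if "\<alpha> \<in> E1.C a" "\<And>\<gamma>. \<gamma> \<in> \<Gamma> \<Longrightarrow> re_pair (Suc a) b' (E1.d a \<alpha>) \<gamma> = 0" for \<alpha>
      by (rule \<Gamma>(3)[OF E1.d_in[OF that(1)] that(2)])
    show "\<psi> = 0" if "\<psi> \<in> E2.C b" "\<And>\<alpha>. \<alpha> \<in> E1.C a \<Longrightarrow> re_pair a b \<alpha> \<psi> = 0" for \<psi>
      by (rule nondegenerate_right[OF n that])
    show "re_pair a b \<alpha> \<beta> = 0" if "\<alpha> \<in> E1.C a" "E1.d a \<alpha> = 0" for \<alpha>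
      by (rule re_pair_if_wed[OF orth[OF that]])
  qed (simp_all add: E1.subspace_C E2.subspace_C E1.linear_d E2.linear_d linear_re_pair \<Gamma>(1,2) \<beta>)
  then show ?thesis using Suc by simp
qed

lemma wed_exact_left:
  assumes "Suc a + b = n" "\<gamma> \<in> E1.C a" "\<beta> \<in> E2.C b" "E2.d b \<beta> = 0"
  shows "wed P (Suc a) b (E1.d a \<gamma>) \<beta> = 0"
  using wed_adjoint[OF _ assms(2,3)] assms(1,4) by (simp add: linear_0[OF wed_right])

lemma wed_exact_right:
  assumes "a + Suc b = n" "\<alpha> \<in> E1.C a" "\<gamma> \<in> E2.C b" "E1.d a \<alpha> = 0"
  shows "wed P a (Suc b) \<alpha> (E2.d b \<gamma>) = 0"
  using wed_adjoint[OF _ assms(2,3)] assms(1,4) by (simp add: linear_0[OF wed_left])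

end

section \<open>The Dolbeault complex of a module\<close>

text \<open>The arguments \<open>ys\<close> come from g^{0,1}, modelled on (g,-J), so complex
  linearity in them reads with -I in place of I.\<close>

definition opp :: "('v::real_vector \<Rightarrow> 'v) \<Rightarrow> ('p \<Rightarrow> 'v) \<Rightarrow> 'p \<Rightarrow> 'v"
  where "opp Iv m = (\<lambda>xs. - Iv (m xs))"

lemma dcochain_iff:
  "dcochain J Iv p q \<phi> \<longleftrightarrow> \<phi> \<in> cochains (cochains UNIV J Iv p) J (opp Iv) q"
proof
  assume d: "dcochain J Iv p q \<phi>"
  note d' = d[unfolded dcochain_def]
  note loc = d'[THEN conjunct1, rule_format]
  note lin_ys = d'[THEN conjunct2, THEN conjunct1, rule_format]
  note lin_xs = d'[THEN conjunct2, THEN conjunct2, THEN conjunct1, rule_format]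
  note d'' = d'[THEN conjunct2, THEN conjunct2, THEN conjunct2]
  note alt_ys = d''[THEN conjunct1, rule_format]
  note alt_xs = d''[THEN conjunct2, THEN conjunct1, rule_format]
  note J_ys = d''[THEN conjunct2, THEN conjunct2, THEN conjunct1, rule_format]
  note J_xs = d''[THEN conjunct2, THEN conjunct2, THEN conjunct2, rule_format]
  show "\<phi> \<in> cochains (cochains UNIV J Iv p) J (opp Iv) q"
  proof (rule cochainsI)
    show "\<phi> ys \<in> cochains UNIV J Iv p" for ys
    proof (rule cochainsI)
      show "\<phi> ys xs = \<phi> ys xs'" if "\<And>i. i < p \<Longrightarrow> xs i = xs' i" for xs xs'
        by (rule loc) (use that in auto)
      show "\<phi> ys xs = 0" if "i < p" "j < p" "i \<noteq> j" "xs i = xs j" for xs i j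
        by (rule alt_xs[OF that])
    qed (simp_all add: lin_xs J_xs)
    show "\<phi> ys = \<phi> ys'" if "\<And>i. i < q \<Longrightarrow> ys i = ys' i" for ys ys'
      by (rule ext, rule loc) (use that in auto)
    show "linear (\<lambda>y. \<phi> (ys(i := y)))" if "i < q" for ys i
      unfolding linear_fun_iff using lin_ys[OF that] by simp
    show "\<phi> ys = 0" if "i < q" "j < q" "i \<noteq> j" "ys i = ys j" for ys i j
      unfolding fun_eq_iff zero_fun_apply using alt_ys[OF that] by simp
    show "\<phi> (ys(i := J (ys i))) = opp Iv (\<phi> ys)" if "i < q" for ys i
      unfolding fun_eq_iff opp_def using J_ys[OF that] by simp
  qed
next
  assume \<phi>: "\<phi> \<in> cochains (cochains UNIV J Iv p) J (opp Iv) q"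
  note \<phi>' = cochains_in[OF \<phi>]
  show "dcochain J Iv p q \<phi>"
    unfolding dcochain_def
  proof (intro conjI allI impI)
    show "\<phi> ys xs = \<phi> ys' xs'" if "\<forall>i<q. ys i = ys' i" "\<forall>j<p. xs j = xs' j" for ys ys' xs xs'
      using cochains_local[OF \<phi>, of ys ys'] cochains_local[OF \<phi>', of xs xs' ys'] that by simp
    show "linear (\<lambda>y. \<phi> (ys(i := y)) xs)" if "i < q" for ys xs i
      using cochains_linear[OF \<phi> that] unfolding linear_fun_iff by blast
    show "linear (\<lambda>x. \<phi> ys (xs(j := x)))" if "j < p" for ys xs j
      by (rule cochains_linear[OF \<phi>' that])
    show "\<phi> ys xs = 0" if "i < q" "i' < q" "i \<noteq> i'" "ys i = ys i'" for ys xs i i'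
      using cochains_alt[OF \<phi> that] by simp
    show "\<phi> ys xs = 0" if "j < p" "j' < p" "j \<noteq> j'" "xs j = xs j'" for ys xs j j'
      by (rule cochains_alt[OF \<phi>' that])
    show "\<phi> (ys(i := J (ys i))) xs = - Iv (\<phi> ys xs)" if "i < q" for ys xs i
      using cochains_J[OF \<phi> that, of ys] by (simp add: opp_def)
    show "\<phi> ys (xs(j := J (xs j))) = Iv (\<phi> ys xs)" if "j < p" for ys xs j
      by (rule cochains_J[OF \<phi>' that])
  qed
qed

lemma if_zero_apply: "(if c then f else 0) x = (if c then f x else 0)"
  by simp

lemma dbar_eq_cd: "dbar br rho J Iv p q = cd (br01 br J) (actM br rho J Iv p) q"
  unfolding fun_eq_iff dbar_def cd_def plus_fun_apply sum_fun_apply scaleR_fun_apply if_zero_apply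
  by simp

lemma complex_coeffs_UNIV: "complex_structure Iv \<Longrightarrow> complex_coeffs UNIV Iv"
  by (simp add: complex_structure_def complex_coeffs_def)

lemma complex_coeffs_forms:
  assumes "complex_structure Iv"
  shows "complex_coeffs (cochains UNIV J Iv p) (opp Iv)"
proof
  have Iv: "linear Iv" "\<And>v. Iv (Iv v) = - v"
    using assms by (auto simp: complex_structure_def)
  show "subspace (cochains UNIV J Iv p)"
    by (rule subspace_cochains) (simp_all add: Iv)
  show "opp Iv m \<in> cochains UNIV J Iv p" if "m \<in> cochains UNIV J Iv p" for m
    unfolding opp_def
    by (rule cochains_comp[OF that]) (simp_all add: linear_iff linear_add[OF Iv(1)] linear_scale[OF Iv(1)] linear_neg[OF Iv(1)])
  show "opp Iv (opp Iv m) = - m" for m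
    by (simp add: opp_def fun_eq_iff linear_neg[OF Iv(1)] Iv(2))
qed (use assms in \<open>auto simp: opp_def fun_eq_iff linear_iff complex_structure_def\<close>)

locale dolbeault =
  fixes br :: "'g::real_vector \<Rightarrow> 'g \<Rightarrow> 'g" and J :: "'g \<Rightarrow> 'g"
    and rho :: "'g \<Rightarrow> 'v::real_vector \<Rightarrow> 'v" and Iv :: "'v \<Rightarrow> 'v"
  assumes lie_algebra: "lie_algebra br" and integrable: "integrable_cs br J"
    and cs: "complex_structure Iv"
    and linear_rho: "linear (rho x)" and linear_rho_left: "linear (\<lambda>x. rho x v)"
begin

lemma linear_J: "linear J" and J_J: "J (J x) = - x"
  using integrable by (auto simp: integrable_cs_def complex_structure_def)

lemma linear_Iv: "linear Iv" and Iv_Iv: "Iv (Iv v) = - v"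
  using cs by (auto simp: complex_structure_def)

lemma linear_br: "linear (br x)" and linear_br_left: "linear (\<lambda>x. br x y)" and br_self: "br x x = 0"
  using lie_algebra by (auto simp: lie_algebra_def)

lemmas lin_simps = linear_add[OF linear_J] linear_scale[OF linear_J] linear_neg[OF linear_J]
  linear_diff[OF linear_J] linear_add[OF linear_Iv] linear_scale[OF linear_Iv] linear_neg[OF linear_Iv]
  linear_diff[OF linear_Iv] linear_add[OF linear_br] linear_scale[OF linear_br] linear_neg[OF linear_br]
  linear_add[OF linear_br_left] linear_scale[OF linear_br_left] linear_neg[OF linear_br_left]
  linear_add[OF linear_rho] linear_scale[OF linear_rho] linear_neg[OF linear_rho]
  linear_add[OF linear_rho_left] linear_scale[OF linear_rho_left] linear_neg[OF linear_rho_left]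
  J_J Iv_Iv

lemma nijenhuis: "br x y - br (J x) (J y) + J (br (J x) y) + J (br x (J y)) = 0"
  using integrable by (simp add: integrable_cs_def)

lemma linear_br01: "linear (br01 br J y)" and linear_br01_left: "linear (\<lambda>x. br01 br J x y)"
  by (simp_all add: br01_def linear_iff lin_simps algebra_simps)

lemma br01_self: "br01 br J y y = 0"
  by (simp add: br01_def br_self)

text \<open>This is \<open>J\<close> applied to the Nijenhuis identity: integrability is what makes
  the bracket of g^{0,1} complex bilinear.\<close>

lemma br01_J: "br01 br J y (J z) = J (br01 br J y z)"
proof -
  have "J (br y z - br (J y) (J z) + J (br (J y) z) + J (br y (J z))) = 0"
    by (simp only: nijenhuis linear_0[OF linear_J])
  then have "J (br y z) - J (br (J y) (J z)) = br (J y) z + br y (J z)"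
    by (simp add: lin_simps algebra_simps)
  then show ?thesis
    by (simp add: br01_def lin_simps add.commute)
qed

lemma linear_act10: "linear (act10 br J y)" and linear_act10_left: "linear (\<lambda>x. act10 br J x y)"
  by (simp_all add: act10_def linear_iff lin_simps algebra_simps)

lemma act10_J: "act10 br J y (J x) = J (act10 br J y x)"
  and act10_J_left: "act10 br J (J y) x = - J (act10 br J y x)"
  by (simp_all add: act10_def lin_simps algebra_simps)

lemma linear_actV: "linear (actV rho J Iv y)" and linear_actV_left: "linear (\<lambda>y. actV rho J Iv y v)"
  by (simp_all add: actV_def linear_iff lin_simps algebra_simps)

lemma actV_Iv: "actV rho J Iv y (Iv v) = Iv (actV rho J Iv y v)"
  and actV_J: "actV rho J Iv (J y) v = - Iv (actV rho J Iv y v)"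
  by (simp_all add: actV_def lin_simps algebra_simps)

text \<open>Makes \<open>lie_cochains\<close> and \<open>lie_wed\<close> available for the
  coefficient forms.\<close>

lemma actM_eq_lie: "actM br rho J Iv p y = lie (act10 br J y) (actV rho J Iv y) p"
  by (simp add: fun_eq_iff actM_def lie_def)

lemma ce_structure_dbar:
  "ce_structure (cochains UNIV J Iv p) J (opp Iv) (br01 br J) (actM br rho J Iv p)"
proof -
  interpret cc: complex_coeffs "cochains UNIV J Iv p" "opp Iv"
    by (rule complex_coeffs_forms[OF cs])
  show ?thesis
  proof (rule ce_structure.intro)
    show "linear (actM br rho J Iv p y)" for y
      by (simp add: linear_iff actM_def fun_eq_iff linear_add[OF linear_actV] linear_scale[OF linear_actV]
          sum.distrib scaleR_diff_right scaleR_sum_right)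
    fix m y assume m: "m \<in> cochains UNIV J Iv p"
    show "actM br rho J Iv p y m \<in> cochains UNIV J Iv p"
      unfolding actM_eq_lie
      by (rule lie_cochains[OF m]) (simp_all add: linear_Iv linear_act10 act10_J linear_actV actV_Iv)
    show "linear (\<lambda>y. actM br rho J Iv p y m)"
      unfolding linear_fun_iff
    proof
      fix xs
      have "linear (\<lambda>y. m (xs(j := act10 br J y (xs j))))" if "j < p" for j
        by (rule linear_of_comp[OF cochains_linear[OF m that, of xs] linear_act10_left[of "xs j"]])
      then have "linear (\<lambda>y. \<Sum>j<p. m (xs(j := act10 br J y (xs j))))"
        by (intro linear_compose_sum ballI) simp
      then show "linear (\<lambda>y. actM br rho J Iv p y m xs)"
        unfolding actM_def by (rule linear_compose_sub[OF linear_actV_left])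
    qed
    show "actM br rho J Iv p y (opp Iv m) = opp Iv (actM br rho J Iv p y m)"
      by (simp add: fun_eq_iff actM_def opp_def linear_neg[OF linear_actV] actV_Iv lin_simps
          linear_sum[OF linear_Iv] sum_negf)
    have "m (xs(j := - J z)) = - Iv (m (xs(j := z)))" if "j < p" for xs j z
      using linear_neg[OF cochains_linear[OF m that, of xs], of "J z"] cochains_J'[OF m that, of xs z]
      by simp
    then show "actM br rho J Iv p (J y) m = opp Iv (actM br rho J Iv p y m)"
      by (simp add: fun_eq_iff actM_def opp_def actV_J act10_J_left lin_simps linear_sum[OF linear_Iv] sum_negf)
  qed (fact cc.subspace cc.linear cc.K_in linear_br01 linear_br01_left br01_self br01_J)+
qed

lemma dcocycles_iff: "\<phi> \<in> dcocycles br rho J Iv p q \<longleftrightarrow>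
    \<phi> \<in> cochains (cochains UNIV J Iv p) J (opp Iv) q \<and> cd (br01 br J) (actM br rho J Iv p) q \<phi> = 0"
  by (simp add: dcocycles_def dcochain_iff dbar_eq_cd fun_eq_iff)

lemma dcoboundaries_iff: "\<phi> \<in> dcoboundaries br rho J Iv p q \<longleftrightarrow>
    (if q = 0 then \<phi> = 0 else \<exists>\<gamma>\<in>cochains (cochains UNIV J Iv p) J (opp Iv) (q - 1).
      \<phi> = cd (br01 br J) (actM br rho J Iv p) (q - 1) \<gamma>)"
  unfolding dcoboundaries_def dbar_eq_cd dcochain_iff by (auto simp: fun_eq_iff)

end

section \<open>Unimodularity\<close>

lemma cform_iff: "cform k \<omega> \<longleftrightarrow> \<omega> \<in> cochains UNIV id id k"
  unfolding cform_def cochains_def by auto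

lemma dCE_eq_cd: "dCE br k = cd br (\<lambda>_ _. 0) k"
proof -
  have scaleR: "(-1 :: real) ^ k *\<^sub>R z = (-1) ^ k * z" for k and z :: complex
    by (simp add: scaleR_conv_of_real)
  show ?thesis
    unfolding dCE_def cd_def fun_eq_iff scaleR by simp
qed

lemma (in complex_basis) real_basis_expansion:
  fixes b c
  defines "b \<equiv> \<lambda>k. if k < n then e k else J (e (k - n))"
    and "c \<equiv> \<lambda>k y. if k < n then Re (\<zeta> k y) else Im (\<zeta> (k - n) y)"
  shows "y = (\<Sum>k<2 * n. c k y *\<^sub>R b k)"
proof -
  have "(\<Sum>k<n + n. c k y *\<^sub>R b k) = (\<Sum>k<n. Re (\<zeta> k y) *\<^sub>R e k) + (\<Sum>k<n. Im (\<zeta> k y) *\<^sub>R J (e k))"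
    unfolding sum_lessThan_add by (simp add: b_def c_def)
  then show ?thesis
    using expansion[of y] by (simp add: sum.distrib mult_2)
qed

text \<open>If \<open>c\<close> spans the top cohomology then \<open>d(\<iota>\<^sub>y c) = L\<^sub>y c = - tr (ad y) c\<close>
  must vanish, i.e. the Lie algebra is unimodular.\<close>

lemma (in complex_basis) trace_ad_eq_0:
  assumes lie: "lie_algebra br" and cohom: "CE_cohom_iso_C br (2 * n)"
  shows "(\<Sum>i<n. Re (\<zeta> i (br y (e i))) + Im (\<zeta> i (br y (J (e i))))) = 0"
proof (rule ccontr)
  let ?t = "\<Sum>i<n. Re (\<zeta> i (br y (e i))) + Im (\<zeta> i (br y (J (e i))))"
  assume t: "?t \<noteq> 0"
  \<comment> \<open>For n = 0 the trace is an empty sum; from here on degree 2n - 1 is genuine and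
    \<open>CE_coboundaries\<close> is an image.\<close>
  then have n: "n \<noteq> 0" by (intro notI) simp
  define b where "b k = (if k < n then e k else J (e (k - n)))" for k
  define c where "c k y = (if k < n then Re (\<zeta> k y) else Im (\<zeta> (k - n) y))" for k y
  have exp: "y = (\<Sum>k<2 * n. c k y *\<^sub>R b k)" for y
    unfolding b_def c_def by (rule real_basis_expansion)
  have br: "linear (br x)" "linear (\<lambda>x. br x y)" "br x x = 0" for x y
    using lie by (auto simp: lie_algebra_def)
  interpret ce: ce_structure "UNIV :: complex set" id id br "\<lambda>_ _. 0"
    by (rule ce_structure.intro) (simp_all add: br linear_zero linear_id)
  obtain \<omega> where "\<omega> \<in> CE_cocycles br (2 * n)" and notin: "\<omega> \<notin> CE_coboundaries br (2 * n)"
    using cohom unfolding CE_cohom_iso_C_def by blast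
  then have \<omega>: "\<omega> \<in> ce.C (2 * n)" and closed: "ce.d (2 * n) \<omega> = 0"
    by (auto simp: CE_cocycles_def cform_iff dCE_eq_cd fun_eq_iff)
  have expand: "\<phi> (ys(i := z)) = (\<Sum>k<2 * n. c k z *\<^sub>R \<phi> (ys(i := b k)))"
    if "\<phi> \<in> ce.C (2 * n)" "i < 2 * n" for \<phi> ys i z
  proof -
    note lin = cochains_linear[OF that, of ys]
    have "\<phi> (ys(i := z)) = \<phi> (ys(i := (\<Sum>k<2 * n. c k z *\<^sub>R b k)))"
      using exp[of z] by simp
    also have "\<dots> = (\<Sum>k<2 * n. c k z *\<^sub>R \<phi> (ys(i := b k)))"
      by (simp only: linear_sum[OF lin] linear_scale[OF lin])
    finally show ?thesis .
  qed
  have trace: "(\<Sum>k<2 * n. c k (br y (b k))) = ?t"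
    unfolding mult_2 sum_lessThan_add by (simp add: b_def c_def sum.distrib)
  \<comment> \<open>A top form vanishes once it vanishes on the real basis \<open>b\<close>, and
    there the Lie derivative is minus the trace.\<close>
  have "ce.L y (2 * n) \<omega> + ?t *\<^sub>R \<omega> = 0"
  proof (rule cochains_top_eq_0[where e = b and N = "2 * n" and s = "\<lambda>k y z. c k y *\<^sub>R z"])
    show in_C: "ce.L y (2 * n) \<omega> + ?t *\<^sub>R \<omega> \<in> ce.C (2 * n)"
      by (intro subspace_add subspace_scale ce.subspace_C ce.L_in \<omega>)
    show "(ce.L y (2 * n) \<omega> + ?t *\<^sub>R \<omega>) (ys(i := z)) =
        (\<Sum>k<2 * n. c k z *\<^sub>R (ce.L y (2 * n) \<omega> + ?t *\<^sub>R \<omega>) (ys(i := b k)))"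
      if "i < 2 * n" for ys i z
      by (rule expand[OF in_C that])
    have "(\<Sum>i<2 * n. \<omega> (b(i := br y (b i)))) = (\<Sum>i<2 * n. c i (br y (b i)) *\<^sub>R \<omega> b)"
    proof (rule cochains_top_trace[OF \<omega>, where s = "\<lambda>k y z. c k y *\<^sub>R z"])
      show "\<omega> (ys(i := z)) = (\<Sum>k<2 * n. c k z *\<^sub>R \<omega> (ys(i := b k)))" if "i < 2 * n" for ys i z
        by (rule expand[OF \<omega> that])
    qed simp
    also have "\<dots> = ?t *\<^sub>R \<omega> b"
      by (simp only: scaleR_sum_left[symmetric] trace)
    finally have "(ce.L y (2 * n) \<omega> + ?t *\<^sub>R \<omega>) b = 0"
      unfolding plus_fun_apply scaleR_fun_apply lie_def by (simp only: diff_0 add.left_inverse)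
    then show "2 * n < 2 * n \<or> 2 * n = 2 * n \<and> (ce.L y (2 * n) \<omega> + ?t *\<^sub>R \<omega>) b = 0"
      by blast
  qed simp
  then have L: "ce.L y (2 * n) \<omega> = - (?t *\<^sub>R \<omega>)"
    by (simp only: eq_neg_iff_add_eq_0)
  \<comment> \<open>The contraction has differential -t times \<open>\<omega>\<close>, so this
    multiple of it is a primitive of \<open>\<omega>\<close>.\<close>
  define \<eta> where "\<eta> = (- 1 / ?t) *\<^sub>R contract (2 * n) y \<omega>"
  have \<iota>: "contract (2 * n) y \<omega> \<in> ce.C (2 * n - 1)"
    by (rule contract_cochains[OF \<omega>]) (simp_all add: linear_id)
  have "ce.d (2 * n - 1) (contract (2 * n) y \<omega>) = ce.L y (2 * n) \<omega>"
  proof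
    fix ys
    show "ce.d (2 * n - 1) (contract (2 * n) y \<omega>) ys = ce.L y (2 * n) \<omega> ys"
      using ce.d_cons[OF \<omega>, of y ys] by (simp add: closed)
  qed
  then have "\<omega> = ce.d (2 * n - 1) \<eta>"
    using t unfolding \<eta>_def linear_scale[OF ce.linear_d] L by simp
  moreover have "cform (2 * n - 1) \<eta>"
    unfolding cform_iff \<eta>_def by (rule subspace_scale[OF ce.subspace_C \<iota>])
  ultimately have "\<omega> \<in> CE_coboundaries br (2 * n)"
    using n unfolding CE_coboundaries_def dCE_eq_cd by auto
  with notin show False ..
qed

section \<open>The action of g^{0,1} on (n,n)-forms\<close>

lemma complex_structure_ii: "complex_structure ((*) \<i>)"
  by (simp add: complex_structure_def linear_iff algebra_simps flip: mult.assoc)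

abbreviation scalar_forms :: "('g::real_vector \<Rightarrow> 'g) \<Rightarrow> nat \<Rightarrow> ((nat \<Rightarrow> 'g) \<Rightarrow> complex) set"
  where "scalar_forms J n \<equiv> cochains UNIV J ((*) \<i>) n"

abbreviation scalar_act :: "('g::real_vector \<Rightarrow> 'g \<Rightarrow> 'g) \<Rightarrow> ('g \<Rightarrow> 'g) \<Rightarrow> nat \<Rightarrow> 'g \<Rightarrow>
    ((nat \<Rightarrow> 'g) \<Rightarrow> complex) \<Rightarrow> (nat \<Rightarrow> 'g) \<Rightarrow> complex"
  where "scalar_act br J n \<equiv> actM br (\<lambda>_ _. 0) J ((*) \<i>) n"

lemma dolbeault_scalar:
  "lie_algebra br \<Longrightarrow> integrable_cs br J \<Longrightarrow> dolbeault br J (\<lambda>_ _. 0 :: complex) ((*) \<i>)"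
  by (simp add: dolbeault_def complex_structure_ii linear_zero)

context complex_basis
begin

text \<open>Up to sign, the sum is the scalar by which the element (z + i J z) / 2 of g^{0,1} acts
  on (n,n)-forms; the conjugate appears because g^{0,1} has the conjugate coframe. By the Nijenhuis
  identity it equals (tr ad z + i tr ad (J z)) / 2.\<close>

lemma trace_action_eq_0:
  assumes lie: "lie_algebra br" and integrable: "integrable_cs br J" and cohom: "CE_cohom_iso_C br (2 * n)"
  shows "(\<Sum>i<n. \<zeta> i (act10 br J z (e i)) + cnj (\<zeta> i (br01 br J z (e i)))) = 0"
proof -
  interpret dolbeault br J "\<lambda>_ _. 0 :: complex" "(*) \<i>"
    by (rule dolbeault_scalar[OF lie integrable])
  let ?X = "\<lambda>z i. \<zeta> i (br z (e i))" and ?Y = "\<lambda>z i. \<zeta> i (br z (J (e i)))"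
  have summand: "\<zeta> i (act10 br J z (e i)) + cnj (\<zeta> i (br01 br J z (e i))) =
      Complex ((Re (?X z i) + Im (?Y z i)) / 2) ((Re (?X (J z) i) + Im (?Y (J z) i)) / 2)" for i
  proof -
    have "\<zeta> i (br z (e i) - br (J z) (J (e i)) + J (br (J z) (e i)) + J (br z (J (e i)))) = 0"
      by (simp only: nijenhuis linear_0[OF linear_\<zeta>])
    then have rel: "?X z i - ?Y (J z) i + \<i> * ?X (J z) i + \<i> * ?Y z i = 0"
      by (simp only: linear_add[OF linear_\<zeta>] linear_diff[OF linear_\<zeta>] \<zeta>_J)
    have "\<zeta> i (act10 br J z (e i)) =
        (1 / 4) *\<^sub>R (?X z i + ?Y (J z) i + \<i> * ?X (J z) i - \<i> * ?Y z i)"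
      by (simp only: act10_def linear_scale[OF linear_\<zeta>] linear_add[OF linear_\<zeta>] linear_diff[OF linear_\<zeta>] \<zeta>_J)
    moreover have "\<zeta> i (br01 br J z (e i)) = (1 / 2) *\<^sub>R (?X z i - ?Y (J z) i)"
      by (simp only: br01_def linear_scale[OF linear_\<zeta>] linear_diff[OF linear_\<zeta>])
    ultimately show ?thesis
      using rel by (simp add: complex_eq_iff)
  qed
  have "(\<Sum>i<n. Complex ((Re (?X z i) + Im (?Y z i)) / 2) ((Re (?X (J z) i) + Im (?Y (J z) i)) / 2)) =
      Complex ((\<Sum>i<n. Re (?X z i) + Im (?Y z i)) / 2) ((\<Sum>i<n. Re (?X (J z) i) + Im (?Y (J z) i)) / 2)"
    by (simp add: complex_eq_iff sum_divide_distrib)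
  then show ?thesis
    unfolding summand trace_ad_eq_0[OF lie cohom] by (simp add: complex_eq_iff)
qed

text \<open>In degree n - 1 the number operator is the identity, so \<open>\<phi>\<close> is a sum
  of contractions of top forms \<open>\<Phi>\<close>. By Cartan's formula d of such a contraction is
  L_y \<open>\<Phi>\<close> minus the contraction of d \<open>\<Phi>\<close>: the first is zero by
  the trace identity, the second by degree.\<close>

lemma dbar_top_eq_0:
  assumes lie: "lie_algebra br" and integrable: "integrable_cs br J" and cohom: "CE_cohom_iso_C br (2 * n)"
    and q: "Suc q = n" and \<phi>: "\<phi> \<in> cochains (scalar_forms J n) J (opp ((*) \<i>)) q"
  shows "cd (br01 br J) (scalar_act br J n) q \<phi> = 0"
proof -
  interpret D: dolbeault br J "\<lambda>_ _. 0 :: complex" "(*) \<i>"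
    by (rule dolbeault_scalar[OF lie integrable])
  interpret E: ce_structure "scalar_forms J n" J "opp ((*) \<i>)" "br01 br J" "scalar_act br J n"
    by (rule D.ce_structure_dbar)
  have coeffs: "complex_coeffs (scalar_forms J n) (opp ((*) \<i>))"
    by (rule complex_coeffs_forms[OF complex_structure_ii])
  have mult_i: "linear ((*) \<i>)"
    by (rule D.linear_Iv)
  \<comment> \<open>Both the cochain and its values are of top degree, so evaluation on the basis in
    both groups of arguments decides.\<close>
  have L0: "E.L z n \<Phi> = 0" if \<Phi>: "\<Phi> \<in> E.C n" for z \<Phi>
  proof -
    have cmul: "cmul ((*) \<i>) w x = w * x" "cmul (opp ((*) \<i>)) w m e = cnj w * m e" for w x m
      by (simp_all add: cmul_def opp_def complex_eq_iff)
    have "(\<Sum>j<n. \<Phi> e (e(j := act10 br J z (e j)))) = (\<Sum>j<n. \<zeta> j (act10 br J z (e j))) * \<Phi> e e"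
      using top_trace[OF cochains_in[OF \<Phi>, of e] mult_i, of "act10 br J z"]
      by (simp add: cmul sum_distrib_right)
    moreover have "(\<Sum>i<n. \<Phi> (e(i := br01 br J z (e i)))) e = (\<Sum>i<n. cnj (\<zeta> i (br01 br J z (e i)))) * \<Phi> e e"
      using top_trace[OF \<Phi> E.linear_K, of "br01 br J z"]
      by (simp add: cmul sum_fun_apply sum_distrib_right)
    moreover have "E.L z n \<Phi> e e = - (\<Sum>j<n. \<Phi> e (e(j := act10 br J z (e j)))) -
        (\<Sum>i<n. \<Phi> (e(i := br01 br J z (e i)))) e"
      by (simp add: lie_def actM_def actV_def)
    ultimately have "E.L z n \<Phi> e e =
        - ((\<Sum>i<n. \<zeta> i (act10 br J z (e i)) + cnj (\<zeta> i (br01 br J z (e i)))) * \<Phi> e e)"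
      by (simp add: sum.distrib algebra_simps)
    then have "E.L z n \<Phi> e e = 0"
      by (simp add: trace_action_eq_0[OF lie integrable cohom])
    then have "E.L z n \<Phi> e = 0"
      by (intro top_eq_0[OF cochains_in[OF E.L_in[OF \<Phi>]] mult_i]) simp
    then show ?thesis
      by (intro top_eq_0[OF E.L_in[OF \<Phi>] E.linear_K]) simp
  qed
  have closed: "E.d q (\<lambda>ys. \<Phi> (cons_arg y ys)) = 0" if \<Phi>: "\<Phi> \<in> E.C n" for \<Phi> y
  proof
    fix ys
    have "E.d n \<Phi> = 0"
      by (rule top_eq_0[OF E.d_in[OF \<Phi>] E.linear_K]) simp
    moreover have "contract n y \<Phi> = (\<lambda>ys. \<Phi> (cons_arg y ys))" "n - 1 = q"
      by (simp_all flip: q)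
    ultimately show "E.d q (\<lambda>ys. \<Phi> (cons_arg y ys)) ys = 0 ys"
      using E.d_cons[OF \<Phi>, of y ys] by (simp add: L0[OF \<Phi>])
  qed
  have ext: "ext_mult (opp ((*) \<i>)) i q \<phi> \<in> E.C n" for i
    using ce_structure.d_in[OF ce_structure_ext[OF coeffs] \<phi>, of i] by (simp add: ext_mult_def q)
  \<comment> \<open>The number operator with n - q = 1.\<close>
  have "\<phi> = (\<Sum>i<n. (\<lambda>ys. ext_mult (opp ((*) \<i>)) i q \<phi> (cons_arg (e i) ys)))"
  proof
    fix ys
    show "\<phi> ys = (\<Sum>i<n. (\<lambda>ys. ext_mult (opp ((*) \<i>)) i q \<phi> (cons_arg (e i) ys))) ys"
      unfolding sum_fun_apply sum_contract_ext_mult[OF \<phi> E.linear_K] by (simp flip: q)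
  qed
  then have "E.d q \<phi> = (\<Sum>i<n. E.d q (\<lambda>ys. ext_mult (opp ((*) \<i>)) i q \<phi> (cons_arg (e i) ys)))"
    using linear_sum[OF E.linear_d] by metis
  then show ?thesis
    by (simp add: closed[OF ext])
qed

end

section \<open>The evaluation pairing and the dual module\<close>

lemma dual_rho_apply: "bounded_linear (rho x) \<Longrightarrow> dual_rho rho x \<psi> v = - \<psi> (rho x v)"
  by (simp add: dual_rho_def blinfun.minus_left bounded_linear_Blinfun_apply)

lemma dual_cs_apply: "bounded_linear I \<Longrightarrow> dual_cs I \<psi> v = \<psi> (I v)"
  by (simp add: dual_cs_def bounded_linear_Blinfun_apply)

lemma eval10_linear_left: "linear I \<Longrightarrow> linear (\<lambda>v. eval10 I v \<psi>)"
  by (simp add: eval10_def linear_iff complex_eq_iff blinfun.bilinear_simps field_simps)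

lemma eval10_linear_right: "linear (eval10 I v)"
  by (simp add: eval10_def linear_iff complex_eq_iff blinfun.bilinear_simps field_simps)

lemma pairing_eval10:
  fixes I :: "'e::real_normed_vector \<Rightarrow> 'e"
  assumes I: "complex_structure I" "bounded_linear I"
  shows "pairing UNIV UNIV UNIV I (dual_cs I) ((*) \<i>) (eval10 I)"
proof (rule pairing.intro)
  have lin: "linear I" and II: "I (I v) = - v" for v
    using I by (auto simp: complex_structure_def)
  show "linear (\<lambda>m. eval10 I m w)" for w
    by (rule eval10_linear_left[OF lin])
  show "linear (eval10 I m)" for m
    by (rule eval10_linear_right)
  show "linear I" by (rule lin)
  show "linear (dual_cs I)"
    by (simp add: linear_iff dual_cs_def bounded_bilinear.add_left[OF bounded_bilinear_blinfun_compose]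
          bounded_bilinear.scaleR_left[OF bounded_bilinear_blinfun_compose])
  show "linear ((*) \<i>)"
    using complex_structure_ii by (simp add: complex_structure_def)
  show "eval10 I (I m) w = \<i> * eval10 I m w" for m w
    by (simp add: eval10_def complex_eq_iff II blinfun.minus_right)
  show "eval10 I m (dual_cs I w) = \<i> * eval10 I m w" for m w
    by (simp add: eval10_def complex_eq_iff II dual_cs_apply[OF I(2)] blinfun.minus_right)
qed simp_all

lemma opp_eq: "opp Iv m = - (\<lambda>xs. Iv (m xs))"
  by (simp add: opp_def fun_eq_iff)

text \<open>The exterior product of coefficient forms is again a complex bilinear pairing, which
  permits the iteration of \<open>wed\<close>.\<close>

lemma (in pairing) pairing_forms:
  assumes "a + b = n" "M = UNIV" "M' = UNIV" "N = UNIV"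
  shows "pairing (cochains UNIV J K a) (cochains UNIV J K' b) (cochains UNIV J L n)
    (opp K) (opp K') (opp L) (wed P a b)"
proof (rule pairing.intro)
  have opp_linear: "linear (opp T)" if "linear T" for T :: "'x::real_vector \<Rightarrow> 'x"
    using that by (auto simp: linear_iff opp_def fun_eq_iff)
  show "subspace (cochains UNIV J K a)" "subspace (cochains UNIV J K' b)" "subspace (cochains UNIV J L n)"
    by (simp_all add: subspace_cochains linears)
  show "linear (opp K)" "linear (opp K')" "linear (opp L)"
    by (simp_all add: opp_linear linears)
  show "linear (\<lambda>m. wed P a b m w)" for w by (rule wed_left)
  show "linear (wed P a b m)" for m by (rule wed_right)
  show "wed P a b m w \<in> cochains UNIV J L n" if "m \<in> cochains UNIV J K a" "w \<in> cochains UNIV J K' b" for m w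
    using wed_cochains[unfolded assms(2-4), OF that] assms(1) by simp
  show "wed P a b (opp K m) w = opp L (wed P a b m w)" for m w
    unfolding opp_eq linear_neg[OF wed_left] by (simp add: fun_eq_iff wed_K)
  show "wed P a b m (opp K' w) = opp L (wed P a b m w)" for m w
    unfolding opp_eq linear_neg[OF wed_right] by (simp add: fun_eq_iff wed_K)
qed

lemma dolbeault_dual:
  fixes rho :: "'g::real_vector \<Rightarrow> 'e::real_normed_vector \<Rightarrow> 'e"
  assumes "dolbeault br J rho I" and bounded: "\<And>x. bounded_linear (rho x)" "bounded_linear I"
  shows "dolbeault br J (dual_rho rho) (dual_cs I)"
proof -
  interpret D: dolbeault br J rho I by fact
  show ?thesis
  proof (rule dolbeault.intro)
    show "complex_structure (dual_cs I)"
      unfolding complex_structure_def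
    proof
      show "linear (dual_cs I)"
        by (simp add: linear_iff dual_cs_def bounded_bilinear.add_left[OF bounded_bilinear_blinfun_compose]
          bounded_bilinear.scaleR_left[OF bounded_bilinear_blinfun_compose])
      show "\<forall>x. dual_cs I (dual_cs I x) = - x"
        by (auto intro!: blinfun_eqI simp: dual_cs_apply[OF bounded(2)] D.Iv_Iv blinfun.bilinear_simps)
    qed
    show "linear (dual_rho rho x)" for x
      by (simp add: linear_iff dual_rho_def bounded_bilinear.add_left[OF bounded_bilinear_blinfun_compose]
          bounded_bilinear.scaleR_left[OF bounded_bilinear_blinfun_compose])
    show "linear (\<lambda>x. dual_rho rho x \<psi>)" for \<psi>
      by (auto intro!: linearI blinfun_eqI simp: dual_rho_apply[OF bounded(1)] blinfun.bilinear_simps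
          linear_add[OF D.linear_rho_left] linear_scale[OF D.linear_rho_left])
  qed (fact D.lie_algebra D.integrable)+
qed

lemma actV_dual_apply:
  assumes "\<And>x. bounded_linear (rho x)" "bounded_linear I"
  shows "actV (dual_rho rho) J (dual_cs I) y \<psi> v = - \<psi> (actV rho J I y v)"
  by (simp add: actV_def blinfun.bilinear_simps dual_rho_apply[OF assms(1)] dual_cs_apply[OF assms(2)]
      algebra_simps)

text \<open>The reordering sign is a global nonzero factor, so vanishing and equality can be decided
  on the iterated product.\<close>

lemma wedge_pair_eq_wed: "wedge_pair I n p q \<alpha> \<beta> = (\<lambda>ys xs. (-1) ^ (q * (n - p)) *
    wed (wed (eval10 I) p (n - p)) q (n - q) \<alpha> \<beta> ys xs)"
proof -
  have "(\<Sum>\<sigma>\<in>shuffles p (n - p). \<Sum>\<tau>\<in>shuffles q (n - q). of_int (sign \<sigma> * sign \<tau>) *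
        eval10 I (\<alpha> (ys \<circ> \<tau>) (xs \<circ> \<sigma>)) (\<beta> (\<lambda>k. ys (\<tau> (q + k))) (\<lambda>k. xs (\<sigma> (p + k))))) =
      wed (wed (eval10 I) p (n - p)) q (n - q) \<alpha> \<beta> ys xs" for ys xs
    unfolding wed_def sum_fun_apply scaleR_fun_apply scaleR_sum_right
    by (subst sum.swap) (simp add: scaleR_conv_of_real mult_ac)
  then show ?thesis
    by (simp add: wedge_pair_def)
qed

theorem mainTheorem9:
  fixes br :: "'g::real_vector \<Rightarrow> 'g \<Rightarrow> 'g" and J :: "'g \<Rightarrow> 'g"
    and rho :: "'g \<Rightarrow> 'e::real_normed_vector \<Rightarrow> 'e" and I :: "'e \<Rightarrow> 'e"
    and n p q :: nat
  assumes "lie_algebra br"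
    and "fin_dim (UNIV :: 'g set)" and "dim (UNIV :: 'g set) = 2 * n"
    and "integrable_cs br J"
    and "CE_cohom_iso_C br (2 * n)"
    and "fin_dim (UNIV :: 'e set)"
    and "lie_module br rho" and "complex_structure I"
    and "integrable_module J rho I \<or> anti_integrable_module J rho I"
    and "p \<le> n" and "q \<le> n"
  shows
    "(\<forall>\<alpha> \<alpha>' \<beta> \<beta>'.
        \<alpha> \<in> dcocycles br rho J I p q \<longrightarrow> \<alpha>' \<in> dcocycles br rho J I p q \<longrightarrow>
        \<beta> \<in> dcocycles br (dual_rho rho) J (dual_cs I) (n - p) (n - q) \<longrightarrow>
        \<beta>' \<in> dcocycles br (dual_rho rho) J (dual_cs I) (n - p) (n - q) \<longrightarrow>
        (\<lambda>ys xs. \<alpha> ys xs - \<alpha>' ys xs) \<in> dcoboundaries br rho J I p q \<longrightarrow>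
        (\<lambda>ys xs. \<beta> ys xs - \<beta>' ys xs) \<in> dcoboundaries br (dual_rho rho) J (dual_cs I) (n - p) (n - q) \<longrightarrow>
        wedge_pair I n p q \<alpha> \<beta> = wedge_pair I n p q \<alpha>' \<beta>') \<and>
     (\<forall>\<alpha> \<in> dcocycles br rho J I p q.
        (\<forall>\<beta> \<in> dcocycles br (dual_rho rho) J (dual_cs I) (n - p) (n - q).
           wedge_pair I n p q \<alpha> \<beta> = (\<lambda>ys xs. 0))
        \<longrightarrow> \<alpha> \<in> dcoboundaries br rho J I p q) \<and>
     (\<forall>\<beta> \<in> dcocycles br (dual_rho rho) J (dual_cs I) (n - p) (n - q).
        (\<forall>\<alpha> \<in> dcocycles br rho J I p q. wedge_pair I n p q \<alpha> \<beta> = (\<lambda>ys xs. 0))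
        \<longrightarrow> \<beta> \<in> dcoboundaries br (dual_rho rho) J (dual_cs I) (n - p) (n - q))"
proof -
  let ?I' = "dual_cs I" and ?rho' = "dual_rho rho" and ?b = "br01 br J"
  let ?M = "cochains UNIV J I p" and ?M' = "cochains UNIV J ?I' (n - p)" and ?N = "scalar_forms J n"
  let ?P = "wed (eval10 I) p (n - p)"
  have J: "linear J" "\<And>y. J (J y) = - y"
    using assms(4) by (auto simp: integrable_cs_def complex_structure_def)
  obtain e \<zeta> where "complex_basis J e \<zeta> n"
    using exists_complex_basis[OF assms(2,3) J] .
  then interpret B: complex_basis J e \<zeta> n .
  have lin: "linear I" "\<And>x. linear (rho x)" "\<And>v. linear (\<lambda>x. rho x v)"
    using assms(7,8) by (auto simp: complex_structure_def lie_module_def)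
  note bounded = fin_dim_bounded_linear[OF assms(6) lin(2)] fin_dim_bounded_linear[OF assms(6) lin(1)]
  interpret D1: dolbeault br J rho I
    by (rule dolbeault.intro) (fact assms lin)+
  interpret D2: dolbeault br J ?rho' ?I'
    by (rule dolbeault_dual[OF D1.dolbeault_axioms bounded])
  interpret D3: dolbeault br J "\<lambda>_ _. 0 :: complex" "(*) \<i>"
    by (rule dolbeault_scalar[OF assms(1,4)])
  have pairing0: "pairing UNIV UNIV UNIV I ?I' ((*) \<i>) (eval10 I)"
    by (rule pairing_eval10[OF assms(8) bounded(2)])
  interpret P0: pairing UNIV UNIV UNIV J I ?I' "(*) \<i>" "eval10 I"
    by (rule pairing0)
  have pairing1: "pairing ?M ?M' ?N (opp I) (opp ?I') (opp ((*) \<i>)) ?P"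
    by (rule P0.pairing_forms) (use assms(10) in auto)
  note coeffs0 = complex_coeffs_UNIV[OF D1.cs] complex_coeffs_UNIV[OF D2.cs] complex_coeffs_UNIV[OF D3.cs]
  obtain V :: "'e set" where V: "finite V" "independent V" "span V = UNIV"
    using fin_dim_basis[OF assms(6)] .
  have sepV: "\<psi> = 0" if "\<And>v. v \<in> V \<Longrightarrow> eval10 I v \<psi> = 0" for \<psi>
  proof -
    have "blinfun_apply \<psi> v = 0" if "v \<in> V" for v
      using \<open>\<And>v. v \<in> V \<Longrightarrow> eval10 I v \<psi> = 0\<close>[OF that] by (simp add: eval10_def complex_eq_iff)
    then have "blinfun_apply \<psi> v = 0" for v
      using linear_eq_0_on_span[OF bounded_linear.linear[OF blinfun.bounded_linear_right], of V \<psi>] V(3)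
      by blast
    then show ?thesis by (auto intro: blinfun_eqI)
  qed
  \<comment> \<open>The coordinate functionals of the basis \<open>V\<close>: a vector that pairs to
    zero with all of them has no nonzero coordinate.\<close>
  define V' where "V' = (\<lambda>v. Blinfun (\<lambda>x. representation V x v)) ` V"
  have sepV': "x = 0" if "\<And>\<psi>. \<psi> \<in> V' \<Longrightarrow> eval10 I x \<psi> = 0" for x
  proof -
    have "representation V x v = 0" if "v \<in> V" for v
    proof -
      have "linear (\<lambda>x. representation V x v)"
        by (simp add: linear_iff representation_add representation_scale V)
      then have "bounded_linear (\<lambda>x. representation V x v)"
        by (rule fin_dim_bounded_linear[OF assms(6)])
      then show ?thesis
        using \<open>\<And>\<psi>. \<psi> \<in> V' \<Longrightarrow> eval10 I x \<psi> = 0\<close>[of "Blinfun (\<lambda>x. representation V x v)"] that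
        by (auto simp: V'_def eval10_def complex_eq_iff bounded_linear_Blinfun_apply)
    qed
    then show ?thesis
      using sum_representation_eq[OF V(2) _ V(1) order_refl, of x] V(3) by simp
  qed
  have "\<exists>\<Gamma>. finite \<Gamma> \<and> \<Gamma> \<subseteq> ?M \<and> (\<forall>b. p + b \<le> n \<longrightarrow>
      (\<forall>\<psi>\<in>cochains UNIV J ?I' b. (\<forall>\<gamma>\<in>\<Gamma>. wed (eval10 I) p b \<gamma> \<psi> = 0) \<longrightarrow> \<psi> = 0))"
    by (rule B.wed_separating_left[OF pairing0 coeffs0 V(1)]) (auto intro: sepV)
  then obtain U where U: "finite U" "U \<subseteq> ?M" and U_sep: "\<forall>b. p + b \<le> n \<longrightarrow>
      (\<forall>\<psi>\<in>cochains UNIV J ?I' b. (\<forall>\<gamma>\<in>U. wed (eval10 I) p b \<gamma> \<psi> = 0) \<longrightarrow> \<psi> = 0)"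
    by (elim exE conjE)
  have sepU: "w = 0" if "w \<in> ?M'" "\<And>u. u \<in> U \<Longrightarrow> ?P u w = 0" for w
  proof -
    have "\<forall>u\<in>U. ?P u w = 0" using that(2) by blast
    then show ?thesis using U_sep[rule_format, OF _ that(1)] assms(10) by simp
  qed
  have "finite V'" using V(1) by (simp add: V'_def)
  then have "\<exists>\<Gamma>. finite \<Gamma> \<and> \<Gamma> \<subseteq> ?M' \<and> (\<forall>a. a + (n - p) \<le> n \<longrightarrow>
      (\<forall>\<phi>\<in>cochains UNIV J I a. (\<forall>\<gamma>\<in>\<Gamma>. wed (eval10 I) a (n - p) \<phi> \<gamma> = 0) \<longrightarrow> \<phi> = 0))"
    by (rule B.wed_separating_right[OF pairing0 coeffs0]) (auto intro: sepV')
  then obtain U' where U': "finite U'" "U' \<subseteq> ?M'" and U'_sep: "\<forall>a. a + (n - p) \<le> n \<longrightarrow>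
      (\<forall>\<phi>\<in>cochains UNIV J I a. (\<forall>\<gamma>\<in>U'. wed (eval10 I) a (n - p) \<phi> \<gamma> = 0) \<longrightarrow> \<phi> = 0)"
    by (elim exE conjE)
  have sepU': "m = 0" if "m \<in> ?M" "\<And>u. u \<in> U' \<Longrightarrow> ?P m u = 0" for m
  proof -
    have "\<forall>u\<in>U'. ?P m u = 0" using that(2) by blast
    then show ?thesis using U'_sep[rule_format, OF _ that(1)] assms(10) by simp
  qed
  have act: "scalar_act br J n y (?P m w) =
      ?P (actM br rho J I p y m) w + ?P m (actM br ?rho' J ?I' (n - p) y w)"
    if "m \<in> ?M" "w \<in> ?M'" for y m w
  proof -
    \<comment> \<open>Evaluation is invariant because the dual action carries a minus sign; the left
      side is the trivial action on the complex numbers.\<close>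
    have compatible: "(0::complex) = eval10 I (actV rho J I y v) \<psi> + eval10 I v (actV ?rho' J ?I' y \<psi>)" for v \<psi>
      by (simp add: eval10_def actV_dual_apply[OF bounded] D1.actV_Iv complex_eq_iff)
    have trivial: "actV (\<lambda>_ _. 0 :: complex) J ((*) \<i>) y = (\<lambda>_. 0)"
      by (simp add: fun_eq_iff actV_def)
    show ?thesis
      unfolding D1.actM_eq_lie D2.actM_eq_lie D3.actM_eq_lie trivial
      using P0.lie_wed[OF that linear_zero compatible, of "act10 br J y"] assms(10)
      by (simp add: fun_eq_iff)
  qed
  interpret W: ce_duality J e \<zeta> n ?M ?M' ?N "opp I" "opp ?I'" "opp ((*) \<i>)" ?P ?b
    "actM br rho J I p" "actM br ?rho' J ?I' (n - p)" "scalar_act br J n" "\<lambda>F. F e" U U'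
  proof (intro ce_duality.intro ce_duality_axioms.intro)
    show "complex_basis J e \<zeta> n" by (rule B.complex_basis_axioms)
    show "pairing ?M ?M' ?N (opp I) (opp ?I') (opp ((*) \<i>)) ?P" by (rule pairing1)
    show "linear (\<lambda>F :: (nat \<Rightarrow> 'g) \<Rightarrow> complex. F e)" by (simp add: linear_iff)
    show "opp ((*) \<i>) m e = - \<i> * m e" for m :: "(nat \<Rightarrow> 'g) \<Rightarrow> complex" by (simp add: opp_def)
    show "m = 0" if "m \<in> ?N" "m e = 0" for m
      by (rule B.top_eq_0[OF that(1) D3.linear_Iv]) (use that in simp)
    show "cd ?b (scalar_act br J n) q \<phi> = 0" if "Suc q = n" "\<phi> \<in> cochains ?N J (opp ((*) \<i>)) q" for q \<phi>
      by (rule B.dbar_top_eq_0[OF assms(1,4,5) that])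
  qed (fact complex_coeffs_forms[OF D1.cs] complex_coeffs_forms[OF D2.cs] complex_coeffs_forms[OF D3.cs]
      D1.ce_structure_dbar D2.ce_structure_dbar D3.ce_structure_dbar act U U' sepU sepU')+
  interpret E1: ce_structure ?M J "opp I" ?b "actM br rho J I p" by (rule D1.ce_structure_dbar)
  interpret E2: ce_structure ?M' J "opp ?I'" ?b "actM br ?rho' J ?I' (n - p)" by (rule D2.ce_structure_dbar)
  let ?W = "wed ?P q (n - q)"
  have n: "q + (n - q) = n" using assms(11) by simp
  have wedge0: "wedge_pair I n p q \<alpha> \<beta> = (\<lambda>ys xs. 0) \<longleftrightarrow> ?W \<alpha> \<beta> = 0" for \<alpha> \<beta>
    by (simp add: wedge_pair_eq_wed fun_eq_iff)
  have left: "?W \<alpha> \<beta> = 0"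
    if exact: "\<alpha> \<in> dcoboundaries br rho J I p q" and closed: "\<beta> \<in> E2.C (n - q)" "E2.d (n - q) \<beta> = 0" for \<alpha> \<beta>
  proof (cases q)
    case 0
    then show ?thesis
      using exact by (simp add: D1.dcoboundaries_iff linear_0[OF W.wed_left])
  next
    case (Suc a)
    then obtain \<gamma> where "\<gamma> \<in> E1.C a" "\<alpha> = E1.d a \<gamma>"
      using exact by (auto simp: D1.dcoboundaries_iff)
    then show ?thesis
      using W.wed_exact_left[of a "n - q" \<gamma> \<beta>] closed n Suc by simp
  qed
  have right: "?W \<alpha> \<beta> = 0"
    if exact: "\<beta> \<in> dcoboundaries br ?rho' J ?I' (n - p) (n - q)" and closed: "\<alpha> \<in> E1.C q" "E1.d q \<alpha> = 0" for \<alpha> \<beta>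
  proof (cases "n - q")
    case 0
    then show ?thesis
      using exact by (simp add: D2.dcoboundaries_iff linear_0[OF W.wed_right])
  next
    case (Suc a)
    then obtain \<gamma> where "\<gamma> \<in> E2.C a" "\<beta> = E2.d a \<gamma>"
      using exact by (auto simp: D2.dcoboundaries_iff)
    then show ?thesis
      using W.wed_exact_right[of q a \<alpha> \<gamma>] closed n Suc by simp
  qed
  show ?thesis
  proof (intro conjI allI impI ballI)
    fix \<alpha> \<alpha>' \<beta> \<beta>'
    assume \<alpha>: "\<alpha> \<in> dcocycles br rho J I p q" "\<alpha>' \<in> dcocycles br rho J I p q"
      and \<beta>: "\<beta> \<in> dcocycles br ?rho' J ?I' (n - p) (n - q)" "\<beta>' \<in> dcocycles br ?rho' J ?I' (n - p) (n - q)"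
      and d\<alpha>: "(\<lambda>ys xs. \<alpha> ys xs - \<alpha>' ys xs) \<in> dcoboundaries br rho J I p q"
      and d\<beta>: "(\<lambda>ys xs. \<beta> ys xs - \<beta>' ys xs) \<in> dcoboundaries br ?rho' J ?I' (n - p) (n - q)"
    have "\<alpha> - \<alpha>' \<in> dcoboundaries br rho J I p q" "\<beta> - \<beta>' \<in> dcoboundaries br ?rho' J ?I' (n - p) (n - q)"
      using d\<alpha> d\<beta> by (simp_all add: fun_diff_def)
    \<comment> \<open>Changing one argument at a time pairs an exact cochain with a closed one in
      each term.\<close>
    then have "?W (\<alpha> - \<alpha>') \<beta> = 0" "?W \<alpha>' (\<beta> - \<beta>') = 0"
      using \<alpha> \<beta> by (auto simp: D1.dcocycles_iff D2.dcocycles_iff intro: left right)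
    then have "?W \<alpha> \<beta> = ?W \<alpha>' \<beta>'"
      by (simp add: linear_diff[OF W.wed_left] linear_diff[OF W.wed_right])
    then show "wedge_pair I n p q \<alpha> \<beta> = wedge_pair I n p q \<alpha>' \<beta>'"
      by (simp add: wedge_pair_eq_wed)
  next
    fix \<alpha> assume \<alpha>: "\<alpha> \<in> dcocycles br rho J I p q"
      and orth: "\<forall>\<beta>\<in>dcocycles br ?rho' J ?I' (n - p) (n - q). wedge_pair I n p q \<alpha> \<beta> = (\<lambda>ys xs. 0)"
    show "\<alpha> \<in> dcoboundaries br rho J I p q"
      unfolding D1.dcoboundaries_iff
      by (rule W.exact_if_orthogonal_left[OF n])
        (use \<alpha> orth in \<open>auto simp: D1.dcocycles_iff D2.dcocycles_iff wedge0\<close>)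
  next
    fix \<beta> assume \<beta>: "\<beta> \<in> dcocycles br ?rho' J ?I' (n - p) (n - q)"
      and orth: "\<forall>\<alpha>\<in>dcocycles br rho J I p q. wedge_pair I n p q \<alpha> \<beta> = (\<lambda>ys xs. 0)"
    show "\<beta> \<in> dcoboundaries br ?rho' J ?I' (n - p) (n - q)"
      unfolding D2.dcoboundaries_iff
      by (rule W.exact_if_orthogonal_right[OF n])
        (use \<beta> orth in \<open>auto simp: D1.dcocycles_iff D2.dcocycles_iff wedge0\<close>)
  qed
qed

end
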